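(* Let $p$ be a probability density on $\mathbb{R}^d$, let $f:\mathbb{R}_+\to\mathbb{R}$, and let $(a,b)\in\mathbb{R}^2$. Let $k\in\mathbb{N}$ be fixed with $k>-2a$, and suppose that the estimator function $\phi_k$ of $f$ with parameter $k$ exists and satisfies $|\phi_k(u)|\le C\psi_{a,b}(u)$ for all $u>0$ and some constant $C$. Suppose that: (i) there exists $0<C_p<\infty$ with $p(x)\le C_p$ for almost every $x$; (ii) there exists $c_p>0$ with $p(x)\ge c_p$ for $x\in\operatorname{supp}(p)$; (iii) $\operatorname{supp}(p)$ is bounded; (iv) there exists $r>0$ such that $\displaystyle\inf_{x\in\operatorname{supp}(p)}\inf_{r'\in(0,r]}\frac{\mathrm{Leb}(B(x,r')\cap\operatorname{supp}(p))}{\mathrm{Leb}(B(x,r'))}>0$; (v) $p$ is $\sigma_p$-Hölder continuous over the interior of $\operatorname{supp}(p)$ for some $\sigma_p\in(0,2]$; (vi) the boundary of $\operatorname{supp}(p)$ has finite $(d-1)$-dimensional Hausdorff measure. Then, as $m\to\infty$, $$\mathbb{E}\Bigl[\bigl(\hat T_f^{(k)}(X_1,\ldots,X_m)-T_f(p)\bigr)^2\Bigr]=\tilde O\bigl(m^{-2\lambda(\sigma_p,a,k)}+m^{-1}\bigr),$$ where $$\lambda(\sigma,a,k)=\begin{cases}\frac1d(\sigma\wedge1)\frac{k+a}{k-1}&\text{if }a\le-\frac{\sigma}{d}-1,\\[2pt]\frac1d\bigl(\sigma\wedge\frac{k+a}{k-1}\bigr)&\text{if }-\frac{\sigma}{d}-1<a\le-1,\\[2pt]\frac1d(\sigma\wedge1)&\text{if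 }a>-1.\end{cases}$$
   Context: $\mathrm{Leb}$ is Lebesgue measure on $\mathbb{R}^d$ with Euclidean norm $\|\cdot\|$; $B(x,r)=\{y:\|x-y\|<r\}$. $P$ is the probability measure with density $p$, $\operatorname{supp}(p)=\{x:P(B(x,r))>0\ \forall r>0\}$, and $X_1,X_2,\ldots$ are i.i.d. with density $p$. For a finite set $A$, $r_k(x|A)$ is the distance from $x$ to its $k$-th nearest neighbor in $A$ (ties broken arbitrarily). $s\wedge t=\min\{s,t\}$. $F(m)=\tilde O(G(m))$ means $F(m)=O(G(m)(\ln G(m))^c)$ for some $c\in\mathbb{R}$ (i.e. $O$ up to polylogarithmic factors). Functional: $T_f(p)=\int f(p(x))p(x)\,dx$. Estimator function: $\phi_k(u)=\frac{\Gamma(k)}{u^{k-1}}\mathcal{L}^{-1}\{f(p)/p^k\}(u)$, where $\mathcal{L}^{-1}$ is the inverse of the one-sided Laplace transform; that is, $\phi_k:(0,\infty)\to\mathbb{R}$ is a function with $\int_0^\infty u^{k-1}\phi_k(u)e^{-su}\,du=\Gamma(k)f(s)/s^k$ for all $s>0$. Estimator: for $m\ge k+1$, $U_{km}(X_i)=(m-1)\,\mathrm{Leb}\bigl(B(X_i,r_k(X_i|\{X_j:j\ne i\}))\bigr)$ and $\hat T_f^{(k)}(X_1,\ldots,X_m)=\frac1m\sum_{i=1}^m\phi_k(U_{km}(X_i))$. Polynomial envelope: $\psi_{a,b}(u)=u^a$ for $0<u\le1$ and $\psi_{a,b}(u)=u^b$ for $u>1$. Hölder continuity: for $\sigma>0$,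 $g:\mathbb{R}^d\to\mathbb{R}$ is $\sigma$-Hölder continuous over an open set $\Omega$ if $g$ is continuously differentiable over $\Omega$ up to order $\kappa=\lceil\sigma\rceil-1$ and $\sup_{|\mathbf{r}|=\kappa}\sup_{y\ne z\in\Omega}\frac{|\partial^{\mathbf{r}}g(y)-\partial^{\mathbf{r}}g(z)|}{\|y-z\|^{\sigma-\kappa}}<\infty$, where $\mathbf{r}$ ranges over multi-indices in $\mathbb{Z}_+^d$. *)

theory Defs
  imports "HOL-Probability.Probability" "HOL-Library.Landau_Symbols"
begin

section \<open>Densities\<close>

definition prob_density :: "('a::euclidean_space \<Rightarrow> real) \<Rightarrow> bool" where
  "prob_density p \<longleftrightarrow>
     p \<in> borel_measurable borel \<and> (\<forall>x. 0 \<le> p x) \<and> (\<integral>\<^sup>+x. ennreal (p x) \<partial>lborel) = 1"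

definition density_measure :: "('a::euclidean_space \<Rightarrow> real) \<Rightarrow> 'a measure" where
  "density_measure p = density lborel (\<lambda>x. ennreal (p x))"

definition dsupp :: "('a::euclidean_space \<Rightarrow> real) \<Rightarrow> 'a set" where
  "dsupp p = {x. \<forall>r>0. measure (density_measure p) (ball x r) > 0}"

definition density_functional :: "(real \<Rightarrow> real) \<Rightarrow> ('a::euclidean_space \<Rightarrow> real) \<Rightarrow> real" where
  "density_functional f p = (\<integral>x. f (p x) * p x \<partial>lborel)"

section \<open>The k-nearest-neighbor estimator\<close>

text \<open>
  The distances to the points of the finite set \<open>A\<close> are listed in increasing order with
  repetitions, so equidistant points are counted separately. Meaningful for
  \<open>1 \<le> k \<le> card A\<close>.
\<close>
definition knn_dist :: "nat \<Rightarrow> 'a::metric_space \<Rightarrow> 'a set \<Rightarrow> real" where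
  "knn_dist k x A = sorted_list_of_multiset (image_mset (dist x) (mset_set A)) ! (k - 1)"

definition knn_volume :: "nat \<Rightarrow> nat \<Rightarrow> (nat \<Rightarrow> 'a::euclidean_space) \<Rightarrow> nat \<Rightarrow> real" where
  "knn_volume k m x i =
     (real m - 1) * measure lborel (ball (x i) (knn_dist k (x i) (x ` ({1..m} - {i}))))"

definition knn_estimator ::
    "(real \<Rightarrow> real) \<Rightarrow> nat \<Rightarrow> nat \<Rightarrow> (nat \<Rightarrow> 'a::euclidean_space) \<Rightarrow> real" where
  "knn_estimator \<phi> k m x = (\<Sum>i=1..m. \<phi> (knn_volume k m x i)) / real m"

text \<open>
  Integrability with respect to \<^term>\<open>lborel\<close> includes Borel measurability of \<open>\<phi>\<close> on
  \<open>(0, \<infinity>)\<close>.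
\<close>
definition is_estimator_function ::
    "(real \<Rightarrow> real) \<Rightarrow> nat \<Rightarrow> (real \<Rightarrow> real) \<Rightarrow> bool" where
  "is_estimator_function f k \<phi> \<longleftrightarrow>
     (\<forall>s>0. set_integrable lborel {0<..} (\<lambda>u. u ^ (k - 1) * \<phi> u * exp (- s * u)) \<and>
            (LINT u:{0<..}|lborel. u ^ (k - 1) * \<phi> u * exp (- s * u))
              = Gamma (real k) * f s / s ^ k)"

definition poly_envelope :: "real \<Rightarrow> real \<Rightarrow> real \<Rightarrow> real" where
  "poly_envelope a b u = (if u \<le> 1 then u powr a else u powr b)"

section \<open>Hoelder continuity\<close>

definition partial_deriv :: "'a \<Rightarrow> ('a::euclidean_space \<Rightarrow> real) \<Rightarrow> 'a \<Rightarrow> real" where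
  "partial_deriv v g x = deriv (\<lambda>t. g (x + t *\<^sub>R v)) 0"

primrec iter_partial :: "'a list \<Rightarrow> ('a::euclidean_space \<Rightarrow> real) \<Rightarrow> 'a \<Rightarrow> real" where
  "iter_partial [] g = g"
| "iter_partial (v # vs) g = partial_deriv v (iter_partial vs g)"

text \<open>All iterated partial derivatives of order at most \<open>n\<close>, taken in any order, exist and
  are continuous on \<open>S\<close>.\<close>
definition C_on :: "nat \<Rightarrow> ('a::euclidean_space \<Rightarrow> real) \<Rightarrow> 'a set \<Rightarrow> bool" where
  "C_on n g S \<longleftrightarrow>
     (\<forall>vs. set vs \<subseteq> Basis \<and> length vs \<le> n \<longrightarrow> continuous_on S (iter_partial vs g)) \<and>
     (\<forall>vs. set vs \<subseteq> Basis \<and> length vs < n \<longrightarrow>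
        (\<forall>v\<in>Basis. \<forall>x\<in>S. (\<lambda>t. iter_partial vs g (x + t *\<^sub>R v)) differentiable at 0))"

text \<open>
  A multi-index is a function \<open>r\<close> giving the order of differentiation in each basis direction.
  The choice of an order of differentiation is immaterial by the symmetry of mixed partial
  derivatives, as the operator is only applied to functions that are continuously
  differentiable up to the order of \<open>r\<close>.
\<close>
definition multi_partial :: "('a \<Rightarrow> nat) \<Rightarrow> ('a::euclidean_space \<Rightarrow> real) \<Rightarrow> 'a \<Rightarrow> real" where
  "multi_partial r g =
     iter_partial (SOME vs. set vs \<subseteq> Basis \<and> (\<forall>v\<in>Basis. count_list vs v = r v)) g"

definition hoelder_on :: "real \<Rightarrow> ('a::euclidean_space \<Rightarrow> real) \<Rightarrow> 'a set \<Rightarrow> bool" where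
  "hoelder_on \<sigma> g S \<longleftrightarrow>
     (let \<kappa> = nat (\<lceil>\<sigma>\<rceil> - 1) in
        C_on \<kappa> g S \<and>
        (\<exists>H. \<forall>r. (\<Sum>v\<in>Basis. r v) = \<kappa> \<longrightarrow>
           (\<forall>y\<in>S. \<forall>z\<in>S. y \<noteq> z \<longrightarrow>
              \<bar>multi_partial r g y - multi_partial r g z\<bar> / norm (y - z) powr (\<sigma> - real \<kappa>) \<le> H)))"

section \<open>Hausdorff measure\<close>

text \<open>
  Hausdorff (outer) measure of integer dimension \<open>n\<close>, without the normalizing constant
  that makes it agree with Lebesgue measure. The boundedness condition is needed because
  \<^const>\<open>diameter\<close> is unspecified on unbounded sets. Natural powers give a one-point
  set the weight \<open>1\<close> when \<open>n = 0\<close>, whereas empty sets always have weight \<open>0\<close>, so that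
  dimension \<open>0\<close> yields counting measure.
\<close>
definition hausdorff_premeasure :: "nat \<Rightarrow> real \<Rightarrow> 'a::metric_space set \<Rightarrow> ennreal" where
  "hausdorff_premeasure n \<delta> A =
     (INF U \<in> {U :: nat \<Rightarrow> 'a set. A \<subseteq> (\<Union>i. U i) \<and> (\<forall>i. bounded (U i) \<and> diameter (U i) \<le> \<delta>)}.
        \<Sum>i. if U i = {} then 0 else ennreal (diameter (U i) ^ n))"

definition hausdorff_measure :: "nat \<Rightarrow> 'a::metric_space set \<Rightarrow> ennreal" where
  "hausdorff_measure n A = (SUP \<delta>\<in>{0<..}. hausdorff_premeasure n \<delta> A)"

section \<open>Rates\<close>

text \<open>Orders up to polylogarithmic factors; the absolute value makes real powers of the
  logarithm meaningful when \<open>G\<close> tends to \<open>0\<close>.\<close>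
definition soft_O :: "(nat \<Rightarrow> real) \<Rightarrow> (nat \<Rightarrow> real) set" where
  "soft_O G = {F. \<exists>c::real. F \<in> O(\<lambda>m. G m * \<bar>ln (G m)\<bar> powr c)}"

definition rate_exponent :: "nat \<Rightarrow> real \<Rightarrow> real \<Rightarrow> nat \<Rightarrow> real" where
  "rate_exponent d \<sigma> a k =
     (if a \<le> - \<sigma> / real d - 1 then 1 / real d * (min \<sigma> 1 * ((real k + a) / (real k - 1)))
      else if a \<le> - 1 then 1 / real d * min \<sigma> ((real k + a) / (real k - 1))
      else 1 / real d * min \<sigma> 1)"

end

theory Submission
  imports Defs
begin

text \<open>
The squared error splits into variance and squared bias. The variance is \<open>O(1 / m)\<close> and the bias is
\<open>O(m powr (- min \<sigma> 1 / d))\<close>, \<open>d\<close> the dimension; since \<open>rate_exponent d \<sigma> a k \<le> min \<sigma> 1 / d\<close>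
(\<open>rate_exponent_bounds\<close>), this gives the claim.

Regularity of \<open>p\<close> enters only through its modulus of continuity in \<open>L1\<close>: after \<open>p\<close> is changed on a null
set, the integral of \<open>\<bar>p (x + h) - p x\<bar>\<close> over \<open>x\<close> is at most \<open>L * norm h powr min \<sigma> 1\<close>
(\<open>L1_modulus\<close>). If the segment from \<open>x\<close> to \<open>x + h\<close> stays in the interior of the support, the
integrand is controlled by Hoelder continuity; if it stays outside the support, the integrand vanishes.
Otherwise the segment meets the boundary, so \<open>x\<close> lies in the set swept by the boundary under translation along \<open>- h\<close>; covering the boundary by small sets shows
that the swept set has volume at most a constant times \<open>norm h\<close>. Sweeping along one vector is what
finite Hausdorff measure controls; the volume of a full neighbourhood of the boundary, which is its
Minkowski content, need not be of that order.

For the bias, condition on which sample point is the \<open>k\<close>-th nearest neighbour of \<open>x\<close>. With \<open>n = m - 1\<close>,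
if that point is \<open>y\<close>, then exactly \<open>k - 1\<close> of the others fall into the ball around \<open>x\<close> through \<open>y\<close>, which
gives a binomial weight; the mean of one summand is therefore a double integral over \<open>x\<close> and \<open>y\<close>
(\<open>nn_integral_knn_radius\<close>). The same double integral with \<open>p y\<close> replaced by \<open>p x\<close>, with \<open>p x\<close> times the
volume instead of the mass of the ball, and with a Poisson instead of the binomial weight is exactly
\<open>density_functional f p\<close>, by the Laplace transform that defines the estimator function
(\<open>integral_poisson_density\<close>). The difference of the two integrands is bounded by \<open>\<bar>p y - p x\<bar>\<close>, by the
oscillation of the mean of \<open>p\<close> over balls and by the error \<open>1 / n\<close> of the Poisson approximation, each times
a weight decaying exponentially in \<open>u\<close>, which is \<open>n\<close> times the volume of the ball
(\<open>density_diff_bound\<close>). Substituting \<open>y = x + h\<close> and integrating over \<open>x\<close> first brings in the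
\<open>L1\<close> modulus, and no regularity of \<open>p\<close> near the boundary is left to discuss. The exponential
decay in \<open>u\<close>, which absorbs the growth of the envelope at infinity, needs a lower bound for the mass of
balls centred in the support; that is where the bound below on \<open>p\<close> and the thickness of the support are
used. At \<open>u = 0\<close> the condition \<open>k > - 2 * a\<close> makes the second moments finite (\<open>wmoment_finite\<close>).

For the variance, remove one sample point. Besides its own summand, this affects only those whose centre has
the removed point among its \<open>k\<close> nearest neighbours, and changes them to their value at the \<open>k + 1\<close>-st
neighbour (\<open>kth_smallest_remove\<close>). By the classical cone argument the number of such centres is at most
a constant (\<open>card_reverse_neighbours\<close>). Hence the sum of the squared changes is at most a constant times
the sum of the squared summands at the \<open>k\<close>-th and \<open>k + 1\<close>-st neighbour (\<open>sum_remove_one_squared\<close>), and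
\<open>efron_stein\<close> concludes.
\<close>

section \<open>Swept sets and the L1 modulus of continuity\<close>

definition sweep :: "'a::euclidean_space \<Rightarrow> 'a set \<Rightarrow> 'a set" where
  "sweep h A = (\<lambda>(a, t). a + t *\<^sub>R h) ` (A \<times> {0..1::real})"

lemma compact_sweep: "compact A \<Longrightarrow> compact (sweep h A)"
  unfolding sweep_def
  by (intro compact_continuous_image compact_Times) (auto simp: case_prod_beta intro!: continuous_intros)

lemma sweep_subset: "A \<subseteq> sweep h A"
  by (force simp: sweep_def image_iff)

text \<open>
A set of diameter at most \<open>e\<close>, moved along \<open>h\<close>, is covered by balls of radius \<open>2 * e\<close> centred on the path
of one of its points; about \<open>norm h / e\<close> of them suffice.
\<close>
lemma emeasure_sweep_le_aux:
  fixes U :: "'a::euclidean_space set"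
  assumes U: "compact U" "diameter U \<le> e" "0 < e"
  shows "emeasure lborel (sweep h U)
    \<le> ennreal (unit_ball_vol (real DIM('a)) * 2 ^ DIM('a) * (norm h + 2 * e) * e ^ (DIM('a) - 1))"
proof (cases "U = {}")
  case True
  then show ?thesis by (simp add: sweep_def)
next
  case False
  then obtain a0 where a0: "a0 \<in> U" by blast
  define N where "N = nat \<lceil>norm h / e\<rceil>"
  let ?V = "unit_ball_vol (real DIM('a))"
  have N: "norm h / e \<le> real N" unfolding N_def by linarith
  have N2: "real N \<le> norm h / e + 1"
    unfolding N_def using U(3) by (simp add: of_nat_nat ceiling_le_iff)
  let ?B = "\<lambda>i. cball (a0 + (real i / real N) *\<^sub>R h) (2 * e)"
  have sub: "sweep h U \<subseteq> (\<Union>i\<in>{..N}. ?B i)"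
  proof
    fix y assume "y \<in> sweep h U"
    then obtain a t where at: "a \<in> U" "0 \<le> t" "t \<le> 1" "y = a + t *\<^sub>R h"
      by (auto simp: sweep_def)
    define i where "i = nat \<lfloor>t * real N\<rfloor>"
    have i1: "real i \<le> t * real N" "t * real N \<le> real i + 1"
      using at(2) unfolding i_def by (simp_all add: of_nat_nat)
    have "t * real N \<le> 1 * real N" using at by (intro mult_right_mono) auto
    then have "i \<le> N" using i1(1) by linarith
    have "\<bar>t - real i / real N\<bar> * norm h \<le> e"
    proof (cases "N = 0")
      case True
      then have "norm h / e \<le> 0" using N by simp
      then show ?thesis using U(3) by (simp add: divide_le_0_iff)
    next
      case False
      then have "\<bar>t - real i / real N\<bar> = \<bar>t * real N - real i\<bar> / real N"
        by (simp add: field_simps abs_divide)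
      also have "\<dots> \<le> 1 / real N" using i1 by (intro divide_right_mono) auto
      finally have "\<bar>t - real i / real N\<bar> * norm h \<le> 1 / real N * norm h"
        by (intro mult_right_mono) auto
      also have "\<dots> \<le> e" using N False U(3) by (simp add: field_simps)
      finally show ?thesis .
    qed
    moreover have "norm (a - a0) \<le> e"
      using diameter_bounded_bound[OF compact_imp_bounded[OF U(1)] at(1) a0] U(2) by (simp add: dist_norm)
    moreover have eq: "y - (a0 + (real i / real N) *\<^sub>R h) = (a - a0) + (t - real i / real N) *\<^sub>R h"
      by (simp add: at(4) algebra_simps)
    ultimately have "norm (y - (a0 + (real i / real N) *\<^sub>R h)) \<le> e + e"
      using norm_triangle_ineq[of "a - a0" "(t - real i / real N) *\<^sub>R h"]
      unfolding eq norm_scaleR by linarith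
    then have "y \<in> ?B i" by (simp add: dist_norm norm_minus_commute)
    then show "y \<in> (\<Union>i\<in>{..N}. ?B i)" using \<open>i \<le> N\<close> by blast
  qed
  have "emeasure lborel (sweep h U) \<le> emeasure lborel (\<Union>i\<in>{..N}. ?B i)"
    using sub by (intro emeasure_mono) (auto intro!: borel_closed closed_UN)
  also have "\<dots> \<le> (\<Sum>i\<in>{..N}. emeasure lborel (?B i))"
    by (intro emeasure_subadditive_finite) auto
  also have "\<dots> = (\<Sum>i\<in>{..N}. ennreal (?V * (2 * e) ^ DIM('a)))"
    using U(3) by (intro sum.cong refl emeasure_cball) auto
  also have "\<dots> = ennreal (real (N + 1) * (?V * (2 * e) ^ DIM('a)))"
    using U(3) by (subst ennreal_mult) (auto simp: ennreal_of_nat_eq_real_of_nat simp del: power_mult_distrib)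
  also have "\<dots> \<le> ennreal ((norm h / e + 2) * (?V * (2 * e) ^ DIM('a)))"
    using N2 U(3) by (intro ennreal_leI mult_right_mono) auto
  also have "(norm h / e + 2) * (?V * (2 * e) ^ DIM('a))
      = ?V * 2 ^ DIM('a) * (norm h + 2 * e) * e ^ (DIM('a) - 1)"
  proof -
    have "e ^ DIM('a) = e * e ^ (DIM('a) - 1)"
      using DIM_positive[where 'a='a] by (metis power_eq_if not_gr_zero mult.commute)
    then show ?thesis using U(3) by (simp add: power_mult_distrib field_simps)
  qed
  finally show ?thesis .
qed

text \<open>
The preceding bound, in the limit \<open>e \<rightarrow> diameter U\<close> from above. The limit is needed to
allow a singleton \<open>U\<close>; in dimension one its factor \<open>diameter U ^ 0\<close> is \<open>1\<close>, and it sweeps a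
segment of positive length.
\<close>
lemma emeasure_sweep_le:
  fixes U :: "'a::euclidean_space set"
  assumes U: "compact U"
  shows "emeasure lborel (sweep h U)
    \<le> ennreal (unit_ball_vol (real DIM('a)) * 2 ^ DIM('a) * (norm h + 2 * diameter U) * diameter U ^ (DIM('a) - 1))"
proof -
  let ?c = "unit_ball_vol (real DIM('a)) * 2 ^ DIM('a)"
  let ?e = "\<lambda>n. diameter U + 1 / real (Suc n)"
  have d0: "0 \<le> diameter U" using U by (intro diameter_ge_0 compact_imp_bounded)
  have e: "?e \<longlonglongrightarrow> diameter U"
    using tendsto_add[OF tendsto_const LIMSEQ_inverse_real_of_nat, of "diameter U"]
    by (simp add: inverse_eq_divide)
  have "(\<lambda>n. ennreal (?c * (norm h + 2 * ?e n) * ?e n ^ (DIM('a) - 1)))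
     \<longlonglongrightarrow> ennreal (?c * (norm h + 2 * diameter U) * diameter U ^ (DIM('a) - 1))"
    using d0 by (intro tendsto_ennrealI tendsto_intros e)
  moreover have "emeasure lborel (sweep h U) \<le> ennreal (?c * (norm h + 2 * ?e n) * ?e n ^ (DIM('a) - 1))" for n
    using d0 by (intro emeasure_sweep_le_aux U) (auto intro: add_nonneg_pos)
  ultimately show ?thesis by (intro LIMSEQ_le_const) auto
qed

text \<open>
The cover in the definition of the Hausdorff measure is taken with mesh \<open>norm h\<close>, so that sweeping each of
its members costs at most \<open>3 * norm h\<close> times its contribution to the Hausdorff sum.
\<close>
lemma emeasure_sweep_hausdorff:
  fixes A :: "'a::euclidean_space set"
  assumes A: "compact A" and H: "hausdorff_measure (DIM('a) - 1) A < \<infinity>"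
  shows "\<exists>C\<ge>0. \<forall>h. emeasure lborel (sweep h A) \<le> ennreal (C * norm h)"
proof -
  let ?n = "DIM('a) - 1"
  let ?c = "unit_ball_vol (real DIM('a)) * 2 ^ DIM('a)"
  have c0: "0 \<le> ?c" by simp
  obtain H0 where H0: "0 \<le> H0" "hausdorff_measure ?n A = ennreal H0"
    using H by (metis ennreal_cases infinity_ennreal_def less_irrefl)
  have main: "emeasure lborel (sweep h A) \<le> ennreal (?c * 3 * (H0 + 1) * norm h)" if h: "h \<noteq> 0" for h :: 'a
  proof -
    have hp: "0 < norm h" using h by simp
    have "hausdorff_premeasure ?n (norm h) A \<le> hausdorff_measure ?n A"
      unfolding hausdorff_measure_def using hp by (intro SUP_upper) auto
    also have "\<dots> < ennreal (H0 + 1)" using H0 by (simp add: ennreal_less_iff)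
    finally obtain U :: "nat \<Rightarrow> 'a set" where U: "A \<subseteq> (\<Union>i. U i)" "\<And>i. bounded (U i)" "\<And>i. diameter (U i) \<le> norm h"
      and sum: "(\<Sum>i. if U i = {} then 0 else ennreal (diameter (U i) ^ ?n)) < ennreal (H0 + 1)"
      unfolding hausdorff_premeasure_def INF_less_iff by auto
    have cU: "compact (closure (U i))" for i using U(2) by (simp add: compact_closure)
    have "sweep h A \<subseteq> (\<Union>i. sweep h (closure (U i)))"
    proof
      fix y assume "y \<in> sweep h A"
      then obtain a t where at: "a \<in> A" "t \<in> {0..1}" "y = a + t *\<^sub>R h" by (auto simp: sweep_def)
      then obtain i where "a \<in> closure (U i)" using U(1) closure_subset by blast
      then have "y \<in> sweep h (closure (U i))" using at by (force simp: sweep_def)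
      then show "y \<in> (\<Union>i. sweep h (closure (U i)))" by blast
    qed
    then have "emeasure lborel (sweep h A) \<le> emeasure lborel (\<Union>i. sweep h (closure (U i)))"
      using compact_sweep[OF cU, of h]
      by (intro emeasure_mono) (simp_all add: sets.countable_UN borel_compact image_subset_iff)
    also have "\<dots> \<le> (\<Sum>i. emeasure lborel (sweep h (closure (U i))))"
      using compact_sweep[OF cU, of h]
      by (intro emeasure_subadditive_countably) (auto intro!: borel_compact)
    also have "\<dots> \<le> (\<Sum>i. ennreal (?c * 3 * norm h) * (if U i = {} then 0 else ennreal (diameter (U i) ^ ?n)))"
    proof (intro suminf_le summableI)
      fix i
      show "emeasure lborel (sweep h (closure (U i)))
        \<le> ennreal (?c * 3 * norm h) * (if U i = {} then 0 else ennreal (diameter (U i) ^ ?n))"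
      proof (cases "U i = {}")
        case True
        then show ?thesis by (simp add: sweep_def)
      next
        case False
        have d0: "0 \<le> diameter (U i)" using U(2) by (rule diameter_ge_0)
        have "emeasure lborel (sweep h (closure (U i)))
          \<le> ennreal (?c * (norm h + 2 * diameter (U i)) * diameter (U i) ^ ?n)"
          using emeasure_sweep_le[OF cU[of i], of h] by (simp add: diameter_closure[OF U(2)])
        also have "\<dots> \<le> ennreal (?c * (3 * norm h) * diameter (U i) ^ ?n)"
          using U(3)[of i] d0 by (intro ennreal_leI mult_right_mono mult_left_mono) auto
        also have "\<dots> = ennreal (?c * 3 * norm h) * ennreal (diameter (U i) ^ ?n)"
          using d0 by (subst ennreal_mult[symmetric]) (auto simp: mult.assoc)
        finally show ?thesis using False by simp
      qed
    qed
    also have "\<dots> = ennreal (?c * 3 * norm h) * (\<Sum>i. if U i = {} then 0 else ennreal (diameter (U i) ^ ?n))"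
      by (rule ennreal_suminf_cmult)
    also have "\<dots> \<le> ennreal (?c * 3 * norm h) * ennreal (H0 + 1)"
      using sum by (intro mult_left_mono) auto
    also have "\<dots> = ennreal (?c * 3 * (H0 + 1) * norm h)"
      using H0 by (subst ennreal_mult[symmetric]) (auto simp: mult_ac)
    finally show ?thesis .
  qed
  let ?C = "?c * 3 * (H0 + 1)"
  have C0: "0 \<le> ?C" using c0 H0 by simp
  have "emeasure lborel A \<le> ennreal e" if "e > 0" for e :: real
  proof -
    obtain b :: 'a where b: "b \<in> Basis" using nonempty_Basis by blast
    let ?h = "(e / (?C + 1)) *\<^sub>R b"
    have h: "?h \<noteq> 0" using that C0 b by (auto simp: add_nonneg_eq_0_iff)
    have "emeasure lborel A \<le> emeasure lborel (sweep ?h A)"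
      using sweep_subset compact_sweep[OF A] by (intro emeasure_mono) (auto intro: borel_compact)
    also have "\<dots> \<le> ennreal (?C * norm ?h)" by (rule main[OF h])
    also have "?C * norm ?h \<le> e" using that C0 b by (simp add: field_simps)
    finally show ?thesis by (simp add: ennreal_leI)
  qed
  then have A0: "emeasure lborel A = 0"
    by (metis ennreal_le_epsilon ennreal_0 le_zero_eq add_0)
  have "sweep 0 A \<subseteq> A" by (auto simp: sweep_def)
  then have "sweep 0 A = A" using sweep_subset[of A 0] by blast
  then have "emeasure lborel (sweep h A) \<le> ennreal (?C * norm h)" for h
    using main[of h] A0 by (cases "h = 0") auto
  then show ?thesis using C0 by blast
qed

lemma nn_integral_lborel_shift:
  fixes f :: "'a::euclidean_space \<Rightarrow> ennreal"
  assumes [measurable]: "f \<in> borel_measurable borel"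
  shows "(\<integral>\<^sup>+x. f (x + c) \<partial>lborel) = (\<integral>\<^sup>+x. f x \<partial>lborel)"
proof -
  have "(\<integral>\<^sup>+x. f x \<partial>lborel) = (\<integral>\<^sup>+x. f x \<partial>distr lborel borel ((+) c))"
    by (simp only: lborel_distr_plus)
  also have "\<dots> = (\<integral>\<^sup>+x. f (c + x) \<partial>lborel)" by (subst nn_integral_distr) auto
  finally show ?thesis by (simp add: add.commute)
qed

text \<open>
Along a basis direction, a point either belongs to the set swept by the boundary, or the whole segment lies
in the interior of \<open>S\<close> or outside \<open>S\<close>. A general translation is a sum of translations along
the basis, each of which preserves Lebesgue measure. Working along the basis means that only partial
derivatives have to be bounded.
\<close>
lemma L1_modulus:
  fixes q :: "'a::euclidean_space \<Rightarrow> real"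
  assumes q [measurable]: "q \<in> borel_measurable borel" and q0: "\<And>x. 0 \<le> q x" and qC: "\<And>x. q x \<le> Cq"
    and qS: "\<And>x. x \<notin> S \<Longrightarrow> q x = 0" and q1: "(\<integral>\<^sup>+x. ennreal (q x) \<partial>lborel) = 1"
    and S: "compact S" and H: "hausdorff_measure (DIM('a) - 1) (frontier S) < \<infinity>"
    and s: "0 < s" "s \<le> 1" and L: "0 \<le> L"
    and dir: "\<And>b t x. b \<in> Basis \<Longrightarrow> closed_segment x (x + t *\<^sub>R b) \<subseteq> interior S \<Longrightarrow>
       \<bar>q (x + t *\<^sub>R b) - q x\<bar> \<le> L * \<bar>t\<bar> powr s"
  shows "\<exists>C\<ge>0. \<forall>h. (\<integral>\<^sup>+x. ennreal \<bar>q (x + h) - q x\<bar> \<partial>lborel) \<le> ennreal (C * norm h powr s)"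
proof -
  have "compact (frontier S)" using S by (rule compact_frontier)
  from emeasure_sweep_hausdorff[OF this H] obtain C1 where
    C1: "0 \<le> C1" "\<And>h. emeasure lborel (sweep h (frontier S)) \<le> ennreal (C1 * norm h)" by blast
  have Cq: "0 \<le> Cq" using q0 qC order_trans by blast
  have [measurable]: "S \<in> sets borel" using S by (rule borel_compact)
  have Sfin: "emeasure lborel S = ennreal (measure lborel S)"
    using emeasure_compact_finite[OF S] by (simp add: emeasure_eq_ennreal_measure)
  define K where "K = max 2 (Cq * C1 + L * measure lborel S)"
  have K0: "0 \<le> K" by (simp add: K_def)
  have one: "(\<integral>\<^sup>+x. ennreal \<bar>q (x + t *\<^sub>R b) - q x\<bar> \<partial>lborel) \<le> ennreal (K * \<bar>t\<bar> powr s)"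
    if b: "b \<in> Basis" for b t
  proof -
    let ?h = "t *\<^sub>R b"
    \<comment> \<open>Twice the total mass bounds the integral for long shifts; the geometry matters for short ones.\<close>
    consider "t = 0" | "\<bar>t\<bar> \<ge> 1" | "t \<noteq> 0" "\<bar>t\<bar> < 1" by linarith
    then show ?thesis
    proof cases
      case 2
      have "(\<integral>\<^sup>+x. ennreal \<bar>q (x + ?h) - q x\<bar> \<partial>lborel) \<le> (\<integral>\<^sup>+x. ennreal (q (x + ?h)) + ennreal (q x) \<partial>lborel)"
      proof (intro nn_integral_mono)
        fix x
        have "\<bar>q (x + ?h) - q x\<bar> \<le> q (x + ?h) + q x" using q0[of x] q0[of "x + ?h"] by linarith
        then show "ennreal \<bar>q (x + ?h) - q x\<bar> \<le> ennreal (q (x + ?h)) + ennreal (q x)"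
          using q0 by (simp add: ennreal_plus[symmetric] ennreal_leI del: ennreal_plus)
      qed
      also have "\<dots> = 2" using q1 nn_integral_lborel_shift[of "\<lambda>x. ennreal (q x)" ?h]
        by (subst nn_integral_add) auto
      also have "2 = ennreal 2" by simp
      also have "\<dots> \<le> ennreal (K * \<bar>t\<bar> powr s)"
      proof (intro ennreal_leI)
        have "1 \<le> \<bar>t\<bar> powr s" using 2 s by (simp add: ge_one_powr_ge_zero)
        then have "2 * 1 \<le> K * \<bar>t\<bar> powr s" by (intro mult_mono) (auto simp: K_def)
        then show "2 \<le> K * \<bar>t\<bar> powr s" by simp
      qed
      finally show ?thesis .
    next
      case 3
      let ?W = "sweep (- ?h) (frontier S)"
      have W: "?W \<in> sets borel" using compact_sweep[OF compact_frontier[OF S]] by (rule borel_compact)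
      have pt: "ennreal \<bar>q (x + ?h) - q x\<bar> \<le> ennreal Cq * indicator ?W x + ennreal (L * \<bar>t\<bar> powr s) * indicator S x" for x
      proof (cases "x \<in> ?W")
        case True
        have "\<bar>q (x + ?h) - q x\<bar> \<le> Cq" using q0[of x] qC[of x] q0[of "x + ?h"] qC[of "x + ?h"] by auto
        then have "ennreal \<bar>q (x + ?h) - q x\<bar> \<le> ennreal Cq * indicator ?W x" using True by (simp add: ennreal_leI)
        then show ?thesis by (rule order_trans) simp
      next
        case False
        have no: "closed_segment x (x + ?h) \<inter> frontier S = {}"
        proof (rule ccontr)
          assume "\<not> ?thesis"
          then obtain u where u: "0 \<le> u" "u \<le> 1" "(1 - u) *\<^sub>R x + u *\<^sub>R (x + ?h) \<in> frontier S"
            by (auto simp: closed_segment_def)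
          then have "x + u *\<^sub>R ?h \<in> frontier S" by (simp add: algebra_simps)
          moreover have "x = (x + u *\<^sub>R ?h) + u *\<^sub>R (- ?h)" by simp
          ultimately have "x \<in> ?W" using u unfolding sweep_def by (intro image_eqI[of _ _ "(x + u *\<^sub>R ?h, u)"]) auto
          with False show False by simp
        qed
        show ?thesis
        proof (cases "closed_segment x (x + ?h) \<inter> S = {}")
          case True
          then have "q x = 0" "q (x + ?h) = 0" using qS by (auto simp: disjoint_iff)
          then show ?thesis by simp
        next
          case meet: False
          have "closed_segment x (x + ?h) - S = {}"
            using connected_Int_frontier[OF connected_segment(1) meet] no by blast
          then have "closed_segment x (x + ?h) \<subseteq> interior S"
            using no by (auto simp: frontier_def compact_imp_closed[OF S] closure_closed)
          then have "\<bar>q (x + ?h) - q x\<bar> \<le> L * \<bar>t\<bar> powr s" "x \<in> S"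
            using dir[OF b] interior_subset[of S] by auto
          then have "ennreal \<bar>q (x + ?h) - q x\<bar> \<le> ennreal (L * \<bar>t\<bar> powr s) * indicator S x"
            by (simp add: ennreal_leI)
          then show ?thesis by (rule order_trans) simp
        qed
      qed
      have "(\<integral>\<^sup>+x. ennreal \<bar>q (x + ?h) - q x\<bar> \<partial>lborel)
        \<le> (\<integral>\<^sup>+x. ennreal Cq * indicator ?W x + ennreal (L * \<bar>t\<bar> powr s) * indicator S x \<partial>lborel)"
        by (intro nn_integral_mono pt)
      also have "\<dots> = ennreal Cq * emeasure lborel ?W + ennreal (L * \<bar>t\<bar> powr s) * emeasure lborel S"
        using W by (subst nn_integral_add) (auto simp: nn_integral_cmult)
      also have "\<dots> \<le> ennreal Cq * ennreal (C1 * \<bar>t\<bar>) + ennreal (L * \<bar>t\<bar> powr s) * ennreal (measure lborel S)"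
        using C1(2)[of "- ?h"] b by (intro add_mono mult_left_mono) (auto simp: Sfin)
      also have "\<dots> = ennreal (Cq * (C1 * \<bar>t\<bar>) + L * \<bar>t\<bar> powr s * measure lborel S)"
        using Cq C1(1) L by (simp add: ennreal_mult ennreal_plus)
      also have "\<dots> \<le> ennreal (K * \<bar>t\<bar> powr s)"
      proof (intro ennreal_leI)
        have "\<bar>t\<bar> powr 1 \<le> \<bar>t\<bar> powr s" using 3 s by (intro powr_mono') auto
        then have "Cq * (C1 * \<bar>t\<bar>) \<le> Cq * (C1 * \<bar>t\<bar> powr s)"
          using 3 Cq C1(1) by (intro mult_left_mono) auto
        then have "Cq * (C1 * \<bar>t\<bar>) + L * \<bar>t\<bar> powr s * measure lborel S
          \<le> (Cq * C1 + L * measure lborel S) * \<bar>t\<bar> powr s" by (simp add: algebra_simps)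
        also have "\<dots> \<le> K * \<bar>t\<bar> powr s" by (intro mult_right_mono) (auto simp: K_def)
        finally show "Cq * (C1 * \<bar>t\<bar>) + L * \<bar>t\<bar> powr s * measure lborel S \<le> K * \<bar>t\<bar> powr s" .
      qed
      finally show ?thesis .
    qed simp
  qed
  have multi: "(\<integral>\<^sup>+x. ennreal \<bar>q (x + (\<Sum>b\<in>F. (h \<bullet> b) *\<^sub>R b)) - q x\<bar> \<partial>lborel) \<le> ennreal (real (card F) * (K * norm h powr s))"
    if "F \<subseteq> Basis" for F and h :: 'a
    using finite_subset[OF that finite_Basis] that
  proof (induction F rule: finite_induct)
    case (insert b F)
    let ?v = "(h \<bullet> b) *\<^sub>R b" and ?w = "\<Sum>b\<in>F. (h \<bullet> b) *\<^sub>R b"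
    have "(\<integral>\<^sup>+x. ennreal \<bar>q (x + (\<Sum>b\<in>insert b F. (h \<bullet> b) *\<^sub>R b)) - q x\<bar> \<partial>lborel)
       = (\<integral>\<^sup>+x. ennreal \<bar>q ((x + ?w) + ?v) - q x\<bar> \<partial>lborel)"
      using insert by (intro nn_integral_cong) (simp add: add_ac)
    also have "\<dots> \<le> (\<integral>\<^sup>+x. ennreal \<bar>q ((x + ?w) + ?v) - q (x + ?w)\<bar> + ennreal \<bar>q (x + ?w) - q x\<bar> \<partial>lborel)"
      by (intro nn_integral_mono) (auto simp: ennreal_plus[symmetric] simp del: ennreal_plus intro!: ennreal_leI)
    also have "\<dots> = (\<integral>\<^sup>+x. ennreal \<bar>q ((x + ?w) + ?v) - q (x + ?w)\<bar> \<partial>lborel) + (\<integral>\<^sup>+x. ennreal \<bar>q (x + ?w) - q x\<bar> \<partial>lborel)"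
      by (intro nn_integral_add) auto
    also have "(\<integral>\<^sup>+x. ennreal \<bar>q ((x + ?w) + ?v) - q (x + ?w)\<bar> \<partial>lborel) = (\<integral>\<^sup>+x. ennreal \<bar>q (x + ?v) - q x\<bar> \<partial>lborel)"
      using nn_integral_lborel_shift[of "\<lambda>x. ennreal \<bar>q (x + ?v) - q x\<bar>" ?w] by simp
    also have "\<dots> \<le> ennreal (K * \<bar>h \<bullet> b\<bar> powr s)" using one insert by simp
    also have "\<dots> \<le> ennreal (K * norm h powr s)"
      using Basis_le_norm[of b h] insert s K0 by (intro ennreal_leI mult_left_mono powr_mono2) auto
    also have "(\<integral>\<^sup>+x. ennreal \<bar>q (x + ?w) - q x\<bar> \<partial>lborel) \<le> ennreal (real (card F) * (K * norm h powr s))"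
      using insert by simp
    finally have "(\<integral>\<^sup>+x. ennreal \<bar>q (x + (\<Sum>b\<in>insert b F. (h \<bullet> b) *\<^sub>R b)) - q x\<bar> \<partial>lborel)
       \<le> ennreal (K * norm h powr s) + ennreal (real (card F) * (K * norm h powr s))"
      by (simp add: add_mono)
    also have "\<dots> = ennreal (real (card (insert b F)) * (K * norm h powr s))"
      using insert K0 by (simp add: ennreal_plus[symmetric] algebra_simps del: ennreal_plus)
    finally show ?case .
  qed simp
  have "(\<integral>\<^sup>+x. ennreal \<bar>q (x + h) - q x\<bar> \<partial>lborel) \<le> ennreal (real DIM('a) * K * norm h powr s)" for h :: 'a
    using multi[OF order_refl, of h] by (simp add: euclidean_representation mult.assoc)
  then show ?thesis using K0 by (intro exI[of _ "real DIM('a) * K"]) auto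
qed

text \<open>
For \<open>\<sigma> > 1\<close> the partial derivatives are Hoelder continuous on a bounded set, hence bounded, and the mean
value theorem gives a Lipschitz bound along segments. It does not extend to pairs of points whose
segment leaves \<open>G\<close>.
\<close>
lemma hoelder_on_directional:
  fixes p :: "'a::euclidean_space \<Rightarrow> real"
  assumes ho: "hoelder_on \<sigma> p G" and \<sigma>: "0 < \<sigma>" "\<sigma> \<le> 2" and G: "bounded G"
  shows "\<exists>L\<ge>0. \<forall>b\<in>Basis. \<forall>t x. closed_segment x (x + t *\<^sub>R b) \<subseteq> G \<longrightarrow>
     \<bar>p (x + t *\<^sub>R b) - p x\<bar> \<le> L * \<bar>t\<bar> powr (min \<sigma> 1)"
proof (cases "\<sigma> \<le> 1")
  case True
  then have \<kappa>: "nat (\<lceil>\<sigma>\<rceil> - 1) = 0" by (simp add: ceiling_le_iff)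
  obtain H where H: "\<And>r y z. (\<Sum>v\<in>Basis. r v) = 0 \<Longrightarrow> y \<in> G \<Longrightarrow> z \<in> G \<Longrightarrow> y \<noteq> z \<Longrightarrow>
       \<bar>multi_partial r p y - multi_partial r p z\<bar> / norm (y - z) powr \<sigma> \<le> H"
    using ho unfolding hoelder_on_def Let_def \<kappa> of_nat_0 diff_zero by blast
  \<comment> \<open>The order of differentiation is an arbitrary choice in \<open>multi_partial\<close>, but for orders zero and
      one there is only one list to choose.\<close>
  have "(SOME vs::'a list. set vs \<subseteq> Basis \<and> (\<forall>v\<in>Basis. count_list vs v = 0)) = []"
  proof (rule some_equality)
    fix vs :: "'a list" assume vs: "set vs \<subseteq> Basis \<and> (\<forall>v\<in>Basis. count_list vs v = 0)"
    then have "\<forall>v\<in>set vs. v \<notin> set vs" by (meson count_list_0_iff subsetD)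
    then show "vs = []" by (cases vs) auto
  qed simp
  then have mp: "multi_partial (\<lambda>_. 0) p = p" by (simp add: multi_partial_def)
  have "\<bar>p (x + t *\<^sub>R b) - p x\<bar> \<le> max 0 H * \<bar>t\<bar> powr \<sigma>"
    if "b \<in> Basis" "closed_segment x (x + t *\<^sub>R b) \<subseteq> G" for b t x
  proof (cases "t = 0")
    case False
    then have ne: "x + t *\<^sub>R b \<noteq> x" using that nonzero_Basis by auto
    have "x \<in> G" "x + t *\<^sub>R b \<in> G" using that by auto
    from H[of "\<lambda>_. 0", OF _ this(2,1) ne] have "\<bar>p (x + t *\<^sub>R b) - p x\<bar> / \<bar>t\<bar> powr \<sigma> \<le> H"
      using that by (simp add: mp)
    then have "\<bar>p (x + t *\<^sub>R b) - p x\<bar> \<le> H * \<bar>t\<bar> powr \<sigma>" using False by (simp add: divide_le_eq)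
    also have "\<dots> \<le> max 0 H * \<bar>t\<bar> powr \<sigma>" by (intro mult_right_mono) auto
    finally show ?thesis .
  qed simp
  then show ?thesis using True by (intro exI[of _ "max 0 H"]) (auto simp: min_def)
next
  case False
  then have "\<lceil>\<sigma>\<rceil> = 2" using \<sigma> by (intro ceiling_unique) auto
  then have \<kappa>: "nat (\<lceil>\<sigma>\<rceil> - 1) = 1" by simp
  obtain H where H: "\<And>r y z. (\<Sum>v\<in>Basis. r v) = 1 \<Longrightarrow> y \<in> G \<Longrightarrow> z \<in> G \<Longrightarrow> y \<noteq> z \<Longrightarrow>
       \<bar>multi_partial r p y - multi_partial r p z\<bar> / norm (y - z) powr (\<sigma> - 1) \<le> H"
    and C1: "C_on 1 p G"
    using ho unfolding hoelder_on_def Let_def \<kappa> by auto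
  have mp: "multi_partial (\<lambda>v. if v = b then 1 else 0) p = partial_deriv b p" if b: "b \<in> Basis" for b :: 'a
  proof -
    have "(SOME vs::'a list. set vs \<subseteq> Basis \<and> (\<forall>v\<in>Basis. count_list vs v = (if v = b then 1 else 0))) = [b]"
    proof (rule some_equality)
      fix vs :: "'a list" assume vs: "set vs \<subseteq> Basis \<and> (\<forall>v\<in>Basis. count_list vs v = (if v = b then 1 else 0))"
      then have "length vs = (\<Sum>v\<in>Basis. count_list vs v)"
        using sum_count_set[of vs Basis] by simp
      also have "\<dots> = (\<Sum>v\<in>Basis. if v = b then 1 else 0)" using vs by (intro sum.cong) auto
      also have "\<dots> = 1" using b by simp
      finally obtain v where v: "vs = [v]" by (auto simp: length_Suc_conv)
      have "count_list vs b = 1" using vs b by auto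
      then show "vs = [b]" using v by (auto split: if_splits)
    qed (use b in auto)
    then show ?thesis by (simp add: multi_partial_def)
  qed
  have diff: "(\<lambda>t. p (x + t *\<^sub>R b)) differentiable at 0" if "b \<in> Basis" "x \<in> G" for b x
    using C1 that unfolding C_on_def by (metis iter_partial.simps(1) empty_subsetI list.set(1) list.size(3) zero_less_one)
  have "\<exists>B\<ge>0. \<forall>x\<in>G. \<bar>partial_deriv b p x\<bar> \<le> B" if b: "b \<in> Basis" for b
  proof (cases "G = {}")
    case False
    then obtain z0 where z0: "z0 \<in> G" by blast
    have "\<bar>partial_deriv b p x\<bar> \<le> \<bar>partial_deriv b p z0\<bar> + max 0 H * diameter G powr (\<sigma> - 1)" if x: "x \<in> G" for x
    proof (cases "x = z0")
      case False
      have "(\<Sum>v\<in>Basis. (if v = b then 1 else 0::nat)) = 1" using b by simp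
      from H[OF this x z0 False] have "\<bar>partial_deriv b p x - partial_deriv b p z0\<bar> / norm (x - z0) powr (\<sigma> - 1) \<le> H"
        by (simp add: mp[OF b])
      then have "\<bar>partial_deriv b p x - partial_deriv b p z0\<bar> \<le> H * norm (x - z0) powr (\<sigma> - 1)"
        using False by (simp add: divide_le_eq)
      also have "\<dots> \<le> max 0 H * diameter G powr (\<sigma> - 1)"
        using diameter_bounded_bound[OF G x z0] \<open>\<not> \<sigma> \<le> 1\<close>
        by (intro mult_mono powr_mono2) (auto simp: dist_norm)
      finally show ?thesis by linarith
    qed simp
    then show ?thesis by (intro exI[of _ "\<bar>partial_deriv b p z0\<bar> + max 0 H * diameter G powr (\<sigma> - 1)"]) auto
  qed auto
  then obtain B where B: "\<And>b. b \<in> Basis \<Longrightarrow> 0 \<le> B b" "\<And>b x. b \<in> Basis \<Longrightarrow> x \<in> G \<Longrightarrow> \<bar>partial_deriv b p x\<bar> \<le> B b"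
    by metis
  have "\<bar>p (x + t *\<^sub>R b) - p x\<bar> \<le> sum B Basis * \<bar>t\<bar>"
    if b: "b \<in> Basis" and seg: "closed_segment x (x + t *\<^sub>R b) \<subseteq> G" for b t x
  proof -
    have mem: "x + u *\<^sub>R b \<in> G" if u: "u \<in> closed_segment 0 t" for u
    proof -
      obtain w where w: "0 \<le> w" "w \<le> 1" "u = w * t" using u by (auto simp: closed_segment_def)
      have "x + u *\<^sub>R b = (1 - w) *\<^sub>R x + w *\<^sub>R (x + t *\<^sub>R b)" by (simp add: w algebra_simps)
      then show ?thesis using seg w by (auto simp: closed_segment_def)
    qed
    have der: "((\<lambda>u. p (x + u *\<^sub>R b)) has_field_derivative partial_deriv b p (x + u *\<^sub>R b)) (at u within closed_segment 0 t)"
      if u: "u \<in> closed_segment 0 t" for u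
    proof -
      have "((\<lambda>v. p ((x + u *\<^sub>R b) + v *\<^sub>R b)) has_field_derivative partial_deriv b p (x + u *\<^sub>R b)) (at 0)"
        using diff[OF b mem[OF u]] unfolding partial_deriv_def
        by (simp add: DERIV_deriv_iff_real_differentiable)
      then have "((\<lambda>v. p (x + (v + u) *\<^sub>R b)) has_field_derivative partial_deriv b p (x + u *\<^sub>R b)) (at 0)"
        by (simp add: algebra_simps)
      then have "((\<lambda>v. p (x + v *\<^sub>R b)) has_field_derivative partial_deriv b p (x + u *\<^sub>R b)) (at (0 + u))"
        by (subst DERIV_shift)
      then show ?thesis by (simp add: has_field_derivative_at_within)
    qed
    have "norm (p (x + t *\<^sub>R b) - p (x + 0 *\<^sub>R b)) \<le> B b * norm (t - 0)"
      by (rule field_differentiable_bound[where S = "closed_segment 0 t" and f' = "\<lambda>u. partial_deriv b p (x + u *\<^sub>R b)"])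
         (use der mem B b in auto)
    also have "\<dots> \<le> sum B Basis * \<bar>t\<bar>"
      using B(1) b by (auto intro!: mult_right_mono member_le_sum)
    finally show ?thesis by simp
  qed
  then show ?thesis using False B(1) by (intro exI[of _ "sum B Basis"]) (auto simp: min_def sum_nonneg)
qed

section \<open>Order statistics\<close>

text \<open>
This has the shape of \<open>knn_dist\<close>, except that the values are indexed by \<open>J\<close>: equal values with
different indices are kept apart, while coinciding sample points collapse in the set that \<open>knn_dist\<close> sees.
\<close>
definition kth_smallest :: "nat \<Rightarrow> ('i \<Rightarrow> real) \<Rightarrow> 'i set \<Rightarrow> real" where
  "kth_smallest k d J = sorted_list_of_multiset (image_mset d (mset_set J)) ! (k - 1)"

lemma sorted_nth_le_iff:
  fixes xs :: "real list"
  assumes "sorted xs" "i < length xs"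
  shows "xs ! i \<le> t \<longleftrightarrow> i < length (filter (\<lambda>x. x \<le> t) xs)"
    and "xs ! i < t \<longleftrightarrow> i < length (filter (\<lambda>x. x < t) xs)"
  using assms
proof (induction xs arbitrary: i)
  case (Cons x xs)
  { case 1
    show ?case
    proof (cases i)
      case 0
      have "\<forall>y\<in>set xs. x \<le> y" using 1 by simp
      then show ?thesis using 0 by (auto simp: filter_empty_conv)
    next
      case (Suc j)
      have le: "\<forall>y\<in>set xs. x \<le> y" using 1 by simp
      have "xs ! j \<in> set xs" using 1 Suc by simp
      then have *: "x \<le> xs ! j" using le by blast
      have "filter (\<lambda>x. x \<le> t) xs = []" if "\<not> x \<le> t"
        using le that by (force simp: filter_empty_conv)
      then show ?thesis using Suc 1 Cons.IH(1)[of j] * by auto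
    qed }
  { case 2
    show ?case
    proof (cases i)
      case 0
      have "\<forall>y\<in>set xs. x \<le> y" using 2 by simp
      then show ?thesis using 0 by (auto simp: filter_empty_conv)
    next
      case (Suc j)
      have le: "\<forall>y\<in>set xs. x \<le> y" using 2 by simp
      have "xs ! j \<in> set xs" using 2 Suc by simp
      then have *: "x \<le> xs ! j" using le by blast
      have "filter (\<lambda>x. x < t) xs = []" if "\<not> x < t"
        using le that by (force simp: filter_empty_conv)
      then show ?thesis using Suc 2 Cons.IH(2)[of j] * by auto
    qed }
qed auto

lemma length_filter_sorted_image:
  assumes "finite J"
  shows "length (filter P (sorted_list_of_multiset (image_mset d (mset_set J)))) = card {j\<in>J. P (d j)}"
proof -
  have "length (filter P (sorted_list_of_multiset (image_mset d (mset_set J))))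
      = size (filter_mset P (image_mset d (mset_set J)))"
    by (metis mset_filter mset_sorted_list_of_multiset size_mset)
  also have "\<dots> = card {j\<in>J. P (d j)}"
    using assms by (simp add: filter_mset_image_mset)
  finally show ?thesis .
qed

text \<open>
Order statistics are handled below through counting, by these two equivalences.
\<close>
lemma kth_smallest_iff:
  assumes "finite J" "1 \<le> k" "k \<le> card J"
  shows "kth_smallest k d J \<le> t \<longleftrightarrow> k \<le> card {j\<in>J. d j \<le> t}"
    and "kth_smallest k d J < t \<longleftrightarrow> k \<le> card {j\<in>J. d j < t}"
proof -
  let ?L = "sorted_list_of_multiset (image_mset d (mset_set J))"
  have len: "length ?L = card J"
    using length_filter_sorted_image[OF assms(1), of "\<lambda>_. True" d] by simp
  have "sorted ?L" by simp
  from sorted_nth_le_iff[OF this, of "k - 1" t] len assms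
  show "kth_smallest k d J \<le> t \<longleftrightarrow> k \<le> card {j\<in>J. d j \<le> t}"
    and "kth_smallest k d J < t \<longleftrightarrow> k \<le> card {j\<in>J. d j < t}"
    by (auto simp: kth_smallest_def length_filter_sorted_image)
qed

lemma kth_smallest_mem:
  assumes "finite J" "1 \<le> k" "k \<le> card J"
  shows "kth_smallest k d J \<in> d ` J"
proof -
  let ?L = "sorted_list_of_multiset (image_mset d (mset_set J))"
  have "length ?L = card J"
    using length_filter_sorted_image[OF assms(1), of "\<lambda>_. True" d] by simp
  then have "?L ! (k - 1) \<in> set ?L" using assms by (intro nth_mem) auto
  then show ?thesis using assms(1) by (simp add: kth_smallest_def)
qed

lemma kth_smallest_image:
  assumes "inj_on x J"
  shows "kth_smallest k d (x ` J) = kth_smallest k (\<lambda>j. d (x j)) J"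
  by (simp add: kth_smallest_def image_mset_mset_set[OF assms, symmetric] image_mset.compositionality comp_def)

lemma kth_smallest_cong:
  assumes "\<And>j. j \<in> J \<Longrightarrow> d j = d' j"
  shows "kth_smallest k d J = kth_smallest k d' J"
proof (cases "finite J")
  case True
  then have "image_mset d (mset_set J) = image_mset d' (mset_set J)"
    using assms by (intro image_mset_cong) auto
  then show ?thesis by (simp add: kth_smallest_def)
qed (simp add: kth_smallest_def)

text \<open>
In the absence of ties, the \<open>k\<close>-th smallest value is singled out by having \<open>k - 1\<close> values
below it. Writing it as a sum over all candidates makes its law computable one candidate at a time.
\<close>
lemma sum_select_kth_smallest:
  fixes g :: "real \<Rightarrow> 'b::comm_monoid_add"
  assumes "finite J" "1 \<le> k" "k \<le> card J" and inj: "inj_on d J"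
  shows "g (kth_smallest k d J)
    = (\<Sum>j\<in>J. if card {l\<in>J - {j}. d l < d j} = k - 1 then g (d j) else 0)"
proof -
  let ?R = "kth_smallest k d J"
  obtain j0 where j0: "j0 \<in> J" "?R = d j0" using kth_smallest_mem[OF assms(1-3), of d] by auto
  have eq: "{l\<in>J - {j}. d l < d j} = {l\<in>J. d l < d j}" for j by auto
  have "k \<le> card {j\<in>J. d j \<le> d j0}"
    using kth_smallest_iff(1)[OF assms(1-3), of d "d j0"] j0 by simp
  moreover have "{j\<in>J. d j \<le> d j0} = insert j0 {j\<in>J. d j < d j0}"
    using inj j0 by (force simp: inj_on_def)
  moreover have "\<not> k \<le> card {j\<in>J. d j < d j0}"
    using kth_smallest_iff(2)[OF assms(1-3), of d "d j0"] j0 by simp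
  ultimately have c0: "card {l\<in>J. d l < d j0} = k - 1"
    using assms(1) by simp
  have "card {l\<in>J. d l < d j} = k - 1 \<longleftrightarrow> j = j0" if "j \<in> J" for j
  proof
    assume c: "card {l\<in>J. d l < d j} = k - 1"
    show "j = j0"
    proof (rule ccontr)
      assume "j \<noteq> j0"
      then have "d j \<noteq> d j0" using inj that j0 by (auto simp: inj_on_def)
      then consider "d j < d j0" | "d j0 < d j" by linarith
      then have "{l\<in>J. d l < d j} \<subset> {l\<in>J. d l < d j0} \<or> {l\<in>J. d l < d j0} \<subset> {l\<in>J. d l < d j}"
        using that j0 by cases force+
      then show False using assms(1) c c0 psubset_card_mono[of "{l\<in>J. d l < d j0}" "{l\<in>J. d l < d j}"]
         psubset_card_mono[of "{l\<in>J. d l < d j}" "{l\<in>J. d l < d j0}"] by auto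
    qed
  qed (use c0 in simp)
  then have "(\<Sum>j\<in>J. if card {l\<in>J - {j}. d l < d j} = k - 1 then g (d j) else 0)
     = (\<Sum>j\<in>J. if j = j0 then g (d j) else 0)"
    unfolding eq by (intro sum.cong refl) auto
  then show ?thesis using assms(1) j0 by simp
qed

text \<open>
If removing \<open>i\<close> moves the \<open>k\<close>-th smallest value, then exactly \<open>k\<close> values lie at or below it and \<open>i\<close>
carries one of them. The strict form of the last claim survives ties.
\<close>
lemma kth_smallest_remove:
  assumes J: "finite J" and k: "1 \<le> k" "k + 1 \<le> card J" and i: "i \<in> J"
    and ne: "kth_smallest k d (J - {i}) \<noteq> kth_smallest k d J"
  shows "kth_smallest k d (J - {i}) = kth_smallest (k + 1) d J"
    and "d i \<le> kth_smallest k d J"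
    and "card {j\<in>J. d j \<le> kth_smallest k d J} \<le> k"
    and "card {j\<in>J - {i}. d j \<le> d i} < k"
proof -
  let ?R = "kth_smallest k d J" and ?R' = "kth_smallest k d (J - {i})"
  have cJ: "card (J - {i}) = card J - 1" using J i by simp
  note R = kth_smallest_iff(1)[OF J k(1), of d]
  have R': "?R' \<le> t \<longleftrightarrow> k \<le> card {j\<in>J - {i}. d j \<le> t}" for t
    using kth_smallest_iff(1)[of "J - {i}" k d] J k cJ by simp
  have R1: "kth_smallest (k + 1) d J \<le> t \<longleftrightarrow> k + 1 \<le> card {j\<in>J. d j \<le> t}" for t
    using kth_smallest_iff(1)[of J "k + 1" d] J k by simp
  have split: "card {j\<in>J. d j \<le> t} = card {j\<in>J - {i}. d j \<le> t} + (if d i \<le> t then 1 else 0)" for t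
  proof -
    have "{j\<in>J. d j \<le> t} = (if d i \<le> t then insert i {j\<in>J - {i}. d j \<le> t} else {j\<in>J - {i}. d j \<le> t})"
      using i by auto
    then show ?thesis using J by simp
  qed
  have "?R \<le> ?R'" using R[of ?R'] R'[of ?R'] k split[of ?R'] by auto
  then have lt: "?R < ?R'" using ne by simp
  then have small: "card {j\<in>J - {i}. d j \<le> ?R} < k" using R'[of ?R] by simp
  have "k \<le> card {j\<in>J. d j \<le> ?R}" using R[of ?R] k by simp
  then show di: "d i \<le> ?R" using small split[of ?R] by (auto split: if_splits)
  then show "card {j\<in>J. d j \<le> kth_smallest k d J} \<le> k" using small split[of ?R] by simp
  have "card {j\<in>J - {i}. d j \<le> d i} \<le> card {j\<in>J - {i}. d j \<le> ?R}"
    using J di by (intro card_mono) auto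
  then show "card {j\<in>J - {i}. d j \<le> d i} < k" using small by simp
  have "?R' \<le> t \<longleftrightarrow> kth_smallest (k + 1) d J \<le> t" for t
  proof (cases "d i \<le> t")
    case True
    then show ?thesis using R'[of t] R1[of t] split[of t] by simp
  next
    case False
    then have "t < ?R" using di by simp
    then have "\<not> k \<le> card {j\<in>J. d j \<le> t}" using R[of t] k by simp
    then show ?thesis using R'[of t] R1[of t] split[of t] False by simp
  qed
  then show "?R' = kth_smallest (k + 1) d J" by (meson order_antisym order_refl)
qed

section \<open>The law of the nearest neighbour radius\<close>

text \<open>
A finite family of measurable events takes only finitely many patterns, each on a measurable set.
\<close>
lemma pred_filter_set:
  assumes J: "finite J" and P: "\<And>j. j \<in> J \<Longrightarrow> Measurable.pred M (P j)"
  shows "Measurable.pred M (\<lambda>\<omega>. Q {j\<in>J. P j \<omega>})"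
proof -
  have "(\<lambda>\<omega>. {j\<in>J. P j \<omega>}) \<in> measurable M (count_space (Pow J))"
  proof (subst measurable_count_space_eq2)
    show "finite (Pow J)" using J by simp
    have "(\<lambda>\<omega>. {j\<in>J. P j \<omega>}) -` {T} \<inter> space M \<in> sets M" if "T \<subseteq> J" for T
    proof -
      have "Measurable.pred M (\<lambda>\<omega>. \<forall>j\<in>J. P j \<omega> \<longleftrightarrow> j \<in> T)"
        using J P by (intro pred_intros_finite pred_intros_logic) auto
      moreover have "(\<lambda>\<omega>. {j\<in>J. P j \<omega>}) -` {T} \<inter> space M = {\<omega>\<in>space M. \<forall>j\<in>J. P j \<omega> \<longleftrightarrow> j \<in> T}"
        using that by auto
      ultimately show ?thesis by (simp add: pred_def)
    qed
    then show "(\<lambda>\<omega>. {j\<in>J. P j \<omega>}) \<in> space M \<rightarrow> Pow J \<and>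
      (\<forall>T\<in>Pow J. (\<lambda>\<omega>. {j\<in>J. P j \<omega>}) -` {T} \<inter> space M \<in> sets M)" by auto
  qed
  from measurable_compose[OF this, of Q "count_space UNIV"] show ?thesis
    by simp
qed

lemma borel_measurable_kth_smallest:
  assumes J: "finite J" "1 \<le> k" "k \<le> card J"
    and d: "\<And>j. j \<in> J \<Longrightarrow> d j \<in> borel_measurable M"
  shows "(\<lambda>\<omega>. kth_smallest k (\<lambda>j. d j \<omega>) J) \<in> borel_measurable M"
proof (subst borel_measurable_iff_le, intro allI)
  fix t :: real
  have "Measurable.pred M (\<lambda>\<omega>. k \<le> card {j\<in>J. d j \<omega> \<le> t})"
    using J d by (intro pred_filter_set[where Q = "\<lambda>A. k \<le> card A"]) auto
  then show "{\<omega> \<in> space M. kth_smallest k (\<lambda>j. d j \<omega>) J \<le> t} \<in> sets M"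
    using kth_smallest_iff(1)[OF J] by (simp add: pred_def)
qed

text \<open>
The binomial law: sum over the \<open>j\<close>-element sets of coordinates that fall into \<open>A\<close>.
\<close>
lemma emeasure_PiM_card_eq:
  fixes \<mu> :: "'a measure"
  assumes \<mu>: "prob_space \<mu>" and I: "finite I" and A: "A \<in> sets \<mu>"
  shows "emeasure (PiM I (\<lambda>_. \<mu>)) {z \<in> space (PiM I (\<lambda>_. \<mu>)). card {l\<in>I. z l \<in> A} = j}
    = ennreal (real (card I choose j) * measure \<mu> A ^ j * (1 - measure \<mu> A) ^ (card I - j))"
proof -
  interpret \<mu>: prob_space \<mu> by fact
  interpret product_prob_space "\<lambda>_. \<mu>" I by unfold_locales
  let ?P = "PiM I (\<lambda>_. \<mu>)"
  let ?F = "\<lambda>T. PiE I (\<lambda>l. if l \<in> T then A else space \<mu> - A)"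
  let ?TT = "{T. T \<subseteq> I \<and> card T = j}"
  have "A \<subseteq> space \<mu>" using A by (rule sets.sets_into_space)
  have memF: "z \<in> ?F T \<longleftrightarrow> z \<in> space ?P \<and> {l\<in>I. z l \<in> A} = T" if "T \<subseteq> I" for z T
    using that \<open>A \<subseteq> space \<mu>\<close> unfolding space_PiM PiE_iff by (auto split: if_splits)
  have "{z \<in> space ?P. card {l\<in>I. z l \<in> A} = j} = (\<Union>T\<in>?TT. ?F T)"
    using memF by auto
  moreover have "emeasure ?P (\<Union>T\<in>?TT. ?F T) = (\<Sum>T\<in>?TT. emeasure ?P (?F T))"
  proof (rule sum_emeasure[symmetric])
    show "?F ` ?TT \<subseteq> sets ?P" using A I by (auto intro!: sets_PiM_I_finite)
    show "disjoint_family_on ?F ?TT"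
      unfolding disjoint_family_on_def using memF by (metis (no_types, lifting) disjoint_iff mem_Collect_eq)
    show "finite ?TT" using I by simp
  qed
  moreover have "emeasure ?P (?F T) = ennreal (measure \<mu> A ^ j * (1 - measure \<mu> A) ^ (card I - j))"
    if "T \<in> ?TT" for T
  proof -
    have "emeasure ?P (?F T) = (\<Prod>l\<in>I. emeasure \<mu> (if l \<in> T then A else space \<mu> - A))"
      using A I by (intro emeasure_PiM) auto
    also have "\<dots> = (\<Prod>l\<in>I. ennreal (if l \<in> T then measure \<mu> A else 1 - measure \<mu> A))"
      using A by (intro prod.cong) (auto simp: \<mu>.emeasure_eq_measure \<mu>.prob_compl)
    also have "\<dots> = ennreal (\<Prod>l\<in>I. if l \<in> T then measure \<mu> A else 1 - measure \<mu> A)"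
      by (intro prod_ennreal) auto
    also have "(\<Prod>l\<in>I. if l \<in> T then measure \<mu> A else 1 - measure \<mu> A)
       = measure \<mu> A ^ card (I \<inter> T) * (1 - measure \<mu> A) ^ card (I \<inter> - T)"
      using I by (simp add: prod.If_cases)
    also have "I \<inter> T = T" using that by auto
    also have "I \<inter> - T = I - T" by auto
    also have "card (I - T) = card I - j" using that I by (auto simp: card_Diff_subset finite_subset)
    finally show ?thesis using that by simp
  qed
  ultimately have "emeasure ?P {z \<in> space ?P. card {l\<in>I. z l \<in> A} = j}
     = (\<Sum>T\<in>?TT. ennreal (measure \<mu> A ^ j * (1 - measure \<mu> A) ^ (card I - j)))"
    by simp
  also have "\<dots> = of_nat (card I choose j) * ennreal (measure \<mu> A ^ j * (1 - measure \<mu> A) ^ (card I - j))"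
    using I by (simp add: n_subsets)
  also have "\<dots> = ennreal (real (card I choose j) * (measure \<mu> A ^ j * (1 - measure \<mu> A) ^ (card I - j)))"
    by (subst ennreal_mult) (auto simp: ennreal_of_nat_eq_real_of_nat)
  finally show ?thesis by (simp add: mult.assoc)
qed

lemma measurable_dist_component:
  fixes \<mu> :: "'a::euclidean_space measure"
  assumes "sets \<mu> = sets borel" "j \<in> J"
  shows "(\<lambda>z. dist x (z j)) \<in> borel_measurable (PiM J (\<lambda>_. \<mu>))"
proof -
  have [measurable_cong]: "sets \<mu> = sets borel" by fact
  have "(\<lambda>z. z j) \<in> measurable (PiM J (\<lambda>_. \<mu>)) \<mu>"
    using assms by (intro measurable_component_singleton)
  then have "(\<lambda>z. z j) \<in> borel_measurable (PiM J (\<lambda>_. \<mu>))"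
    by (simp add: measurable_cong_sets[OF refl assms(1)])
  then show ?thesis by measurable
qed

text \<open>
If \<open>P\<close> is the mass of the ball around a point through a candidate neighbour, this is \<open>n\<close> (the number of
candidates) times the probability that exactly \<open>k - 1\<close> of the other \<open>n - 1\<close> points fall into the ball.
As a function of \<open>P\<close> it is the density of the \<open>k\<close>-th of \<open>n\<close> uniform order statistics.
\<close>
definition knn_weight :: "nat \<Rightarrow> nat \<Rightarrow> real \<Rightarrow> real" where
  "knn_weight k n P = real n * real ((n - 1) choose (k - 1)) * P ^ (k - 1) * (1 - P) ^ (n - k)"

lemma AE_PiM_dist_inj:
  fixes \<mu> :: "'a::euclidean_space measure"
  assumes \<mu>: "prob_space \<mu>" "sets \<mu> = sets borel"
    and null: "\<And>x r. emeasure \<mu> {y. dist x y = r} = 0"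
    and J: "finite J"
  shows "AE z in PiM J (\<lambda>_. \<mu>). inj_on (\<lambda>j. dist x (z j)) J"
proof -
  interpret \<mu>: prob_space \<mu> by fact
  interpret product_sigma_finite "\<lambda>_. \<mu>" by unfold_locales
  have [measurable_cong]: "sets \<mu> = sets borel" by fact
  have "AE z in PiM J (\<lambda>_. \<mu>). dist x (z j) \<noteq> dist x (z l)" if jl: "j \<in> J" "l \<in> J" "j \<noteq> l" for j l
  proof -
    let ?E = "{z \<in> space (PiM J (\<lambda>_. \<mu>)). dist x (z j) = dist x (z l)}"
    have eq: "?E \<in> sets (PiM J (\<lambda>_. \<mu>))"
      by (intro borel_measurable_eq measurable_dist_component \<mu>(2) jl)
    let ?J = "J - {j}"
    have J': "J = insert j ?J" "finite ?J" "j \<notin> ?J" using jl J by auto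
    have l: "l \<in> ?J" using jl by auto
    let ?f = "\<lambda>z. indicator ?E z :: ennreal"
    have m: "?f \<in> borel_measurable (PiM (insert j ?J) (\<lambda>_. \<mu>))"
      unfolding J'(1)[symmetric] using eq by (intro borel_measurable_indicator) simp
    have "(\<integral>\<^sup>+z. ?f z \<partial>PiM (insert j ?J) (\<lambda>_. \<mu>)) = (\<integral>\<^sup>+z. (\<integral>\<^sup>+y. ?f (z(j := y)) \<partial>\<mu>) \<partial>PiM ?J (\<lambda>_. \<mu>))"
      using J' m by (intro product_nn_integral_insert) auto
    also have "\<dots> \<le> (\<integral>\<^sup>+z. (\<integral>\<^sup>+y. indicator {y. dist x y = dist x (z l)} y \<partial>\<mu>) \<partial>PiM ?J (\<lambda>_. \<mu>))"
      using l by (intro nn_integral_mono) (auto simp: indicator_def)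
    also have "\<dots> = (\<integral>\<^sup>+z. 0 \<partial>PiM ?J (\<lambda>_. \<mu>))"
      using null by (intro nn_integral_cong) (subst nn_integral_indicator, auto simp: \<mu>(2))
    finally have "(\<integral>\<^sup>+z. ?f z \<partial>PiM J (\<lambda>_. \<mu>)) = 0" using J'(1) by simp
    then have "?E \<in> null_sets (PiM J (\<lambda>_. \<mu>))"
      using eq by (simp add: null_sets_def nn_integral_indicator)
    then show ?thesis by (rule AE_I') auto
  qed
  then have "AE z in PiM J (\<lambda>_. \<mu>). \<forall>j\<in>J. \<forall>l\<in>J. j \<noteq> l \<longrightarrow> dist x (z j) \<noteq> dist x (z l)"
    using J by (auto simp: AE_finite_all intro!: AE_impI)
  then show ?thesis by eventually_elim (auto simp: inj_on_def)
qed

lemma borel_measurable_measure_ball: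
  fixes \<mu> :: "'a::euclidean_space measure"
  assumes \<mu>: "prob_space \<mu>" "sets \<mu> = sets borel"
  shows "(\<lambda>(x, y). measure \<mu> (ball x (dist x y))) \<in> borel_measurable (borel \<Otimes>\<^sub>M borel)"
proof -
  interpret \<mu>: prob_space \<mu> by fact
  have [measurable_cong]: "sets \<mu> = sets borel" by fact
  have [measurable]: "{q :: ('a \<times> 'a) \<times> 'a. dist (fst (fst q)) (snd q) < dist (fst (fst q)) (snd (fst q))}
      \<in> sets ((borel \<Otimes>\<^sub>M borel) \<Otimes>\<^sub>M \<mu>)"
  proof -
    have "{q \<in> space ((borel \<Otimes>\<^sub>M borel) \<Otimes>\<^sub>M \<mu>). dist (fst (fst q)) (snd q) < dist (fst (fst q)) (snd (fst q) :: 'a)}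
      \<in> sets ((borel \<Otimes>\<^sub>M borel) \<Otimes>\<^sub>M \<mu>)"
      by measurable
    then show ?thesis using sets_eq_imp_space_eq[OF \<mu>(2)] by (simp add: space_pair_measure)
  qed
  have "(\<lambda>q::'a\<times>'a. \<integral>\<^sup>+z. indicator {q. dist (fst (fst q)) (snd q) < dist (fst (fst q)) (snd (fst q))} (q, z) \<partial>\<mu>)
      \<in> borel_measurable (borel \<Otimes>\<^sub>M borel)"
    by measurable
  then have "(\<lambda>q. enn2real (\<integral>\<^sup>+z. indicator {q. dist (fst (fst q)) (snd q) < dist (fst (fst q)) (snd (fst q))} (q, z) \<partial>\<mu>))
      \<in> borel_measurable (borel \<Otimes>\<^sub>M borel)" by measurable
  moreover have "(\<integral>\<^sup>+z. indicator {q. dist (fst (fst q)) (snd q) < dist (fst (fst q)) (snd (fst q))} (q, z) \<partial>\<mu>)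
     = emeasure \<mu> (ball (fst q) (dist (fst q) (snd q)))" for q
  proof -
    have "(\<integral>\<^sup>+z. indicator {q. dist (fst (fst q)) (snd q) < dist (fst (fst q)) (snd (fst q))} (q, z) \<partial>\<mu>)
        = (\<integral>\<^sup>+z. indicator (ball (fst q) (dist (fst q) (snd q))) z \<partial>\<mu>)"
      by (intro nn_integral_cong) (auto simp: indicator_def)
    then show ?thesis using \<mu>(2) by simp
  qed
  ultimately show ?thesis by (simp add: measure_def case_prod_beta)
qed

lemma knn_weight_measurable [measurable]: "knn_weight k n \<in> borel_measurable borel"
  unfolding knn_weight_def by measurable

text \<open>
Decompose according to which sample point is the \<open>k\<close>-th neighbour of \<open>x\<close>, and integrate that point last.
Integrating over the neighbour itself, and not over the radius, avoids surface integrals over spheres.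
\<close>
lemma nn_integral_kth_smallest:
  fixes \<mu> :: "'a::euclidean_space measure" and g :: "real \<Rightarrow> ennreal"
  assumes \<mu>: "prob_space \<mu>" "sets \<mu> = sets borel"
    and null: "\<And>x r. emeasure \<mu> {y. dist x y = r} = 0"
    and J: "finite J" "1 \<le> k" "k \<le> card J"
    and g [measurable]: "g \<in> borel_measurable borel"
  shows "(\<integral>\<^sup>+z. g (kth_smallest k (\<lambda>j. dist x (z j)) J) \<partial>PiM J (\<lambda>_. \<mu>))
    = (\<integral>\<^sup>+y. ennreal (knn_weight k (card J) (measure \<mu> (ball x (dist x y)))) * g (dist x y) \<partial>\<mu>)"
proof -
  interpret \<mu>: prob_space \<mu> by fact
  interpret product_sigma_finite "\<lambda>_. \<mu>" by unfold_locales
  have [measurable_cong]: "sets \<mu> = sets borel" by fact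
  have [measurable]: "(\<lambda>y. measure \<mu> (ball x (dist x y))) \<in> borel_measurable borel"
    using measurable_compose[OF _ borel_measurable_measure_ball[OF \<mu>], of "\<lambda>y. (x, y)" borel] by simp
  let ?sel = "\<lambda>j z. card {l\<in>J - {j}. dist x (z l) < dist x (z j)} = k - 1"
  let ?P = "\<lambda>y. measure \<mu> (ball x (dist x y))"
  have [measurable]: "Measurable.pred (PiM J (\<lambda>_. \<mu>)) (?sel j)" if "j \<in> J" for j
  proof (intro pred_filter_set[where Q = "\<lambda>A. card A = k - 1"])
    fix l assume "l \<in> J - {j}"
    then have "l \<in> J" by simp
    note [measurable] = measurable_dist_component[OF \<mu>(2) this, of x] measurable_dist_component[OF \<mu>(2) that, of x]
    show "Measurable.pred (PiM J (\<lambda>_. \<mu>)) (\<lambda>z. dist x (z l) < dist x (z j))"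
      by measurable
  qed (use J in simp)
  have mf [measurable]: "(\<lambda>z. if ?sel j z then g (dist x (z j)) else 0) \<in> borel_measurable (PiM J (\<lambda>_. \<mu>))"
    if "j \<in> J" for j
  proof -
    note [measurable] = measurable_dist_component[OF \<mu>(2) that, of x] \<open>j \<in> J\<close>
    show ?thesis by measurable
  qed
  have "(\<integral>\<^sup>+z. g (kth_smallest k (\<lambda>j. dist x (z j)) J) \<partial>PiM J (\<lambda>_. \<mu>))
     = (\<integral>\<^sup>+z. (\<Sum>j\<in>J. if ?sel j z then g (dist x (z j)) else 0) \<partial>PiM J (\<lambda>_. \<mu>))"
  proof (rule nn_integral_cong_AE)
    show "AE z in PiM J (\<lambda>_. \<mu>). g (kth_smallest k (\<lambda>j. dist x (z j)) J)
      = (\<Sum>j\<in>J. if ?sel j z then g (dist x (z j)) else 0)"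
      using AE_PiM_dist_inj[OF \<mu> null J(1), of x]
    proof eventually_elim
      case (elim z)
      show ?case using sum_select_kth_smallest[OF J elim, where g = g] .
    qed
  qed
  also have "\<dots> = (\<Sum>j\<in>J. \<integral>\<^sup>+z. (if ?sel j z then g (dist x (z j)) else 0) \<partial>PiM J (\<lambda>_. \<mu>))"
    by (intro nn_integral_sum mf)
  also have "\<dots> = (\<Sum>j\<in>J. \<integral>\<^sup>+y. ennreal (real ((card J - 1) choose (k - 1)) * ?P y ^ (k - 1)
       * (1 - ?P y) ^ (card J - k)) * g (dist x y) \<partial>\<mu>)"
  proof (intro sum.cong refl)
    fix j assume j: "j \<in> J"
    let ?J = "J - {j}"
    have J': "J = insert j ?J" "finite ?J" "j \<notin> ?J" using j J by auto
    have cJ: "card ?J = card J - 1" using j J by simp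
    let ?f = "\<lambda>z. if ?sel j z then g (dist x (z j)) else 0"
    have m: "?f \<in> borel_measurable (PiM (insert j ?J) (\<lambda>_. \<mu>))"
      unfolding J'(1)[symmetric] using mf[OF j] .
    have "(\<integral>\<^sup>+z. ?f z \<partial>PiM (insert j ?J) (\<lambda>_. \<mu>))
       = (\<integral>\<^sup>+y. (\<integral>\<^sup>+z. ?f (z(j := y)) \<partial>PiM ?J (\<lambda>_. \<mu>)) \<partial>\<mu>)"
      using J' m by (intro product_nn_integral_insert_rev) auto
    also have "\<dots> = (\<integral>\<^sup>+y. ennreal (real ((card J - 1) choose (k - 1)) * ?P y ^ (k - 1)
       * (1 - ?P y) ^ (card J - k)) * g (dist x y) \<partial>\<mu>)"
    proof (intro nn_integral_cong)
      fix y
      let ?A = "ball x (dist x y)"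
      let ?E = "{z \<in> space (PiM ?J (\<lambda>_. \<mu>)). card {l\<in>?J. z l \<in> ?A} = k - 1}"
      have E: "?E \<in> sets (PiM ?J (\<lambda>_. \<mu>))"
      proof -
        have "Measurable.pred (PiM ?J (\<lambda>_. \<mu>)) (\<lambda>z. card {l\<in>?J. z l \<in> ?A} = k - 1)"
        proof (intro pred_filter_set[where Q = "\<lambda>A. card A = k - 1"])
          fix l assume "l \<in> ?J"
          note [measurable] = measurable_dist_component[OF \<mu>(2) this, of x]
          show "Measurable.pred (PiM ?J (\<lambda>_. \<mu>)) (\<lambda>z. z l \<in> ?A)"
            unfolding mem_ball by measurable
        qed (use J in simp)
        then show ?thesis by (simp add: pred_def)
      qed
      have "(\<integral>\<^sup>+z. ?f (z(j := y)) \<partial>PiM ?J (\<lambda>_. \<mu>)) = (\<integral>\<^sup>+z. g (dist x y) * indicator ?E z \<partial>PiM ?J (\<lambda>_. \<mu>))"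
      proof (intro nn_integral_cong)
        fix z assume z: "z \<in> space (PiM ?J (\<lambda>_. \<mu>))"
        have "{l \<in> ?J. dist x ((z(j := y)) l) < dist x ((z(j := y)) j)} = {l\<in>?J. z l \<in> ?A}" by auto
        then show "?f (z(j := y)) = g (dist x y) * indicator ?E z" using z by simp
      qed
      also have "\<dots> = g (dist x y) * emeasure (PiM ?J (\<lambda>_. \<mu>)) ?E"
        using E by (rule nn_integral_cmult_indicator)
      also have "emeasure (PiM ?J (\<lambda>_. \<mu>)) ?E
         = ennreal (real (card ?J choose (k - 1)) * measure \<mu> ?A ^ (k - 1) * (1 - measure \<mu> ?A) ^ (card ?J - (k - 1)))"
        using J \<mu> by (intro emeasure_PiM_card_eq) auto
      also have "card ?J - (k - 1) = card J - k" using cJ J by simp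
      finally show "(\<integral>\<^sup>+z. ?f (z(j := y)) \<partial>PiM ?J (\<lambda>_. \<mu>)) =
         ennreal (real ((card J - 1) choose (k - 1)) * ?P y ^ (k - 1) * (1 - ?P y) ^ (card J - k)) * g (dist x y)"
        using cJ by (simp add: mult.commute)
    qed
    finally show "(\<integral>\<^sup>+z. ?f z \<partial>PiM J (\<lambda>_. \<mu>)) = (\<integral>\<^sup>+y. ennreal (real ((card J - 1) choose (k - 1)) * ?P y ^ (k - 1)
       * (1 - ?P y) ^ (card J - k)) * g (dist x y) \<partial>\<mu>)" using J'(1) by simp
  qed
  also have "\<dots> = (\<integral>\<^sup>+y. of_nat (card J) * (ennreal (real ((card J - 1) choose (k - 1)) * ?P y ^ (k - 1)
       * (1 - ?P y) ^ (card J - k)) * g (dist x y)) \<partial>\<mu>)"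
    by (simp add: nn_integral_cmult)
  also have "\<dots> = (\<integral>\<^sup>+y. ennreal (knn_weight k (card J) (?P y)) * g (dist x y) \<partial>\<mu>)"
  proof (intro nn_integral_cong)
    fix y
    have "of_nat (card J) * ennreal (real ((card J - 1) choose (k - 1)) * ?P y ^ (k - 1) * (1 - ?P y) ^ (card J - k))
       = ennreal (knn_weight k (card J) (?P y))"
      unfolding knn_weight_def
      by (subst ennreal_of_nat_eq_real_of_nat, subst ennreal_mult[symmetric])
         (auto simp: mult.assoc)
    then show "of_nat (card J) * (ennreal (real ((card J - 1) choose (k - 1)) * ?P y ^ (k - 1)
       * (1 - ?P y) ^ (card J - k)) * g (dist x y)) = ennreal (knn_weight k (card J) (?P y)) * g (dist x y)"
      by (metis mult.assoc)
  qed
  finally show ?thesis .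
qed

lemma nn_integral_knn_radius:
  fixes \<mu> :: "'a::euclidean_space measure" and g :: "real \<Rightarrow> ennreal"
  assumes \<mu>: "prob_space \<mu>" "sets \<mu> = sets borel"
    and null: "\<And>x r. emeasure \<mu> {y. dist x y = r} = 0"
    and J: "finite J" "1 \<le> k" "k \<le> card J" "i \<notin> J"
    and g [measurable]: "g \<in> borel_measurable borel"
  shows "(\<integral>\<^sup>+z. g (kth_smallest k (\<lambda>j. dist (z i) (z j)) J) \<partial>PiM (insert i J) (\<lambda>_. \<mu>))
    = (\<integral>\<^sup>+x. \<integral>\<^sup>+y. ennreal (knn_weight k (card J) (measure \<mu> (ball x (dist x y)))) * g (dist x y) \<partial>\<mu> \<partial>\<mu>)"
proof -
  interpret \<mu>: prob_space \<mu> by fact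
  interpret product_sigma_finite "\<lambda>_. \<mu>" by unfold_locales
  have [measurable_cong]: "sets \<mu> = sets borel" by fact
  have m: "(\<lambda>z. g (kth_smallest k (\<lambda>j. dist (z i) (z j)) J)) \<in> borel_measurable (PiM (insert i J) (\<lambda>_. \<mu>))"
  proof (intro measurable_compose[OF borel_measurable_kth_smallest g] J)
    fix j assume "j \<in> J"
    then have "(\<lambda>z. z j) \<in> measurable (PiM (insert i J) (\<lambda>_. \<mu>)) \<mu>"
      "(\<lambda>z. z i) \<in> measurable (PiM (insert i J) (\<lambda>_. \<mu>)) \<mu>"
      by (auto intro!: measurable_component_singleton)
    then have "(\<lambda>z. z j) \<in> borel_measurable (PiM (insert i J) (\<lambda>_. \<mu>))"
      "(\<lambda>z. z i) \<in> borel_measurable (PiM (insert i J) (\<lambda>_. \<mu>))"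
      by (simp_all add: measurable_cong_sets[OF refl \<mu>(2)])
    then show "(\<lambda>z. dist (z i) (z j)) \<in> borel_measurable (PiM (insert i J) (\<lambda>_. \<mu>))"
      by measurable
  qed
  have "(\<integral>\<^sup>+z. g (kth_smallest k (\<lambda>j. dist (z i) (z j)) J) \<partial>PiM (insert i J) (\<lambda>_. \<mu>))
    = (\<integral>\<^sup>+x. \<integral>\<^sup>+z. g (kth_smallest k (\<lambda>j. dist ((z(i := x)) i) ((z(i := x)) j)) J) \<partial>PiM J (\<lambda>_. \<mu>) \<partial>\<mu>)"
    using J m by (intro product_nn_integral_insert_rev) auto
  also have "\<dots> = (\<integral>\<^sup>+x. \<integral>\<^sup>+z. g (kth_smallest k (\<lambda>j. dist x (z j)) J) \<partial>PiM J (\<lambda>_. \<mu>) \<partial>\<mu>)"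
    using J by (intro nn_integral_cong arg_cong[where f = g] kth_smallest_cong) auto
  finally show ?thesis by (simp add: nn_integral_kth_smallest[OF \<mu> null J(1-3) g])
qed

section \<open>Radial change of variables\<close>

text \<open>
The rescaled volume \<open>u\<close> at which the estimator function is evaluated if \<open>y\<close> is the relevant neighbour
of \<open>x\<close>.
\<close>
definition vol :: "nat \<Rightarrow> 'a::euclidean_space \<Rightarrow> 'a \<Rightarrow> real" where
  "vol n x y = real n * (unit_ball_vol (real DIM('a)) * dist x y ^ DIM('a))"

text \<open>
A substitute for polar coordinates: \<open>vol n x y \<le> a\<close> describes a ball around \<open>x\<close> of
volume \<open>a / n\<close>.
\<close>
lemma distr_vol:
  fixes x :: "'a::euclidean_space"
  assumes n: "1 \<le> n"
  shows "distr lborel borel (vol n x) = density lborel (\<lambda>u. ennreal (indicator {0<..} u / real n))"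
    (is "?A = ?B")
proof (rule measure_eqI_generator_eq[where E = "range (\<lambda>a::real. {..a})" and \<Omega> = UNIV and A = "\<lambda>i::nat. {..real i}"])
  let ?V = "unit_ball_vol (real DIM('a))"
  have V: "0 < ?V" by simp
  have n0: "0 < real n" using n by simp
  have d: "0 < DIM('a)" by simp
  have m [measurable]: "vol n x \<in> borel_measurable borel"
    unfolding vol_def[abs_def] by measurable
  show "Int_stable (range (\<lambda>a::real. {..a}))"
    by (auto simp: Int_stable_def)
  show "range (\<lambda>a::real. {..a}) \<subseteq> Pow UNIV" by simp
  show "sets ?A = sigma_sets UNIV (range (\<lambda>a::real. {..a}))"
    "sets ?B = sigma_sets UNIV (range (\<lambda>a::real. {..a}))"
    by (simp_all add: borel_eq_atMost)
  show "range (\<lambda>i::nat. {..real i}) \<subseteq> range (\<lambda>a. {..a})" by auto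
  show "(\<Union>i::nat. {..real i}) = UNIV" using real_arch_simple by auto
  have A: "emeasure ?A {..a} = ennreal (max 0 a / real n)" for a
  proof (cases "a < 0")
    case True
    have "vol n x -` {..a} = {}"
    proof -
      have "0 \<le> vol n x y" for y unfolding vol_def by simp
      then show ?thesis using True by (auto simp: not_le) (meson not_le order.strict_trans1)
    qed
    then show ?thesis using True by (simp add: emeasure_distr)
  next
    case False
    define r where "r = root DIM('a) (a / (real n * ?V))"
    have r: "0 \<le> r" "r ^ DIM('a) = a / (real n * ?V)"
      using False n0 V d by (auto simp: r_def)
    have "vol n x y \<le> a \<longleftrightarrow> dist x y \<le> r" for y
    proof -
      have "vol n x y \<le> a \<longleftrightarrow> dist x y ^ DIM('a) \<le> r ^ DIM('a)"
        using n0 V by (simp add: r(2) vol_def field_simps)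
      also have "\<dots> \<longleftrightarrow> dist x y \<le> r" using r(1) d by (simp add: power_mono_iff)
      finally show ?thesis .
    qed
    then have "vol n x -` {..a} = cball x r" by auto
    then have "emeasure ?A {..a} = emeasure lborel (cball x r)" by (simp add: emeasure_distr)
    also have "\<dots> = ennreal (?V * r ^ DIM('a))" by (rule emeasure_cball[OF r(1)])
    also have "?V * r ^ DIM('a) = max 0 a / real n" using False n0 less_imp_neq[OF V] by (simp add: r(2))
    finally show ?thesis .
  qed
  have B: "emeasure ?B {..a} = ennreal (max 0 a / real n)" for a
  proof -
    have "emeasure ?B {..a} = (\<integral>\<^sup>+u. ennreal (1 / real n) * indicator {0<..a} u \<partial>lborel)"
      by (subst emeasure_density) (auto intro!: nn_integral_cong simp: indicator_def)
    also have "\<dots> = ennreal (1 / real n) * ennreal (max 0 a)"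
      by (subst nn_integral_cmult_indicator) (auto simp: max_def ennreal_neg)
    finally show ?thesis by (simp add: ennreal_mult'[symmetric] max_def)
  qed
  show "\<And>X. X \<in> range (\<lambda>a. {..a}) \<Longrightarrow> emeasure ?A X = emeasure ?B X" using A B by auto
  show "\<And>i. emeasure ?A {..real i} \<noteq> \<infinity>" using A by simp
qed

lemma measurable_vol2 [measurable]:
  "(\<lambda>z. vol n (fst z) (snd z)) \<in> borel_measurable (borel \<Otimes>\<^sub>M borel)"
  unfolding vol_def by measurable

lemma measurable_vol [measurable]: "vol n x \<in> borel_measurable borel"
  unfolding vol_def[abs_def] by measurable

lemma nn_integral_vol:
  fixes x :: "'a::euclidean_space"
  assumes n: "1 \<le> n" and G [measurable]: "G \<in> borel_measurable borel"
  shows "(\<integral>\<^sup>+y. G (vol n x y) \<partial>lborel) = ennreal (1 / real n) * (\<integral>\<^sup>+u. G u * indicator {0<..} u \<partial>lborel)"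
proof -
  have "(\<integral>\<^sup>+y. G (vol n x y) \<partial>lborel) = (\<integral>\<^sup>+u. G u \<partial>distr lborel borel (vol n x))"
    by (simp add: nn_integral_distr)
  also have "\<dots> = (\<integral>\<^sup>+u. ennreal (1 / real n) * (G u * indicator {0<..} u) \<partial>lborel)"
    unfolding distr_vol[OF n]
    by (subst nn_integral_density) (auto intro!: nn_integral_cong simp: indicator_def)
  finally show ?thesis by (simp add: nn_integral_cmult)
qed

lemma integral_vol:
  fixes x :: "'a::euclidean_space" and G :: "real \<Rightarrow> real"
  assumes n: "1 \<le> n" and G [measurable]: "G \<in> borel_measurable borel"
  shows "(\<integral>y. G (vol n x y) \<partial>lborel) = (LINT u:{0<..}|lborel. G u) / real n"
proof -
  have "(\<integral>y. G (vol n x y) \<partial>lborel) = (\<integral>u. G u \<partial>distr lborel borel (vol n x))"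
    by (simp add: integral_distr)
  also have "\<dots> = (\<integral>u. (indicator {0<..} u / real n) *\<^sub>R G u \<partial>lborel)"
    unfolding distr_vol[OF n] by (subst integral_density) auto
  also have "\<dots> = (\<integral>u. (indicator {0<..} u *\<^sub>R G u) / real n \<partial>lborel)"
    by (intro Bochner_Integration.integral_cong) auto
  finally show ?thesis by (simp add: set_lebesgue_integral_def)
qed

lemma nn_integral_powr_exp_finite:
  fixes \<alpha> c :: real
  assumes "-1 < \<alpha>" "0 < c"
  shows "(\<integral>\<^sup>+u. ennreal (u powr \<alpha> * exp (- c * u)) * indicator {0<..} u \<partial>lborel) < \<infinity>"
proof -
  have "(\<lambda>t. complex_of_real t powr (complex_of_real (\<alpha> + 1) - 1) / of_real (exp (c * t))) absolutely_integrable_on {0<..}"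
    using assms by (intro absolutely_integrable_Gamma_integral) auto
  then have "integrable lebesgue (\<lambda>t. indicator {0<..} t *\<^sub>R norm (complex_of_real t powr (complex_of_real (\<alpha> + 1) - 1) / of_real (exp (c * t))))"
    unfolding set_integrable_def[symmetric] by (rule set_integrable_norm)
  also have "(\<lambda>t. indicator {0<..} t *\<^sub>R norm (complex_of_real t powr (complex_of_real (\<alpha> + 1) - 1) / of_real (exp (c * t))))
    = (\<lambda>t. indicator {0<..} t * (t powr \<alpha> * exp (- c * t)))"
    by (intro ext) (auto simp: indicator_def norm_divide norm_powr_real_powr exp_minus field_simps)
  finally have "integrable lebesgue (\<lambda>t::real. indicator {0<..} t * (t powr \<alpha> * exp (- c * t)))" .
  then have "integrable lborel (\<lambda>t::real. indicator {0<..} t * (t powr \<alpha> * exp (- c * t)))"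
    by (subst (asm) integrable_completion) measurable
  then have "(\<integral>\<^sup>+u. ennreal (norm (indicator {0<..} u * (u powr \<alpha> * exp (- c * u)))) \<partial>lborel) < \<infinity>"
    by (simp add: integrable_iff_bounded)
  also have "(\<integral>\<^sup>+u. ennreal (norm (indicator {0<..} u * (u powr \<alpha> * exp (- c * u)))) \<partial>lborel)
    = (\<integral>\<^sup>+u. ennreal (u powr \<alpha> * exp (- c * u)) * indicator {0<..} u \<partial>lborel)"
    by (intro nn_integral_cong) (auto simp: indicator_def)
  finally show ?thesis .
qed

section \<open>Binomial and Poisson weights\<close>

text \<open>
The limit of \<open>knn_weight k n P\<close> for \<open>n * P = t\<close>, with the factor \<open>n\<close> kept in front.
\<close>
definition pois_weight :: "nat \<Rightarrow> nat \<Rightarrow> real \<Rightarrow> real" where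
  "pois_weight k n t = real n * (t ^ (k - 1) * exp (- t)) / fact (k - 1)"

lemma pois_weight_measurable [measurable]: "pois_weight k n \<in> borel_measurable borel"
  unfolding pois_weight_def by measurable

lemma knn_weight_nonneg: "0 \<le> P \<Longrightarrow> P \<le> 1 \<Longrightarrow> 0 \<le> knn_weight k n P"
  by (simp add: knn_weight_def)

lemma pois_weight_nonneg: "0 \<le> t \<Longrightarrow> 0 \<le> pois_weight k n t"
  by (simp add: pois_weight_def)

lemma one_minus_power_le:
  fixes P :: real
  assumes "0 \<le> P" "P \<le> 1" "k \<le> n"
  shows "(1 - P) ^ (n - k) \<le> exp (- (real (n - k) * P))"
    and "exp (- (real (n - k) * P)) \<le> exp (real k) * exp (- (real n * P))"
proof -
  have "1 - P \<le> exp (- P)" using exp_ge_add_one_self[of "- P"] by simp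
  then have "(1 - P) ^ (n - k) \<le> exp (- P) ^ (n - k)" using assms by (intro power_mono) auto
  also have "\<dots> = exp (- (real (n - k) * P))" by (simp flip: exp_of_nat_mult)
  finally show "(1 - P) ^ (n - k) \<le> exp (- (real (n - k) * P))" .
  have "real k * P \<le> real k * 1" using assms by (intro mult_left_mono) auto
  then have "- (real (n - k) * P) \<le> real k - real n * P"
    using assms by (simp add: of_nat_diff algebra_simps)
  then show "exp (- (real (n - k) * P)) \<le> exp (real k) * exp (- (real n * P))"
    by (simp add: exp_diff[symmetric] exp_minus[symmetric] exp_add[symmetric] del: exp_le_cancel_iff) simp
qed

lemma knn_weight_le:
  assumes "0 \<le> P" "P \<le> 1" "1 \<le> k" "k \<le> n"
  shows "knn_weight k n P \<le> exp (real k) * (real n * ((real n * P) ^ (k - 1) * exp (- (real n * P))))"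
proof -
  have "(n - 1) choose (k - 1) \<le> (n - 1) ^ (k - 1)" using assms by (intro binomial_le_pow) auto
  also have "\<dots> \<le> n ^ (k - 1)" by (intro power_mono) auto
  finally have "real ((n - 1) choose (k - 1)) \<le> real n ^ (k - 1)"
    by (metis of_nat_le_iff of_nat_power)
  then have "knn_weight k n P \<le> real n * real n ^ (k - 1) * P ^ (k - 1) * (exp (real k) * exp (- (real n * P)))"
    unfolding knn_weight_def using assms one_minus_power_le[OF assms(1,2,4)]
    by (intro mult_mono) (auto intro: order_trans)
  then show ?thesis by (simp add: power_mult_distrib mult_ac)
qed

text \<open>
Induction on \<open>N\<close>, with the one-step error \<open>exp (- P) - (1 - P) \<le> P\<^sup>2\<close>. Each step loses a
factor \<open>exp (- P)\<close> in the exponential, which the constant \<open>exp 1\<close> compensates for.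
\<close>
lemma exp_minus_power_bound:
  fixes P :: real
  assumes "0 \<le> P" "P \<le> 1"
  shows "exp (- (real N * P)) - (1 - P) ^ N \<le> real N * P\<^sup>2 * exp 1 * exp (- (real N * P))"
proof (induction N)
  case (Suc N)
  let ?e = "exp (- P)"
  have e1: "1 - P \<le> ?e" using exp_ge_add_one_self[of "- P"] by simp
  have e2: "?e - (1 - P) \<le> P\<^sup>2"
  proof -
    have "1 + P \<le> exp P" by (rule exp_ge_add_one_self)
    then have "?e * (1 + P) \<le> 1"
      by (metis exp_ge_zero exp_minus_inverse mult.commute mult_left_mono)
    then have "?e \<le> 1 / (1 + P)" using assms by (simp add: field_simps)
    also have "\<dots> \<le> 1 - P + P\<^sup>2"
      using assms by (simp add: field_simps power2_eq_square)
    finally show ?thesis by simp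
  qed
  have E: "exp (- (real (Suc N) * P)) = ?e * exp (- (real N * P))"
    by (simp add: exp_add[symmetric] algebra_simps)
  have "exp (- (real (Suc N) * P)) - (1 - P) ^ Suc N
     = (1 - P) * (exp (- (real N * P)) - (1 - P) ^ N) + (?e - (1 - P)) * exp (- (real N * P))"
    unfolding E by (simp add: algebra_simps)
  also have "\<dots> \<le> ?e * (real N * P\<^sup>2 * exp 1 * exp (- (real N * P))) + P\<^sup>2 * exp (- (real N * P))"
  proof (intro add_mono)
    have "(1 - P) * (exp (- (real N * P)) - (1 - P) ^ N) \<le> (1 - P) * (real N * P\<^sup>2 * exp 1 * exp (- (real N * P)))"
      using Suc assms by (intro mult_left_mono) auto
    also have "\<dots> \<le> ?e * (real N * P\<^sup>2 * exp 1 * exp (- (real N * P)))"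
      using e1 by (intro mult_right_mono) auto
    finally show "(1 - P) * (exp (- (real N * P)) - (1 - P) ^ N) \<le> ?e * (real N * P\<^sup>2 * exp 1 * exp (- (real N * P)))" .
    show "(?e - (1 - P)) * exp (- (real N * P)) \<le> P\<^sup>2 * exp (- (real N * P))"
      using e2 by (intro mult_right_mono) auto
  qed
  also have "P\<^sup>2 * exp (- (real N * P)) \<le> P\<^sup>2 * (exp 1 * (?e * exp (- (real N * P))))"
  proof -
    have "1 \<le> exp 1 * ?e" using assms by (simp add: exp_add[symmetric])
    then have "1 * exp (- (real N * P)) \<le> exp 1 * ?e * exp (- (real N * P))" by (intro mult_right_mono) auto
    then show ?thesis by (intro mult_left_mono) (auto simp: mult_ac)
  qed
  finally show ?case unfolding E by (simp add: algebra_simps)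
qed simp

lemma binomial_lower:
  assumes "1 \<le> k" "k \<le> n"
  shows "1 - (real k)\<^sup>2 / real n \<le> real ((n - 1) choose (k - 1)) * fact (k - 1) / real n ^ (k - 1)"
    and "real ((n - 1) choose (k - 1)) * fact (k - 1) / real n ^ (k - 1) \<le> 1"
proof -
  have n: "0 < real n" using assms by simp
  have eq: "real ((n - 1) choose (k - 1)) * fact (k - 1) / real n ^ (k - 1)
     = (\<Prod>i=0..<k-1. (real (n - 1) - real i) / real n)"
    by (simp add: binomial_gbinomial gbinomial_prod_rev prod_dividef)
  have fac: "1 - real (k - 1) / real n \<le> (real (n - 1) - real i) / real n"
    "(real (n - 1) - real i) / real n \<le> 1" if "i < k - 1" for i
  proof -
    have i: "real i + 2 \<le> real k" "real (n - 1) = real n - 1" "real (k - 1) = real k - 1"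
      using that assms by (auto simp: of_nat_diff)
    have "1 - real (k - 1) / real n = (real n - (real k - 1)) / real n" using n i by (simp add: field_simps)
    also have "\<dots> \<le> (real (n - 1) - real i) / real n" using i by (intro divide_right_mono) auto
    finally show "1 - real (k - 1) / real n \<le> (real (n - 1) - real i) / real n" .
    show "(real (n - 1) - real i) / real n \<le> 1" using i n by (simp add: field_simps)
  qed
  have f0: "0 \<le> 1 - real (k - 1) / real n" using assms n by (simp add: field_simps)
  have "real k * real (k - 1) \<le> real k * real k" by (intro mult_left_mono) auto
  then have "1 - (real k)\<^sup>2 / real n \<le> 1 + real (k - 1) * (- (real (k - 1) / real n))"
  proof -
    have "real (k - 1) * real (k - 1) \<le> real k * real k" by (intro mult_mono) auto
    then have "real (k - 1) * real (k - 1) / real n \<le> (real k)\<^sup>2 / real n"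
      using n by (simp add: divide_right_mono power2_eq_square)
    then show ?thesis by simp
  qed
  also have "\<dots> \<le> (1 + (- (real (k - 1) / real n))) ^ (k - 1)"
    using f0 by (intro Bernoulli_inequality) auto
  also have "\<dots> = (\<Prod>i=0..<k-1. 1 - real (k - 1) / real n)"
    using assms by (simp add: of_nat_diff)
  also have "\<dots> \<le> (\<Prod>i=0..<k-1. (real (n - 1) - real i) / real n)"
    using f0 fac by (intro prod_mono) auto
  finally show "1 - (real k)\<^sup>2 / real n \<le> real ((n - 1) choose (k - 1)) * fact (k - 1) / real n ^ (k - 1)"
    unfolding eq .
  show "real ((n - 1) choose (k - 1)) * fact (k - 1) / real n ^ (k - 1) \<le> 1"
    unfolding eq using fac order_trans[OF f0 fac(1)] by (intro prod_le_1) auto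
qed

text \<open>
The relative error of the Poisson approximation is of order \<open>1 / n\<close>, which cancels the factor \<open>n\<close> in
both weights. Three sources contribute: the binomial coefficient, replacing \<open>1 - P\<close> by \<open>exp (- P)\<close>, and the
exponent \<open>n - k\<close> in place of \<open>n\<close>.
\<close>
lemma knn_weight_pois_weight:
  assumes P: "0 \<le> P" "P \<le> 1" and k: "1 \<le> k" "k \<le> n"
  shows "\<bar>knn_weight k n P - pois_weight k n (real n * P)\<bar>
    \<le> exp (real k + 1) * (real k)\<^sup>2 * ((real n * P) ^ (k - 1) * (1 + real n * P)\<^sup>2 * exp (- (real n * P)))"
proof -
  define \<tau> where "\<tau> = real n * P"
  define c where "c = real ((n - 1) choose (k - 1)) * fact (k - 1) / real n ^ (k - 1)"
  let ?A = "(1 - P) ^ (n - k)" and ?E = "exp (- \<tau>)" and ?F = "exp (- (real (n - k) * P))"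
  have n: "0 < real n" using k by simp
  have \<tau>0: "0 \<le> \<tau>" using P by (simp add: \<tau>_def)
  have Pt: "P = \<tau> / real n" using n by (simp add: \<tau>_def)
  have kn: "knn_weight k n P = real n * \<tau> ^ (k - 1) / fact (k - 1) * (c * ?A)"
    using n by (simp add: knn_weight_def c_def \<tau>_def power_mult_distrib field_simps)
  have pw: "pois_weight k n (real n * P) = real n * \<tau> ^ (k - 1) / fact (k - 1) * ?E"
    by (simp add: pois_weight_def \<tau>_def)
  have A: "0 \<le> ?A" "?A \<le> ?F" "?F \<le> exp (real k) * ?E" "?A \<le> exp (real k) * ?E"
    using one_minus_power_le[OF P k(2)] P by (auto simp: \<tau>_def)
  have "\<bar>c - 1\<bar> \<le> (real k)\<^sup>2 / real n" using binomial_lower[OF k] unfolding c_def by simp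
  then have t1: "\<bar>c - 1\<bar> * ?A \<le> (real k)\<^sup>2 / real n * (exp (real k) * ?E)"
    using A by (intro mult_mono) auto
  have "?F - ?A \<le> real (n - k) * P\<^sup>2 * exp 1 * ?F" by (rule exp_minus_power_bound[OF P])
  also have "\<dots> \<le> real n * P\<^sup>2 * exp 1 * (exp (real k) * ?E)"
    using A by (intro mult_mono) auto
  also have "\<dots> = \<tau>\<^sup>2 / real n * exp (real k + 1) * ?E"
    using n by (simp add: Pt power2_eq_square exp_add field_simps)
  finally have t2: "?F - ?A \<le> \<tau>\<^sup>2 / real n * exp (real k + 1) * ?E" .
  have "?E = ?F * exp (- (real k * P))"
    using k by (simp add: \<tau>_def exp_add[symmetric] of_nat_diff algebra_simps)
  then have "?F - ?E = ?F * (1 - exp (- (real k * P)))" by (simp add: algebra_simps)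
  also have "\<dots> \<le> (exp (real k) * ?E) * (real k * P)"
    using A exp_ge_add_one_self[of "- (real k * P)"] P by (intro mult_mono) auto
  finally have t3: "?F - ?E \<le> exp (real k) * ?E * (real k * \<tau> / real n)" by (simp add: Pt)
  have "?E \<le> ?F" using P k by (simp add: \<tau>_def mult_right_mono)
  have ek: "exp (real k) \<le> exp (real k + 1)" by simp
  have "\<bar>c * ?A - ?E\<bar> \<le> \<bar>c - 1\<bar> * ?A + ((?F - ?A) + (?F - ?E))"
  proof -
    have "c * ?A - ?E = (c - 1) * ?A + (?A - ?E)" by (simp add: algebra_simps)
    then have "\<bar>c * ?A - ?E\<bar> \<le> \<bar>c - 1\<bar> * ?A + \<bar>?A - ?E\<bar>"
      using A(1) by (metis abs_mult abs_of_nonneg abs_triangle_ineq)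
    moreover have "\<bar>?A - ?E\<bar> \<le> (?F - ?A) + (?F - ?E)" using A \<open>?E \<le> ?F\<close> by linarith
    ultimately show ?thesis by linarith
  qed
  also have "\<bar>c - 1\<bar> * ?A + ((?F - ?A) + (?F - ?E)) \<le>
     (real k)\<^sup>2 / real n * (exp (real k) * ?E) + (\<tau>\<^sup>2 / real n * exp (real k + 1) * ?E + exp (real k) * ?E * (real k * \<tau> / real n))"
    by (intro add_mono t1 t2 t3)
  also have "\<dots> \<le> (real k)\<^sup>2 / real n * (exp (real k + 1) * ?E) + (\<tau>\<^sup>2 / real n * exp (real k + 1) * ?E + exp (real k + 1) * ?E * (real k * \<tau> / real n))"
    using ek \<tau>0 by (intro add_mono mult_left_mono mult_right_mono) auto
  also have "\<dots> = exp (real k + 1) * ?E / real n * ((real k)\<^sup>2 + \<tau>\<^sup>2 + real k * \<tau>)"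
    by (simp add: add_divide_distrib algebra_simps)
  also have "\<dots> \<le> exp (real k + 1) * ?E / real n * ((real k)\<^sup>2 * (1 + \<tau>)\<^sup>2)"
  proof (intro mult_left_mono)
    have k1: "1 \<le> real k" using k by simp
    have "1 * 1 \<le> real k * real k" using k1 by (intro mult_mono) auto
    then have "1 * \<tau>\<^sup>2 \<le> (real k)\<^sup>2 * \<tau>\<^sup>2" by (intro mult_right_mono) (auto simp: power2_eq_square)
    moreover have "1 * (real k * \<tau>) \<le> real k * (real k * \<tau>)" using k1 \<tau>0 by (intro mult_right_mono) auto
    moreover have "0 \<le> (real k)\<^sup>2 * \<tau>" using \<tau>0 by simp
    ultimately show "(real k)\<^sup>2 + \<tau>\<^sup>2 + real k * \<tau> \<le> (real k)\<^sup>2 * (1 + \<tau>)\<^sup>2"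
      by (simp add: power2_eq_square algebra_simps)
  qed simp
  finally have D: "\<bar>c * ?A - ?E\<bar> \<le> exp (real k + 1) * ?E / real n * ((real k)\<^sup>2 * (1 + \<tau>)\<^sup>2)" .
  have "\<bar>knn_weight k n P - pois_weight k n (real n * P)\<bar> = real n * \<tau> ^ (k - 1) / fact (k - 1) * \<bar>c * ?A - ?E\<bar>"
    unfolding kn pw right_diff_distrib[symmetric] using \<tau>0 by (simp add: abs_mult)
  also have "\<dots> \<le> real n * \<tau> ^ (k - 1) / 1 * (exp (real k + 1) * ?E / real n * ((real k)\<^sup>2 * (1 + \<tau>)\<^sup>2))"
  proof (rule mult_mono[OF _ D])
    show "real n * \<tau> ^ (k - 1) / fact (k - 1) \<le> real n * \<tau> ^ (k - 1) / 1"
      using \<tau>0 by (intro divide_left_mono) (auto simp: fact_ge_1)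
  qed (use \<tau>0 in auto)
  also have "\<dots> = exp (real k + 1) * (real k)\<^sup>2 * (\<tau> ^ (k - 1) * (1 + \<tau>)\<^sup>2 * ?E)"
    using n by (simp add: field_simps)
  finally show ?thesis unfolding \<tau>_def .
qed

lemma abs_power_diff_le:
  fixes \<alpha> \<beta> M :: real
  assumes "1 \<le> M" "0 \<le> \<alpha>" "\<alpha> \<le> M" "0 \<le> \<beta>" "\<beta> \<le> M"
  shows "\<bar>\<alpha> ^ j - \<beta> ^ j\<bar> \<le> real j * M ^ j * \<bar>\<alpha> - \<beta>\<bar>"
proof (induction j)
  case (Suc j)
  have "\<alpha> ^ Suc j - \<beta> ^ Suc j = \<alpha> * (\<alpha> ^ j - \<beta> ^ j) + \<beta> ^ j * (\<alpha> - \<beta>)" by (simp add: algebra_simps)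
  then have "\<bar>\<alpha> ^ Suc j - \<beta> ^ Suc j\<bar> \<le> \<alpha> * \<bar>\<alpha> ^ j - \<beta> ^ j\<bar> + \<beta> ^ j * \<bar>\<alpha> - \<beta>\<bar>"
    using assms by (metis abs_mult abs_of_nonneg abs_triangle_ineq zero_le_power)
  also have "\<dots> \<le> M * (real j * M ^ j * \<bar>\<alpha> - \<beta>\<bar>) + M ^ Suc j * \<bar>\<alpha> - \<beta>\<bar>"
  proof (intro add_mono mult_mono Suc)
    have "\<beta> ^ j \<le> M ^ j" using assms by (intro power_mono) auto
    also have "\<dots> \<le> M ^ Suc j" using assms by (intro power_increasing) auto
    finally show "\<beta> ^ j \<le> M ^ Suc j" .
  qed (use assms in auto)
  finally show ?case by (simp add: algebra_simps)
qed simp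

lemma abs_exp_diff_le:
  fixes x y l :: real
  assumes "l \<le> x" "l \<le> y"
  shows "\<bar>exp (- x) - exp (- y)\<bar> \<le> exp (- l) * \<bar>x - y\<bar>"
proof -
  have *: "\<bar>exp (- x) - exp (- y)\<bar> \<le> exp (- l) * \<bar>x - y\<bar>" if "l \<le> x" "x \<le> y" for x y :: real
  proof -
    have "exp (- x) - exp (- y) = exp (- x) * (1 - exp (- (y - x)))"
      by (simp add: algebra_simps exp_add[symmetric])
    also have "\<dots> \<le> exp (- l) * (y - x)"
    proof (intro mult_mono)
      show "1 - exp (- (y - x)) \<le> y - x" using exp_ge_add_one_self[of "- (y - x)"] by linarith
    qed (use that in auto)
    finally show ?thesis using that by simp
  qed
  show ?thesis
  proof (cases "x \<le> y")
    case True then show ?thesis using *[of x y] assms by simp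
  next
    case False
    then show ?thesis using *[of y x] assms by (simp add: abs_minus_commute)
  qed
qed

text \<open>
Both factors of the Poisson weight are Lipschitz in the density value, with a constant that keeps the
exponential decay in \<open>u\<close>.
\<close>
lemma power_exp_diff_le:
  fixes \<alpha> \<beta> u lo M :: real
  assumes "1 \<le> M" "0 < lo" "lo \<le> \<alpha>" "\<alpha> \<le> M" "lo \<le> \<beta>" "\<beta> \<le> M" "0 \<le> u"
  shows "\<bar>(\<alpha> * u) ^ j * exp (- (\<alpha> * u)) - (\<beta> * u) ^ j * exp (- (\<beta> * u))\<bar>
     \<le> (real j + 1) * M ^ j * (u ^ j * (1 + u) * exp (- (lo * u))) * \<bar>\<alpha> - \<beta>\<bar>"
proof -
  let ?l = "exp (- (lo * u))"
  have "(\<alpha> * u) ^ j * exp (- (\<alpha> * u)) - (\<beta> * u) ^ j * exp (- (\<beta> * u))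
     = u ^ j * ((\<alpha> ^ j - \<beta> ^ j) * exp (- (\<alpha> * u)) + \<beta> ^ j * (exp (- (\<alpha> * u)) - exp (- (\<beta> * u))))"
    by (simp add: power_mult_distrib algebra_simps)
  then have "\<bar>(\<alpha> * u) ^ j * exp (- (\<alpha> * u)) - (\<beta> * u) ^ j * exp (- (\<beta> * u))\<bar>
     = u ^ j * \<bar>(\<alpha> ^ j - \<beta> ^ j) * exp (- (\<alpha> * u)) + \<beta> ^ j * (exp (- (\<alpha> * u)) - exp (- (\<beta> * u)))\<bar>"
    using assms by (simp add: abs_mult)
  also have "\<dots> \<le> u ^ j * (\<bar>\<alpha> ^ j - \<beta> ^ j\<bar> * exp (- (\<alpha> * u)) + \<beta> ^ j * \<bar>exp (- (\<alpha> * u)) - exp (- (\<beta> * u))\<bar>)"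
    using assms by (intro mult_left_mono order_trans[OF abs_triangle_ineq]) (auto simp: abs_mult)
  also have "\<dots> \<le> u ^ j * ((real j * M ^ j * \<bar>\<alpha> - \<beta>\<bar>) * ?l + M ^ j * (?l * (u * \<bar>\<alpha> - \<beta>\<bar>)))"
  proof (intro mult_left_mono add_mono mult_mono)
    show "\<bar>\<alpha> ^ j - \<beta> ^ j\<bar> \<le> real j * M ^ j * \<bar>\<alpha> - \<beta>\<bar>" using assms by (intro abs_power_diff_le) auto
    show "exp (- (\<alpha> * u)) \<le> ?l" using assms by (simp add: mult_right_mono)
    show "\<beta> ^ j \<le> M ^ j" using assms by (intro power_mono) auto
    have "\<bar>exp (- (\<alpha> * u)) - exp (- (\<beta> * u))\<bar> \<le> ?l * \<bar>\<alpha> * u - \<beta> * u\<bar>"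
      using assms by (intro abs_exp_diff_le mult_right_mono) auto
    also have "\<bar>\<alpha> * u - \<beta> * u\<bar> = u * \<bar>\<alpha> - \<beta>\<bar>"
      using assms by (simp add: left_diff_distrib[symmetric] abs_mult)
    finally show "\<bar>exp (- (\<alpha> * u)) - exp (- (\<beta> * u))\<bar> \<le> ?l * (u * \<bar>\<alpha> - \<beta>\<bar>)" .
  qed (use assms in auto)
  also have "\<dots> = M ^ j * (u ^ j * (real j + u) * ?l) * \<bar>\<alpha> - \<beta>\<bar>"
    by (simp add: algebra_simps)
  also have "\<dots> \<le> M ^ j * (u ^ j * ((real j + 1) * (1 + u)) * ?l) * \<bar>\<alpha> - \<beta>\<bar>"
    using assms by (intro mult_right_mono mult_left_mono) (auto simp: algebra_simps)
  finally show ?thesis by (simp add: mult_ac)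
qed

lemma square_exp_bound:
  fixes c u :: real
  assumes "0 < c" "0 \<le> u"
  shows "(1 + u)\<^sup>2 * exp (- (c * u)) \<le> (1 / (min 1 (c / 4))\<^sup>2) * exp (- (c / 2 * u))"
proof -
  let ?m = "min 1 (c / 4)"
  have m: "0 < ?m" using assms by simp
  have "?m * (1 + u) \<le> 1 + c / 4 * u"
  proof -
    have "?m * u \<le> c / 4 * u" using assms by (intro mult_right_mono) auto
    moreover have "?m \<le> 1" by simp
    ultimately show ?thesis unfolding distrib_left mult_1_right by linarith
  qed
  also have "\<dots> \<le> exp (c / 4 * u)" by (rule exp_ge_add_one_self)
  finally have "(?m * (1 + u))\<^sup>2 \<le> exp (c / 4 * u) ^ 2" using m assms by (intro power_mono) auto
  also have "\<dots> = exp (c / 2 * u)" by (simp flip: exp_double)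
  finally have "(1 + u)\<^sup>2 \<le> exp (c / 2 * u) / ?m\<^sup>2" using m
    by (simp only: power_mult_distrib pos_le_divide_eq zero_less_power mult.commute)
  then have "(1 + u)\<^sup>2 * exp (- (c * u)) \<le> exp (c / 2 * u) / ?m\<^sup>2 * exp (- (c * u))" by (intro mult_right_mono) auto
  also have "\<dots> = (1 / ?m\<^sup>2) * exp (- (c / 2 * u))" by (simp add: exp_add[symmetric])
  finally show ?thesis .
qed

lemma integral_eq_via_nn:
  fixes f :: "'x \<Rightarrow> real" and h :: "'y \<Rightarrow> real"
  assumes "f \<in> borel_measurable M" "integrable N h"
    and "(\<integral>\<^sup>+x. ennreal (f x) \<partial>M) = (\<integral>\<^sup>+x. ennreal (h x) \<partial>N)"
    and "(\<integral>\<^sup>+x. ennreal (- f x) \<partial>M) = (\<integral>\<^sup>+x. ennreal (- h x) \<partial>N)"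
  shows "integrable M f" "integral\<^sup>L M f = integral\<^sup>L N h"
proof -
  show i: "integrable M f" using assms by (simp add: real_integrable_def)
  show "integral\<^sup>L M f = integral\<^sup>L N h"
    using assms by (simp add: real_lebesgue_integral_def[OF i] real_lebesgue_integral_def[OF assms(2)])
qed

lemma emeasure_lborel_sphere: "emeasure lborel {y::'a::euclidean_space. dist x y = r} = 0"
proof -
  have "negligible (sphere x r)" by (rule negligible_sphere)
  then have "sphere x r \<in> null_sets lebesgue" by (simp add: negligible_iff_null_sets)
  then have "emeasure lborel (sphere x r) = 0"
    by (simp add: null_sets_def emeasure_completion[symmetric] main_part_sets)
  moreover have "sphere x r = {y. dist x y = r}" by auto
  ultimately show ?thesis by simp
qed

section \<open>Bias of the estimator\<close>

text \<open>
What the mean squared error depends on. The set \<open>S\<close> has finite volume and carries the density \<open>q\<close>; \<open>lo\<close> bounds both \<open>q\<close> on \<open>S\<close> and, relative to volume, the mass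
of balls centred in \<open>S\<close>, from below, up to a radius \<open>D\<close> that bounds every distance between points of \<open>S\<close>.
The smoothness and the boundary conditions are condensed into the \<open>L1\<close> modulus of continuity.
\<close>
locale knn_model =
  fixes q :: "'a::euclidean_space \<Rightarrow> real" and S :: "'a set" and lo Mx D L s :: real
  assumes q_meas [measurable]: "q \<in> borel_measurable borel"
    and q0: "0 \<le> q x" and qM: "q x \<le> Mx" and qS: "x \<notin> S \<Longrightarrow> q x = 0" and qlo: "x \<in> S \<Longrightarrow> lo \<le> q x"
    and lo: "0 < lo" and Mx: "1 \<le> Mx" and S_meas [measurable]: "S \<in> sets borel"
    and Sfin: "emeasure lborel S < \<infinity>"
    and q1: "(\<integral>\<^sup>+x. ennreal (q x) \<partial>lborel) = 1"
    and mass: "x \<in> S \<Longrightarrow> 0 \<le> r \<Longrightarrow> r \<le> D \<Longrightarrow>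
      lo * (unit_ball_vol (real DIM('a)) * r ^ DIM('a)) \<le> measure (density lborel q) (ball x r)"
    and diam: "x \<in> S \<Longrightarrow> y \<in> S \<Longrightarrow> dist x y \<le> D"
    and L1: "(\<integral>\<^sup>+x. ennreal \<bar>q (x + h) - q x\<bar> \<partial>lborel) \<le> ennreal (L * norm h powr s)"
    and L: "0 \<le> L" and s: "0 < s"
begin

definition \<mu> :: "'a measure" where "\<mu> = density lborel (\<lambda>x. ennreal (q x))"

definition ball_mass :: "'a \<Rightarrow> real \<Rightarrow> real" where "ball_mass x r = measure \<mu> (ball x r)"

lemma sets_mu [measurable_cong, simp]: "sets \<mu> = sets borel"
  by (simp add: \<mu>_def)

lemma prob_mu: "prob_space \<mu>"
proof
  show "emeasure \<mu> (space \<mu>) = 1"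
    unfolding \<mu>_def by (subst emeasure_density) (auto simp: q1)
qed

sublocale mu: prob_space \<mu> by (rule prob_mu)

lemma unit_ball_vol_DIM_pos: "0 < unit_ball_vol (real DIM('a))" by simp

lemma emeasure_mu_ball: "emeasure \<mu> (ball x r) = (\<integral>\<^sup>+z. ennreal (q z) * indicator (ball x r) z \<partial>lborel)"
  unfolding \<mu>_def by (subst emeasure_density) auto

lemma ball_mass_bounds: "0 \<le> ball_mass x r" "ball_mass x r \<le> 1" "0 \<le> r \<Longrightarrow> ball_mass x r \<le> Mx * (unit_ball_vol (real DIM('a)) * r ^ DIM('a))"
proof -
  show "0 \<le> ball_mass x r" "ball_mass x r \<le> 1" by (auto simp: ball_mass_def)
  assume r: "0 \<le> r"
  have "ennreal (ball_mass x r) = emeasure \<mu> (ball x r)" by (simp add: ball_mass_def mu.emeasure_eq_measure)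
  also have "\<dots> \<le> (\<integral>\<^sup>+z. ennreal Mx * indicator (ball x r) z \<partial>lborel)"
    unfolding emeasure_mu_ball by (intro nn_integral_mono mult_right_mono ennreal_leI qM) auto
  also have "\<dots> = ennreal Mx * ennreal (unit_ball_vol (real DIM('a)) * r ^ DIM('a))"
    using r by (simp add: nn_integral_cmult_indicator emeasure_ball)
  also have "\<dots> = ennreal (Mx * (unit_ball_vol (real DIM('a)) * r ^ DIM('a)))"
    using Mx r by (simp add: ennreal_mult)
  finally show "ball_mass x r \<le> Mx * (unit_ball_vol (real DIM('a)) * r ^ DIM('a))"
    using Mx r by (subst (asm) ennreal_le_iff) auto
qed

lemma ball_mass_lower: "x \<in> S \<Longrightarrow> 0 \<le> r \<Longrightarrow> r \<le> D \<Longrightarrow> lo * (unit_ball_vol (real DIM('a)) * r ^ DIM('a)) \<le> ball_mass x r"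
  using mass by (simp add: ball_mass_def \<mu>_def)

lemma mu_sphere: "emeasure \<mu> {y. dist x y = r} = 0"
proof -
  have "{y. dist x y = r} \<in> null_sets lborel"
    using emeasure_lborel_sphere[of x r] by (auto simp: null_sets_def)
  then have "(\<integral>\<^sup>+z. ennreal (q z) * indicator {y. dist x y = r} z \<partial>lborel) = 0"
    by (rule nn_integral_null_set)
  moreover have "{y. dist x y = r} \<in> sets lborel"
    using \<open>{y. dist x y = r} \<in> null_sets lborel\<close> by (rule null_setsD2)
  ultimately show ?thesis unfolding \<mu>_def
    by (subst emeasure_density) (use q_meas in simp_all)
qed

lemma nn_mu: "f \<in> borel_measurable borel \<Longrightarrow> (\<integral>\<^sup>+x. f x \<partial>\<mu>) = (\<integral>\<^sup>+x. ennreal (q x) * f x \<partial>lborel)"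
  unfolding \<mu>_def by (subst nn_integral_density) auto

lemma ball_mass_meas [measurable]: "(\<lambda>z. ball_mass (fst z) (dist (fst z) (snd z))) \<in> borel_measurable (borel \<Otimes>\<^sub>M borel)"
  using borel_measurable_measure_ball[OF prob_mu sets_mu] by (simp add: ball_mass_def case_prod_beta)

lemma ball_mass_meas1 [measurable]: "(\<lambda>y. ball_mass x (dist x y)) \<in> borel_measurable borel"
  using measurable_compose[OF _ ball_mass_meas, of "\<lambda>y. (x, y)" borel] by simp

definition pair_weight :: "nat \<Rightarrow> nat \<Rightarrow> 'a \<Rightarrow> 'a \<Rightarrow> real" where
  "pair_weight k n x y = knn_weight k n (ball_mass x (dist x y))"

lemma pair_weight_nonneg: "0 \<le> pair_weight k n x y"
  by (simp add: pair_weight_def knn_weight_nonneg ball_mass_bounds)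

lemma pair_weight_meas [measurable]: "(\<lambda>z. pair_weight k n (fst z) (snd z)) \<in> borel_measurable (borel \<Otimes>\<^sub>M borel)"
  unfolding pair_weight_def by measurable

lemma pair_weight_meas1 [measurable]: "pair_weight k n x \<in> borel_measurable borel"
  unfolding pair_weight_def[abs_def] by measurable

lemma vol_nonneg: "0 \<le> vol n x y" by (simp add: vol_def)

lemma scaled_ball_mass_bounds:
  "real n * ball_mass x (dist x y) \<le> Mx * vol n x y"
  "x \<in> S \<Longrightarrow> y \<in> S \<Longrightarrow> lo * vol n x y \<le> real n * ball_mass x (dist x y)"
proof -
  have "real n * ball_mass x (dist x y) \<le> real n * (Mx * (unit_ball_vol (real DIM('a)) * dist x y ^ DIM('a)))"
    by (intro mult_left_mono ball_mass_bounds) auto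
  then show "real n * ball_mass x (dist x y) \<le> Mx * vol n x y" by (simp add: vol_def mult_ac)
  assume "x \<in> S" "y \<in> S"
  then have "real n * (lo * (unit_ball_vol (real DIM('a)) * dist x y ^ DIM('a))) \<le> real n * ball_mass x (dist x y)"
    by (intro mult_left_mono ball_mass_lower diam) auto
  then show "lo * vol n x y \<le> real n * ball_mass x (dist x y)" by (simp add: vol_def mult_ac)
qed

text \<open>
For \<open>x\<close> and \<open>y\<close> in \<open>S\<close> the mass of the ball around \<open>x\<close> through \<open>y\<close> is comparable with its volume, also
for large radii; hence exponential decay in the rescaled volume.
\<close>
lemma pair_weight_le:
  assumes "x \<in> S" "y \<in> S" "1 \<le> k" "k \<le> n"
  shows "pair_weight k n x y \<le> exp (real k) * Mx ^ (k - 1) * (real n * (vol n x y ^ (k - 1) * exp (- (lo * vol n x y))))"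
proof -
  let ?t = "real n * ball_mass x (dist x y)"
  have t: "0 \<le> ?t" "?t \<le> Mx * vol n x y" "lo * vol n x y \<le> ?t"
    using scaled_ball_mass_bounds(1)[of n x y] scaled_ball_mass_bounds(2)[of x y n] assms ball_mass_bounds by auto
  have "pair_weight k n x y \<le> exp (real k) * (real n * (?t ^ (k - 1) * exp (- ?t)))"
    unfolding pair_weight_def using assms ball_mass_bounds by (intro knn_weight_le) auto
  also have "\<dots> \<le> exp (real k) * (real n * ((Mx * vol n x y) ^ (k - 1) * exp (- (lo * vol n x y))))"
    using power_mono[OF t(2,1), of "k - 1"] t by (intro mult_left_mono mult_mono) auto
  finally show ?thesis by (simp add: power_mult_distrib mult_ac)
qed

text \<open>
The density, with respect to Lebesgue measure, of a sample point \<open>x\<close> together with its \<open>k\<close>-th nearest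
neighbour \<open>y\<close>.
\<close>
definition pair_density :: "nat \<Rightarrow> nat \<Rightarrow> 'a \<Rightarrow> 'a \<Rightarrow> real" where
  "pair_density k n x y = q x * q y * pair_weight k n x y"

lemma pair_density_meas [measurable]:
  "(\<lambda>z. pair_density k n (fst z) (snd z)) \<in> borel_measurable (borel \<Otimes>\<^sub>M borel)"
  "pair_density k n x \<in> borel_measurable borel"
  unfolding pair_density_def[abs_def] by measurable

lemma pair_density_nonneg: "0 \<le> pair_density k n x y"
  by (simp add: pair_density_def q0 pair_weight_nonneg)

lemma nn_integral_knn_volume:
  assumes J: "finite J" "1 \<le> k" "k \<le> card J" "i \<notin> J" and G [measurable]: "G \<in> borel_measurable borel"
  shows "(\<integral>\<^sup>+z. G (real (card J) * (unit_ball_vol (real DIM('a)) * kth_smallest k (\<lambda>j. dist (z i) (z j)) J ^ DIM('a))) \<partial>PiM (insert i J) (\<lambda>_. \<mu>))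
    = (\<integral>\<^sup>+x. \<integral>\<^sup>+y. ennreal (pair_density k (card J) x y) * G (vol (card J) x y) \<partial>lborel \<partial>lborel)"
proof -
  have "(\<integral>\<^sup>+z. G (real (card J) * (unit_ball_vol (real DIM('a)) * kth_smallest k (\<lambda>j. dist (z i) (z j)) J ^ DIM('a))) \<partial>PiM (insert i J) (\<lambda>_. \<mu>))
    = (\<integral>\<^sup>+x. \<integral>\<^sup>+y. ennreal (pair_weight k (card J) x y) * G (vol (card J) x y) \<partial>\<mu> \<partial>\<mu>)"
    using nn_integral_knn_radius[OF prob_mu sets_mu mu_sphere J, of "\<lambda>r. G (real (card J) * (unit_ball_vol (real DIM('a)) * r ^ DIM('a)))"]
    by (simp add: pair_weight_def ball_mass_def vol_def)
  also have "\<dots> = (\<integral>\<^sup>+x. ennreal (q x) * (\<integral>\<^sup>+y. ennreal (q y) * (ennreal (pair_weight k (card J) x y) * G (vol (card J) x y)) \<partial>lborel) \<partial>lborel)"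
  proof (subst nn_mu)
    have "(\<lambda>z. ennreal (pair_weight k (card J) (fst z) (snd z)) * G (vol (card J) (fst z) (snd z)))
        \<in> borel_measurable (borel \<Otimes>\<^sub>M \<mu>)"
      by measurable
    from mu.borel_measurable_nn_integral_fst[OF this]
    show "(\<lambda>x. \<integral>\<^sup>+y. ennreal (pair_weight k (card J) x y) * G (vol (card J) x y) \<partial>\<mu>) \<in> borel_measurable borel"
      by simp
    have "(\<integral>\<^sup>+y. ennreal (pair_weight k (card J) x y) * G (vol (card J) x y) \<partial>\<mu>)
      = (\<integral>\<^sup>+y. ennreal (q y) * (ennreal (pair_weight k (card J) x y) * G (vol (card J) x y)) \<partial>lborel)" for x
      by (rule nn_mu) measurable
    then show "(\<integral>\<^sup>+x. ennreal (q x) * (\<integral>\<^sup>+y. ennreal (pair_weight k (card J) x y) * G (vol (card J) x y) \<partial>\<mu>) \<partial>lborel)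
      = (\<integral>\<^sup>+x. ennreal (q x) * (\<integral>\<^sup>+y. ennreal (q y) * (ennreal (pair_weight k (card J) x y) * G (vol (card J) x y)) \<partial>lborel) \<partial>lborel)"
      by presburger
  qed
  also have "\<dots> = (\<integral>\<^sup>+x. \<integral>\<^sup>+y. ennreal (pair_density k (card J) x y) * G (vol (card J) x y) \<partial>lborel \<partial>lborel)"
  proof (intro nn_integral_cong)
    fix x
    have "ennreal (q x) * (\<integral>\<^sup>+y. ennreal (q y) * (ennreal (pair_weight k (card J) x y) * G (vol (card J) x y)) \<partial>lborel)
      = (\<integral>\<^sup>+y. ennreal (q x) * (ennreal (q y) * (ennreal (pair_weight k (card J) x y) * G (vol (card J) x y))) \<partial>lborel)"
      by (intro nn_integral_cmult[symmetric]) measurable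
    also have "\<dots> = (\<integral>\<^sup>+y. ennreal (pair_density k (card J) x y) * G (vol (card J) x y) \<partial>lborel)"
    proof (intro nn_integral_cong)
      fix y
      have "ennreal (pair_density k (card J) x y) = ennreal (q x) * (ennreal (q y) * ennreal (pair_weight k (card J) x y))"
        using q0 pair_weight_nonneg by (simp add: pair_density_def ennreal_mult mult.assoc)
      then show "ennreal (q x) * (ennreal (q y) * (ennreal (pair_weight k (card J) x y) * G (vol (card J) x y)))
        = ennreal (pair_density k (card J) x y) * G (vol (card J) x y)" by (simp only: mult.assoc)
    qed
    finally show "ennreal (q x) * (\<integral>\<^sup>+y. ennreal (q y) * (ennreal (pair_weight k (card J) x y) * G (vol (card J) x y)) \<partial>lborel)
      = (\<integral>\<^sup>+y. ennreal (pair_density k (card J) x y) * G (vol (card J) x y) \<partial>lborel)" .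
  qed
  finally show ?thesis .
qed

text \<open>
A bound uniform in \<open>n\<close>: the factor \<open>n\<close> in the weight is exactly what the change of variables from \<open>y\<close>
to the rescaled volume absorbs.
\<close>
lemma moment_bound:
  assumes k: "1 \<le> k" "k \<le> n" and G [measurable]: "G \<in> borel_measurable borel"
  shows "(\<integral>\<^sup>+x. \<integral>\<^sup>+y. ennreal (pair_density k n x y) * G (vol n x y) \<partial>lborel \<partial>lborel)
    \<le> ennreal (Mx * (exp (real k) * Mx ^ (k - 1))) *
       (\<integral>\<^sup>+u. ennreal (u ^ (k - 1) * exp (- (lo * u))) * G u * indicator {0<..} u \<partial>lborel)"
    (is "_ \<le> ennreal ?K * ?I")
proof -
  have n: "0 < real n" "1 \<le> n" using k by auto
  have K: "0 \<le> ?K" using Mx by simp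
  let ?H = "\<lambda>u. ennreal (u ^ (k - 1) * exp (- (lo * u))) * G u"
  have pd: "ennreal (pair_density k n x y) * G (vol n x y) \<le> ennreal (q x * ?K * real n) * ?H (vol n x y)" for x y
  proof -
    have "pair_density k n x y \<le> q x * ?K * real n * (vol n x y ^ (k - 1) * exp (- (lo * vol n x y)))"
    proof (cases "x \<in> S \<and> y \<in> S")
      case True
      then have "q x * (q y * pair_weight k n x y) \<le> q x * (Mx * (exp (real k) * Mx ^ (k - 1) * (real n * (vol n x y ^ (k - 1) * exp (- (lo * vol n x y))))))"
        using pair_weight_le[of x y k n] k qM q0 pair_weight_nonneg Mx by (intro mult_left_mono mult_mono) auto
      then show ?thesis by (simp add: pair_density_def mult_ac)
    next
      case False
      then have "pair_density k n x y = 0" using qS by (auto simp: pair_density_def)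
      moreover have "0 \<le> q x * ?K * real n * (vol n x y ^ (k - 1) * exp (- (lo * vol n x y)))"
        using q0 Mx vol_nonneg by (intro mult_nonneg_nonneg zero_le_power) auto
      ultimately show ?thesis by simp
    qed
    then have "ennreal (pair_density k n x y) \<le> ennreal (q x * ?K * real n) * ennreal (vol n x y ^ (k - 1) * exp (- (lo * vol n x y)))"
      using q0 Mx vol_nonneg[of n x y] by (subst ennreal_mult[symmetric]) (auto intro!: ennreal_leI)
    then have "ennreal (pair_density k n x y) * G (vol n x y) \<le>
        ennreal (q x * ?K * real n) * ennreal (vol n x y ^ (k - 1) * exp (- (lo * vol n x y))) * G (vol n x y)"
      by (rule mult_right_mono) simp
    then show ?thesis by (simp only: mult.assoc)
  qed
  have "(\<integral>\<^sup>+x. \<integral>\<^sup>+y. ennreal (pair_density k n x y) * G (vol n x y) \<partial>lborel \<partial>lborel)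
    \<le> (\<integral>\<^sup>+x. \<integral>\<^sup>+y. ennreal (q x * ?K * real n) * ?H (vol n x y) \<partial>lborel \<partial>lborel)"
    by (intro nn_integral_mono pd)
  also have "\<dots> = (\<integral>\<^sup>+x. ennreal (q x * ?K) * ?I \<partial>lborel)"
  proof (intro nn_integral_cong)
    fix x
    have "(\<integral>\<^sup>+y. ennreal (q x * ?K * real n) * ?H (vol n x y) \<partial>lborel) = ennreal (q x * ?K * real n) * (ennreal (1 / real n) * ?I)"
      using nn_integral_vol[OF n(2), of ?H x] by (simp add: nn_integral_cmult)
    also have "\<dots> = ennreal (q x * ?K) * ?I"
    proof -
      have "ennreal (q x * ?K * real n) * ennreal (1 / real n) = ennreal (q x * ?K * real n * (1 / real n))"
        using q0 Mx n by (intro ennreal_mult[symmetric] mult_nonneg_nonneg zero_le_power) auto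
      also have "q x * ?K * real n * (1 / real n) = q x * ?K" using n by simp
      finally have e: "ennreal (q x * ?K * real n) * ennreal (1 / real n) = ennreal (q x * ?K)" .
      show ?thesis by (subst mult.assoc[symmetric]) (simp only: e)
    qed
    finally show "(\<integral>\<^sup>+y. ennreal (q x * ?K * real n) * ?H (vol n x y) \<partial>lborel) = ennreal (q x * ?K) * ?I" .
  qed
  also have "\<dots> = (\<integral>\<^sup>+x. ennreal (q x) * (ennreal ?K * ?I) \<partial>lborel)"
    using q0 K by (intro nn_integral_cong) (simp add: ennreal_mult mult.assoc)
  also have "\<dots> = ennreal ?K * ?I" by (subst nn_integral_multc) (auto simp: q1)
  finally show ?thesis .
qed

lemma nn_integral_shift_pair:
  fixes A :: "'a \<Rightarrow> 'a \<Rightarrow> ennreal"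
  assumes [measurable]: "(\<lambda>z. A (fst z) (snd z)) \<in> borel_measurable (borel \<Otimes>\<^sub>M borel)"
  shows "(\<integral>\<^sup>+x. \<integral>\<^sup>+y. A x y \<partial>lborel \<partial>lborel) = (\<integral>\<^sup>+h. \<integral>\<^sup>+x. A x (x + h) \<partial>lborel \<partial>lborel)"
proof -
  have m1: "A x \<in> borel_measurable borel" for x
    using measurable_compose[OF _ assms, of "\<lambda>y. (x, y)" borel] by simp
  have m2: "(\<lambda>(h, x). A x (x + h)) \<in> borel_measurable (lborel \<Otimes>\<^sub>M lborel)"
    using measurable_compose[OF _ assms, of "\<lambda>(h, x). (x, x + h)" "lborel \<Otimes>\<^sub>M lborel"] by (simp add: case_prod_beta)
  have "(\<integral>\<^sup>+x. \<integral>\<^sup>+y. A x y \<partial>lborel \<partial>lborel) = (\<integral>\<^sup>+x. \<integral>\<^sup>+h. A x (x + h) \<partial>lborel \<partial>lborel)"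
  proof (rule nn_integral_cong)
    fix x
    show "(\<integral>\<^sup>+y. A x y \<partial>lborel) = (\<integral>\<^sup>+h. A x (x + h) \<partial>lborel)"
      using nn_integral_lborel_shift[OF m1, of x x] by (simp add: add.commute)
  qed
  also have "\<dots> = (\<integral>\<^sup>+h. \<integral>\<^sup>+x. A x (x + h) \<partial>lborel \<partial>lborel)"
    using lborel_pair.Fubini'[OF m2] .
  finally show ?thesis .
qed

text \<open>
The mass of a ball differs from \<open>q x\<close> times its volume by an integral of \<open>q (x + z) - q x\<close> over the ball;
integrate over \<open>x\<close> first.
\<close>
lemma ball_mass_center:
  assumes r: "0 \<le> r"
  shows "(\<integral>\<^sup>+x. ennreal \<bar>ball_mass x r - unit_ball_vol (real DIM('a)) * r ^ DIM('a) * q x\<bar> \<partial>lborel) \<le> ennreal (L * r powr s * (unit_ball_vol (real DIM('a)) * r ^ DIM('a)))"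
proof -
  let ?B = "ball (0::'a) r"
  have [measurable]: "ball x r \<in> sets borel" for x :: 'a by simp
  have vB: "emeasure lborel ?B = ennreal (unit_ball_vol (real DIM('a)) * r ^ DIM('a))" using r by (rule emeasure_ball)
  have pt: "ennreal \<bar>ball_mass x r - unit_ball_vol (real DIM('a)) * r ^ DIM('a) * q x\<bar> \<le> (\<integral>\<^sup>+z. ennreal \<bar>q (x + z) - q x\<bar> * indicator ?B z \<partial>lborel)" for x
  proof -
    have i1: "integrable lborel (\<lambda>z. q (x + z) * indicator ?B z)"
    proof (rule Bochner_Integration.integrable_bound[where f = "\<lambda>z. Mx * indicator ?B z :: real"])
      show "integrable lborel (\<lambda>z. Mx * indicator ?B z)"
        using vB by (intro integrable_mult_right integrable_real_indicator) auto
      show "AE z in lborel. norm (q (x + z) * indicator ?B z :: real) \<le> norm (Mx * indicator ?B z :: real)"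
        using q0 qM Mx by (intro AE_I2) (auto simp: indicator_def)
    qed measurable
    have i2: "integrable lborel (\<lambda>z. q x * indicator ?B z)"
      using vB by (intro integrable_mult_right integrable_real_indicator) auto
    have "ennreal (ball_mass x r) = (\<integral>\<^sup>+z. ennreal (q z) * indicator (ball x r) z \<partial>lborel)"
      unfolding emeasure_mu_ball[symmetric] by (simp add: ball_mass_def mu.emeasure_eq_measure)
    also have "\<dots> = (\<integral>\<^sup>+z. ennreal (q (z + x)) * indicator (ball x r) (z + x) \<partial>lborel)"
      by (rule nn_integral_lborel_shift[symmetric]) measurable
    also have "\<dots> = (\<integral>\<^sup>+z. ennreal (q (x + z) * indicator ?B z) \<partial>lborel)"
      using q0 by (intro nn_integral_cong) (auto simp: indicator_def dist_norm add.commute)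
    also have "\<dots> = ennreal (\<integral>z. q (x + z) * indicator ?B z \<partial>lborel)"
      using q0 by (intro nn_integral_eq_integral i1) auto
    finally have e1: "ball_mass x r = (\<integral>z. q (x + z) * indicator ?B z \<partial>lborel)"
      using q0 ball_mass_bounds by (subst (asm) ennreal_inj) (auto intro!: integral_nonneg_AE)
    have e2: "unit_ball_vol (real DIM('a)) * r ^ DIM('a) * q x = (\<integral>z. q x * indicator ?B z \<partial>lborel)"
      using vB r by (simp add: measure_def)
    have "ball_mass x r - unit_ball_vol (real DIM('a)) * r ^ DIM('a) * q x = (\<integral>z. q (x + z) * indicator ?B z - q x * indicator ?B z \<partial>lborel)"
      unfolding e1 e2 by (rule Bochner_Integration.integral_diff[OF i1 i2, symmetric])
    then have "ennreal \<bar>ball_mass x r - unit_ball_vol (real DIM('a)) * r ^ DIM('a) * q x\<bar> \<le> (\<integral>\<^sup>+z. norm (q (x + z) * indicator ?B z - q x * indicator ?B z) \<partial>lborel)"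
      using integral_norm_bound_ennreal[OF Bochner_Integration.integrable_diff[OF i1 i2]]
      unfolding real_norm_def by metis
    also have "\<dots> = (\<integral>\<^sup>+z. ennreal \<bar>q (x + z) - q x\<bar> * indicator ?B z \<partial>lborel)"
      by (intro nn_integral_cong) (auto simp: indicator_def)
    finally show ?thesis .
  qed
  have m: "(\<lambda>(x, z). ennreal \<bar>q (x + z) - q x\<bar> * indicator ?B z) \<in> borel_measurable (lborel \<Otimes>\<^sub>M lborel)"
    by measurable
  have "(\<integral>\<^sup>+x. ennreal \<bar>ball_mass x r - unit_ball_vol (real DIM('a)) * r ^ DIM('a) * q x\<bar> \<partial>lborel)
     \<le> (\<integral>\<^sup>+x. \<integral>\<^sup>+z. ennreal \<bar>q (x + z) - q x\<bar> * indicator ?B z \<partial>lborel \<partial>lborel)"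
    by (intro nn_integral_mono pt)
  also have "\<dots> = (\<integral>\<^sup>+z. \<integral>\<^sup>+x. ennreal \<bar>q (x + z) - q x\<bar> * indicator ?B z \<partial>lborel \<partial>lborel)"
    using lborel_pair.Fubini'[OF m] by simp
  also have "\<dots> = (\<integral>\<^sup>+z. (\<integral>\<^sup>+x. ennreal \<bar>q (x + z) - q x\<bar> \<partial>lborel) * indicator ?B z \<partial>lborel)"
    by (intro nn_integral_cong nn_integral_multc) measurable
  also have "\<dots> \<le> (\<integral>\<^sup>+z. ennreal (L * r powr s) * indicator ?B z \<partial>lborel)"
  proof (intro nn_integral_mono)
    fix z :: 'a
    show "(\<integral>\<^sup>+x. ennreal \<bar>q (x + z) - q x\<bar> \<partial>lborel) * indicator ?B z \<le> ennreal (L * r powr s) * indicator ?B z"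
    proof (cases "z \<in> ?B")
      case True
      have "ennreal (L * norm z powr s) \<le> ennreal (L * r powr s)"
        using True L s by (intro ennreal_leI mult_left_mono powr_mono2) auto
      then show ?thesis using L1[of z] True by simp
    qed simp
  qed
  also have "\<dots> = ennreal (L * r powr s * (unit_ball_vol (real DIM('a)) * r ^ DIM('a)))"
    using L r by (simp add: nn_integral_cmult_indicator vB ennreal_mult)
  finally show ?thesis .
qed

end

lemma nn_integral_cmult_add3:
  assumes [measurable]: "f1 \<in> borel_measurable M" "f2 \<in> borel_measurable M" "f3 \<in> borel_measurable M"
  shows "(\<integral>\<^sup>+x. c * (f1 x + f2 x + f3 x) \<partial>M) = c * (integral\<^sup>N M f1 + integral\<^sup>N M f2 + integral\<^sup>N M f3)"
  by (simp add: nn_integral_cmult nn_integral_add)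

context knn_model begin

text \<open>
The counterpart of \<open>pair_density\<close> in which the density is constant with value \<open>q x\<close> and the sample is a
Poisson process of intensity \<open>n * q x\<close>.
\<close>
definition poisson_density :: "nat \<Rightarrow> nat \<Rightarrow> 'a \<Rightarrow> 'a \<Rightarrow> real" where
  "poisson_density k n x y = q x * q x * pois_weight k n (q x * vol n x y)"

lemma poisson_density_meas [measurable]:
  "(\<lambda>z. poisson_density k n (fst z) (snd z)) \<in> borel_measurable (borel \<Otimes>\<^sub>M borel)"
  unfolding poisson_density_def by measurable

definition mean_density :: "'a \<Rightarrow> real \<Rightarrow> real" where
  "mean_density x r = ball_mass x r / (unit_ball_vol (real DIM('a)) * r ^ DIM('a))"

lemma mean_density_meas [measurable]:
  "(\<lambda>z. mean_density (fst z) (dist (fst z) (snd z))) \<in> borel_measurable (borel \<Otimes>\<^sub>M borel)"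
  unfolding mean_density_def by measurable

definition bias_const :: "nat \<Rightarrow> real" where
  "bias_const k = Mx * Mx ^ (k - 1)
     + Mx * (Mx * (exp (real k + 1) * (real k)\<^sup>2 * (Mx ^ (k - 1) * Mx\<^sup>2 * (1 / (min 1 (lo / 4))\<^sup>2))))
     + Mx * (Mx * (real k * Mx ^ (k - 1) * (1 / (min 1 (lo / 4))\<^sup>2)))"

lemma bias_const_nonneg: "0 \<le> bias_const k"
  unfolding bias_const_def using Mx by (intro add_nonneg_nonneg mult_nonneg_nonneg) auto

text \<open>
The difference \<open>q y - q x\<close> is attached to the Poisson weight, which decays for all \<open>y\<close>; the
remaining terms carry the factor \<open>q y\<close> and hence vanish unless \<open>y\<close> lies in \<open>S\<close>, where the binomial weight is
under control.
\<close>
lemma density_diff_bound: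
  assumes k: "1 \<le> k" "k \<le> n" and xy: "x \<noteq> y"
  shows "\<bar>pair_density k n x y - poisson_density k n x y\<bar> \<le> bias_const k *
     (vol n x y ^ (k - 1) * exp (- (lo / 2 * vol n x y))) *
     (real n * \<bar>q y - q x\<bar> + indicator S x + real n * \<bar>mean_density x (dist x y) - q x\<bar>)"
proof (cases "x \<in> S")
  case False
  then have "pair_density k n x y = 0" "poisson_density k n x y = 0"
    using qS by (auto simp: pair_density_def poisson_density_def)
  moreover have "0 \<le> bias_const k * (vol n x y ^ (k - 1) * exp (- (lo / 2 * vol n x y))) *
     (real n * \<bar>q y - q x\<bar> + indicator S x + real n * \<bar>mean_density x (dist x y) - q x\<bar>)"
    using bias_const_nonneg vol_nonneg by (intro mult_nonneg_nonneg add_nonneg_nonneg zero_le_power) auto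
  ultimately show ?thesis by simp
next
  case xS: True
  define u where "u = vol n x y"
  \<comment> \<open>The constant of \<open>square_exp_bound\<close>, the price for halving the exponential rate.\<close>
  define B where "B = 1 / (min 1 (lo / 4))\<^sup>2"
  define \<alpha> where "\<alpha> = mean_density x (dist x y)"
  define e where "e = u ^ (k - 1) * exp (- (lo / 2 * u))"
  have n: "0 < real n" using k by simp
  have r: "0 < dist x y" using xy by simp
  have V: "0 < unit_ball_vol (real DIM('a)) * dist x y ^ DIM('a)" using r by simp
  have u: "0 < u" unfolding u_def vol_def using n V by simp
  have e0: "0 \<le> e" using u by (simp add: e_def)
  have B0: "0 \<le> B" by (simp add: B_def)
  have M0: "0 \<le> Mx" using Mx by simp
  have \<alpha>u: "real n * ball_mass x (dist x y) = \<alpha> * u"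
    unfolding \<alpha>_def u_def mean_density_def vol_def using less_imp_neq[OF V] by auto
  have qx: "lo \<le> q x" "q x \<le> Mx" "0 \<le> q x" using qlo[OF xS] qM q0 by auto
  have sq: "(1 + u)\<^sup>2 * exp (- (lo * u)) \<le> B * exp (- (lo / 2 * u))"
    unfolding B_def using lo u by (intro square_exp_bound) auto
  have ee: "exp (- (lo * u)) \<le> exp (- (lo / 2 * u))" using lo u by simp
  have p1: "pois_weight k n (q x * u) \<le> real n * (Mx ^ (k - 1) * e)"
  proof -
    have "(q x * u) ^ (k - 1) * exp (- (q x * u)) \<le> (Mx * u) ^ (k - 1) * exp (- (lo / 2 * u))"
    proof (intro mult_mono power_mono)
      have "lo / 2 * u \<le> q x * u" using qx lo u by (intro mult_right_mono) auto
      then show "exp (- (q x * u)) \<le> exp (- (lo / 2 * u))" by simp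
    qed (use qx u M0 in auto)
    also have "\<dots> = Mx ^ (k - 1) * e" by (simp add: e_def power_mult_distrib)
    finally have "real n * ((q x * u) ^ (k - 1) * exp (- (q x * u))) / fact (k - 1) \<le> real n * (Mx ^ (k - 1) * e) / 1"
      using n e0 M0 by (intro frac_le mult_left_mono) (auto simp: fact_ge_1)
    then show ?thesis by (simp add: pois_weight_def)
  qed
  have q2: "q y * \<bar>pair_weight k n x y - pois_weight k n (q x * u)\<bar>
    \<le> Mx * (exp (real k + 1) * (real k)\<^sup>2 * (Mx ^ (k - 1) * Mx\<^sup>2 * B) * e
        + real n * (real k * Mx ^ (k - 1) * B * e * \<bar>\<alpha> - q x\<bar>))"
  proof (cases "y \<in> S")
    case False
    then have "q y = 0" by (rule qS)
    then show ?thesis using M0 B0 e0 n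
      by (auto intro!: mult_nonneg_nonneg add_nonneg_nonneg)
  next
    case yS: True
    let ?\<tau> = "real n * ball_mass x (dist x y)"
    have \<tau>: "0 \<le> ?\<tau>" "?\<tau> \<le> Mx * u" "lo * u \<le> ?\<tau>"
      using scaled_ball_mass_bounds(1)[of n x y] scaled_ball_mass_bounds(2)[OF xS yS, of n] ball_mass_bounds by (auto simp: u_def)
    have \<alpha>: "lo \<le> \<alpha>" "\<alpha> \<le> Mx" using \<tau>(2,3) u unfolding \<alpha>u by auto
    have "\<bar>pair_weight k n x y - pois_weight k n ?\<tau>\<bar>
      \<le> exp (real k + 1) * (real k)\<^sup>2 * (?\<tau> ^ (k - 1) * (1 + ?\<tau>)\<^sup>2 * exp (- ?\<tau>))"
      unfolding pair_weight_def using k ball_mass_bounds by (intro knn_weight_pois_weight) auto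
    also have "\<dots> \<le> exp (real k + 1) * (real k)\<^sup>2 * ((Mx * u) ^ (k - 1) * (Mx * (1 + u))\<^sup>2 * exp (- (lo * u)))"
    proof (rule mult_left_mono)
      have a: "?\<tau> ^ (k - 1) \<le> (Mx * u) ^ (k - 1)" by (rule power_mono[OF \<tau>(2,1)])
      have "1 + ?\<tau> \<le> Mx * (1 + u)" using \<tau>(2) Mx by (simp add: algebra_simps)
      then have b: "(1 + ?\<tau>)\<^sup>2 \<le> (Mx * (1 + u))\<^sup>2" using \<tau>(1) by (intro power_mono) auto
      have c: "exp (- ?\<tau>) \<le> exp (- (lo * u))" using \<tau>(3) by simp
      show "?\<tau> ^ (k - 1) * (1 + ?\<tau>)\<^sup>2 * exp (- ?\<tau>) \<le> (Mx * u) ^ (k - 1) * (Mx * (1 + u))\<^sup>2 * exp (- (lo * u))"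
        using \<tau>(1) u M0 by (intro mult_mono[OF mult_mono[OF a b] c]) auto
    qed simp
    also have "(Mx * u) ^ (k - 1) * (Mx * (1 + u))\<^sup>2 * exp (- (lo * u))
       = Mx ^ (k - 1) * Mx\<^sup>2 * u ^ (k - 1) * ((1 + u)\<^sup>2 * exp (- (lo * u)))"
      by (simp add: power_mult_distrib mult_ac)
    also have "exp (real k + 1) * (real k)\<^sup>2 * \<dots> \<le> exp (real k + 1) * (real k)\<^sup>2 * (Mx ^ (k - 1) * Mx\<^sup>2 * u ^ (k - 1) * (B * exp (- (lo / 2 * u))))"
      using sq u M0 by (intro mult_left_mono) auto
    finally have d1: "\<bar>pair_weight k n x y - pois_weight k n ?\<tau>\<bar> \<le> exp (real k + 1) * (real k)\<^sup>2 * (Mx ^ (k - 1) * Mx\<^sup>2 * B) * e"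
      by (simp add: e_def mult_ac)
    have "\<bar>(\<alpha> * u) ^ (k - 1) * exp (- (\<alpha> * u)) - (q x * u) ^ (k - 1) * exp (- (q x * u))\<bar>
      \<le> (real (k - 1) + 1) * Mx ^ (k - 1) * (u ^ (k - 1) * (1 + u) * exp (- (lo * u))) * \<bar>\<alpha> - q x\<bar>"
      using Mx lo \<alpha> qx u by (intro power_exp_diff_le) auto
    also have "\<dots> \<le> real k * Mx ^ (k - 1) * (u ^ (k - 1) * (B * exp (- (lo / 2 * u)))) * \<bar>\<alpha> - q x\<bar>"
    proof (rule mult_right_mono)
      have "(1 + u) * 1 \<le> (1 + u) * (1 + u)" using u by (intro mult_left_mono) auto
      then have "(1 + u) * exp (- (lo * u)) \<le> (1 + u)\<^sup>2 * exp (- (lo * u))"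
        by (intro mult_right_mono) (auto simp: power2_eq_square)
      also note sq
      finally have "u ^ (k - 1) * ((1 + u) * exp (- (lo * u))) \<le> u ^ (k - 1) * (B * exp (- (lo / 2 * u)))"
        using u by (intro mult_left_mono) auto
      then show "(real (k - 1) + 1) * Mx ^ (k - 1) * (u ^ (k - 1) * (1 + u) * exp (- (lo * u)))
        \<le> real k * Mx ^ (k - 1) * (u ^ (k - 1) * (B * exp (- (lo / 2 * u))))"
        using k M0 by (simp add: of_nat_diff mult.assoc mult_left_mono)
    qed simp
    also have "\<dots> = real k * Mx ^ (k - 1) * B * e * \<bar>\<alpha> - q x\<bar>" by (simp add: e_def mult_ac)
    finally have dd: "\<bar>(\<alpha> * u) ^ (k - 1) * exp (- (\<alpha> * u)) - (q x * u) ^ (k - 1) * exp (- (q x * u))\<bar>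
      \<le> real k * Mx ^ (k - 1) * B * e * \<bar>\<alpha> - q x\<bar>" .
    have "\<bar>pois_weight k n ?\<tau> - pois_weight k n (q x * u)\<bar>
      = real n * \<bar>(\<alpha> * u) ^ (k - 1) * exp (- (\<alpha> * u)) - (q x * u) ^ (k - 1) * exp (- (q x * u))\<bar> / fact (k - 1)"
      unfolding pois_weight_def \<alpha>u by (simp add: diff_divide_distrib[symmetric] right_diff_distrib[symmetric] abs_mult abs_divide)
    also have "\<dots> \<le> real n * (real k * Mx ^ (k - 1) * B * e * \<bar>\<alpha> - q x\<bar>) / 1"
      using dd B0 e0 M0 by (intro frac_le mult_left_mono) (auto simp: fact_ge_1)
    finally have d2: "\<bar>pois_weight k n ?\<tau> - pois_weight k n (q x * u)\<bar> \<le> real n * (real k * Mx ^ (k - 1) * B * e * \<bar>\<alpha> - q x\<bar>)"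
      by simp
    have "\<bar>pair_weight k n x y - pois_weight k n (q x * u)\<bar> \<le> exp (real k + 1) * (real k)\<^sup>2 * (Mx ^ (k - 1) * Mx\<^sup>2 * B) * e
        + real n * (real k * Mx ^ (k - 1) * B * e * \<bar>\<alpha> - q x\<bar>)"
      using d1 d2 by linarith
    then show ?thesis using qM q0 M0 by (intro mult_mono) auto
  qed
  have "pair_density k n x y - poisson_density k n x y
    = q x * ((q y - q x) * pois_weight k n (q x * u)) + q x * (q y * (pair_weight k n x y - pois_weight k n (q x * u)))"
    by (simp add: pair_density_def poisson_density_def u_def algebra_simps)
  then have "\<bar>pair_density k n x y - poisson_density k n x y\<bar>
    \<le> \<bar>q x * ((q y - q x) * pois_weight k n (q x * u))\<bar> + \<bar>q x * (q y * (pair_weight k n x y - pois_weight k n (q x * u)))\<bar>"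
    by (metis abs_triangle_ineq)
  also have "\<dots> = q x * (\<bar>q y - q x\<bar> * pois_weight k n (q x * u)) + q x * (q y * \<bar>pair_weight k n x y - pois_weight k n (q x * u)\<bar>)"
    using qx q0 u by (simp add: abs_mult pois_weight_nonneg)
  also have "\<dots> \<le> Mx * (\<bar>q y - q x\<bar> * (real n * (Mx ^ (k - 1) * e))) + Mx * (Mx * (exp (real k + 1) * (real k)\<^sup>2 * (Mx ^ (k - 1) * Mx\<^sup>2 * B) * e
        + real n * (real k * Mx ^ (k - 1) * B * e * \<bar>\<alpha> - q x\<bar>)))"
    using qx q0 M0 u pair_weight_nonneg
    by (intro add_mono mult_mono[OF qx(2) mult_left_mono[OF p1]] mult_mono[OF qx(2) q2])
      (auto intro!: mult_nonneg_nonneg pois_weight_nonneg)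
  also have "\<dots> = (Mx * Mx ^ (k - 1)) * (e * (real n * \<bar>q y - q x\<bar>))
      + (Mx * (Mx * (exp (real k + 1) * (real k)\<^sup>2 * (Mx ^ (k - 1) * Mx\<^sup>2 * B)))) * (e * 1)
      + (Mx * (Mx * (real k * Mx ^ (k - 1) * B))) * (e * (real n * \<bar>\<alpha> - q x\<bar>))"
    by (simp add: algebra_simps)
  also have "\<dots> \<le> bias_const k * (e * (real n * \<bar>q y - q x\<bar>)) + bias_const k * (e * 1) + bias_const k * (e * (real n * \<bar>\<alpha> - q x\<bar>))"
    unfolding bias_const_def B_def[symmetric]
    using M0 B0 e0 by (intro add_mono mult_right_mono) (auto intro!: mult_nonneg_nonneg add_nonneg_nonneg simp del: mult.commute)
  also have "\<dots> = bias_const k * e * (real n * \<bar>q y - q x\<bar> + indicator S x + real n * \<bar>\<alpha> - q x\<bar>)"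
    using xS by (simp add: algebra_simps)
  finally show ?thesis unfolding e_def u_def \<alpha>_def .
qed

text \<open>
All integrability conditions on the estimator function are stated through these moments. The exponential
is \<open>exp (- lo / 2 * u)\<close> because half of the available decay pays for polynomial factors in \<open>u\<close>.
\<close>
definition wmoment :: "(real \<Rightarrow> real) \<Rightarrow> nat \<Rightarrow> real \<Rightarrow> ennreal" where
  "wmoment \<phi> k \<theta> = (\<integral>\<^sup>+u. ennreal (\<bar>\<phi> u\<bar> * (u powr \<theta> * (u ^ (k - 1) * exp (- (lo / 2 * u))))) * indicator {0<..} u \<partial>lborel)"

lemma vol_self: "vol n x x = 0"
  by (simp add: vol_def zero_power)

lemma vol_shift: "vol n x (x + h) = vol n 0 h"
  by (simp add: vol_def dist_norm)

text \<open>
The three terms of \<open>density_diff_bound\<close> are integrated separately. In the first and the third, the shift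
\<open>y = x + h\<close> leaves the rescaled volume depending on \<open>h\<close> alone, and the inner integral over \<open>x\<close> is at most
\<open>L * norm h powr s\<close>. Written in terms of the rescaled volume, \<open>norm h powr s\<close> yields the rate.
\<close>
lemma bias_integral_bound:
  assumes k: "1 \<le> k" "k \<le> n" and \<phi> [measurable]: "\<phi> \<in> borel_measurable borel"
  shows "(\<integral>\<^sup>+x. \<integral>\<^sup>+y. ennreal \<bar>pair_density k n x y * \<phi> (vol n x y) - poisson_density k n x y * \<phi> (vol n x y)\<bar> \<partial>lborel \<partial>lborel)
    \<le> ennreal (bias_const k) *
       (ennreal (2 * L * (real n * unit_ball_vol (real DIM('a))) powr (- s / real DIM('a))) * wmoment \<phi> k (s / real DIM('a))
        + emeasure lborel S * ennreal (1 / real n) * wmoment \<phi> k 0)"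
proof -
  let ?V = "unit_ball_vol (real DIM('a))"
  define H where "H = (\<lambda>u. ennreal (\<bar>\<phi> u\<bar> * (u ^ (k - 1) * exp (- (lo / 2 * u)))) * indicator {0<..} u)"
  have [measurable]: "H \<in> borel_measurable borel" unfolding H_def by measurable
  have n: "0 < real n" "1 \<le> n" using k by auto
  have vp: "0 < vol n x y" if "x \<noteq> y" for x y :: 'a
    using that n by (simp add: vol_def)
  let ?A1 = "\<lambda>x y. H (vol n x y) * ennreal (real n * \<bar>q y - q x\<bar>)"
  let ?A2 = "\<lambda>x y. H (vol n x y) * indicator S x"
  let ?A3 = "\<lambda>x y. H (vol n x y) * ennreal (real n * \<bar>mean_density x (dist x y) - q x\<bar>)"
  have mm [measurable]: "(\<lambda>z. mean_density (fst z) (dist (fst z) (snd z))) \<in> borel_measurable (borel \<Otimes>\<^sub>M borel)"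
    by measurable
  have [measurable]: "(\<lambda>y. mean_density x (dist x y)) \<in> borel_measurable borel" for x
    using measurable_compose[OF _ mm, of "\<lambda>y. (x, y)" borel] by simp
  have [measurable]: "(\<lambda>x. mean_density x (norm h)) \<in> borel_measurable borel" for h :: 'a
    using measurable_compose[OF _ mm, of "\<lambda>x. (x, x + h)" borel] by (simp add: dist_norm)
  have pt: "ennreal \<bar>pair_density k n x y * \<phi> (vol n x y) - poisson_density k n x y * \<phi> (vol n x y)\<bar>
    \<le> ennreal (bias_const k) * (?A1 x y + ?A2 x y + ?A3 x y)" if xy: "x \<noteq> y" for x y
  proof -
    let ?E = "vol n x y ^ (k - 1) * exp (- (lo / 2 * vol n x y))"
    let ?R = "real n * \<bar>q y - q x\<bar> + indicator S x + real n * \<bar>mean_density x (dist x y) - q x\<bar>"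
    have E0: "0 \<le> ?E" using vol_nonneg by (intro mult_nonneg_nonneg zero_le_power) auto
    have "\<bar>pair_density k n x y * \<phi> (vol n x y) - poisson_density k n x y * \<phi> (vol n x y)\<bar>
      = \<bar>pair_density k n x y - poisson_density k n x y\<bar> * \<bar>\<phi> (vol n x y)\<bar>"
      by (simp add: abs_mult[symmetric] left_diff_distrib)
    also have "\<dots> \<le> bias_const k * ?E * ?R * \<bar>\<phi> (vol n x y)\<bar>"
      using density_diff_bound[OF k xy] by (intro mult_right_mono) auto
    also have "\<dots> = bias_const k * ((\<bar>\<phi> (vol n x y)\<bar> * ?E) * ?R)" by (simp add: mult_ac)
    finally have "ennreal \<bar>pair_density k n x y * \<phi> (vol n x y) - poisson_density k n x y * \<phi> (vol n x y)\<bar>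
      \<le> ennreal (bias_const k * ((\<bar>\<phi> (vol n x y)\<bar> * ?E) * ?R))" by (rule ennreal_leI)
    also have "\<dots> = ennreal (bias_const k) * (ennreal (\<bar>\<phi> (vol n x y)\<bar> * ?E) * ennreal ?R)"
      using bias_const_nonneg E0 by (simp add: ennreal_mult)
    also have "ennreal (\<bar>\<phi> (vol n x y)\<bar> * ?E) = H (vol n x y)" using vp[OF xy] by (simp add: H_def)
    also have "ennreal ?R = ennreal (real n * \<bar>q y - q x\<bar>) + indicator S x + ennreal (real n * \<bar>mean_density x (dist x y) - q x\<bar>)"
      by (auto simp: ennreal_plus indicator_def)
    finally show ?thesis by (simp add: distrib_left)
  qed
  have "(\<integral>\<^sup>+x. \<integral>\<^sup>+y. ennreal \<bar>pair_density k n x y * \<phi> (vol n x y) - poisson_density k n x y * \<phi> (vol n x y)\<bar> \<partial>lborel \<partial>lborel)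
    \<le> (\<integral>\<^sup>+x. \<integral>\<^sup>+y. ennreal (bias_const k) * (?A1 x y + ?A2 x y + ?A3 x y) \<partial>lborel \<partial>lborel)"
  proof (rule nn_integral_mono, rule nn_integral_mono_AE)
    fix x :: 'a
    show "AE y in lborel. ennreal \<bar>pair_density k n x y * \<phi> (vol n x y) - poisson_density k n x y * \<phi> (vol n x y)\<bar>
       \<le> ennreal (bias_const k) * (?A1 x y + ?A2 x y + ?A3 x y)"
      using AE_lborel_singleton[of x]
    proof eventually_elim
      case (elim y)
      then show ?case by (intro pt) auto
    qed
  qed
  also have "\<dots> = (\<integral>\<^sup>+x. ennreal (bias_const k) * ((\<integral>\<^sup>+y. ?A1 x y \<partial>lborel) + (\<integral>\<^sup>+y. ?A2 x y \<partial>lborel) + (\<integral>\<^sup>+y. ?A3 x y \<partial>lborel)) \<partial>lborel)"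
    by (intro nn_integral_cong) (simp add: nn_integral_cmult nn_integral_add)
  also have "\<dots> = ennreal (bias_const k) * ((\<integral>\<^sup>+x. \<integral>\<^sup>+y. ?A1 x y \<partial>lborel \<partial>lborel) + (\<integral>\<^sup>+x. \<integral>\<^sup>+y. ?A2 x y \<partial>lborel \<partial>lborel)
      + (\<integral>\<^sup>+x. \<integral>\<^sup>+y. ?A3 x y \<partial>lborel \<partial>lborel))"
  proof -
    have m: "(\<lambda>x. \<integral>\<^sup>+y. A (x, y) \<partial>lborel) \<in> borel_measurable lborel"
      if "A \<in> borel_measurable (lborel \<Otimes>\<^sub>M lborel)" for A :: "'a \<times> 'a \<Rightarrow> ennreal"
      using lborel.borel_measurable_nn_integral_fst[OF that] .
    have "(\<lambda>x. \<integral>\<^sup>+y. ?A1 x y \<partial>lborel) \<in> borel_measurable lborel"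
      using m[of "\<lambda>z. ?A1 (fst z) (snd z)"] by simp
    have "(\<lambda>x. \<integral>\<^sup>+y. ?A2 x y \<partial>lborel) \<in> borel_measurable lborel"
      using m[of "\<lambda>z. ?A2 (fst z) (snd z)"] by simp
    have "(\<lambda>x. \<integral>\<^sup>+y. ?A3 x y \<partial>lborel) \<in> borel_measurable lborel"
      using m[of "\<lambda>z. ?A3 (fst z) (snd z)"] by simp
    show ?thesis by (rule nn_integral_cmult_add3) fact+
  qed
  also have "\<dots> \<le> ennreal (bias_const k) * (ennreal (L * (real n * ?V) powr (- s / real DIM('a))) * wmoment \<phi> k (s / real DIM('a))
      + emeasure lborel S * ennreal (1 / real n) * wmoment \<phi> k 0
      + ennreal (L * (real n * ?V) powr (- s / real DIM('a))) * wmoment \<phi> k (s / real DIM('a)))"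
  proof (intro mult_left_mono add_mono)
    have R: "(\<integral>\<^sup>+h. H (vol n 0 h) * ennreal (real n * (L * norm (h::'a) powr s)) \<partial>lborel)
      = ennreal (L * (real n * ?V) powr (- s / real DIM('a))) * wmoment \<phi> k (s / real DIM('a))"
    proof -
      let ?d = "real DIM('a)"
      let ?c = "L * (real n * ?V) powr (- s / ?d)"
      have "H (vol n 0 h) * ennreal (real n * (L * norm h powr s)) = H (vol n 0 h) * ennreal (real n * (?c * vol n 0 h powr (s / ?d)))" for h :: 'a
      proof (cases "h = 0")
        case True
        then show ?thesis by (simp add: vol_self H_def)
      next
        case False
        have "vol n 0 h powr (s / ?d) = (real n * ?V) powr (s / ?d) * (norm h ^ DIM('a)) powr (s / ?d)"
          unfolding vol_def by (simp add: powr_mult mult.assoc)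
        also have "(norm h ^ DIM('a)) powr (s / ?d) = norm h powr s"
          using False by (simp add: powr_realpow[symmetric] powr_powr)
        finally have "(real n * ?V) powr (- s / ?d) * vol n 0 h powr (s / ?d)
           = ((real n * ?V) powr (- s / ?d) * (real n * ?V) powr (s / ?d)) * norm h powr s" by simp
        also have "(real n * ?V) powr (- s / ?d) * (real n * ?V) powr (s / ?d) = 1"
        proof -
          have "real n * ?V \<noteq> 0" using n less_imp_neq[OF unit_ball_vol_DIM_pos] by simp
          then show ?thesis by (simp add: powr_add[symmetric])
        qed
        finally show ?thesis by (simp add: mult.assoc)
      qed
      then have "(\<integral>\<^sup>+h. H (vol n 0 h) * ennreal (real n * (L * norm (h::'a) powr s)) \<partial>lborel)
         = (\<integral>\<^sup>+h. H (vol n (0::'a) h) * ennreal (real n * (?c * vol n (0::'a) h powr (s / ?d))) \<partial>lborel)" by simp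
      also have "\<dots> = ennreal (1 / real n) * (\<integral>\<^sup>+u. H u * ennreal (real n * (?c * u powr (s / ?d))) * indicator {0<..} u \<partial>lborel)"
        by (rule nn_integral_vol[OF n(2)]) measurable
      also have "\<dots> = ennreal (1 / real n) * (\<integral>\<^sup>+u. ennreal (real n * ?c) * (ennreal (\<bar>\<phi> u\<bar> * (u powr (s / ?d) * (u ^ (k - 1) * exp (- (lo / 2 * u))))) * indicator {0<..} u) \<partial>lborel)"
      proof (intro arg_cong[where f = "(*) _"] nn_integral_cong)
        fix u :: real
        show "H u * ennreal (real n * (?c * u powr (s / ?d))) * indicator {0<..} u = ennreal (real n * ?c) * (ennreal (\<bar>\<phi> u\<bar> * (u powr (s / ?d) * (u ^ (k - 1) * exp (- (lo / 2 * u))))) * indicator {0<..} u)"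
        proof (cases "0 < u")
          case True
          then have "H u * ennreal (real n * (?c * u powr (s / ?d))) = ennreal ((\<bar>\<phi> u\<bar> * (u ^ (k - 1) * exp (- (lo / 2 * u)))) * (real n * (?c * u powr (s / ?d))))"
            using L by (simp add: H_def ennreal_mult)
          also have "\<dots> = ennreal ((real n * ?c) * (\<bar>\<phi> u\<bar> * (u powr (s / ?d) * (u ^ (k - 1) * exp (- (lo / 2 * u))))))"
            by (intro arg_cong[where f = ennreal]) (simp add: mult_ac)
          also have "\<dots> = ennreal (real n * ?c) * ennreal (\<bar>\<phi> u\<bar> * (u powr (s / ?d) * (u ^ (k - 1) * exp (- (lo / 2 * u)))))"
            using True L by (intro ennreal_mult) auto
          finally show ?thesis using True by simp
        qed simp
      qed
      also have "\<dots> = ennreal (1 / real n) * (ennreal (real n * ?c) * wmoment \<phi> k (s / ?d))"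
        unfolding wmoment_def by (subst nn_integral_cmult) auto
      also have "\<dots> = ennreal (1 / real n * (real n * ?c)) * wmoment \<phi> k (s / ?d)"
        using n L by (subst ennreal_mult) (auto simp: mult.assoc)
      also have "1 / real n * (real n * ?c) = ?c" using n by simp
      finally show ?thesis .
    qed
    have "(\<integral>\<^sup>+x. \<integral>\<^sup>+y. ?A1 x y \<partial>lborel \<partial>lborel) = (\<integral>\<^sup>+h. \<integral>\<^sup>+x. ?A1 x (x + h) \<partial>lborel \<partial>lborel)"
      by (rule nn_integral_shift_pair) measurable
    also have "\<dots> \<le> (\<integral>\<^sup>+h. H (vol n 0 h) * ennreal (real n * (L * norm (h::'a) powr s)) \<partial>lborel)"
    proof (intro nn_integral_mono)
      fix h :: 'a
      have "(\<integral>\<^sup>+x. ?A1 x (x + h) \<partial>lborel) = (\<integral>\<^sup>+x. (H (vol n 0 h) * ennreal (real n)) * ennreal \<bar>q (x + h) - q x\<bar> \<partial>lborel)"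
        by (intro nn_integral_cong) (simp add: vol_shift ennreal_mult mult.assoc)
      also have "\<dots> = (H (vol n 0 h) * ennreal (real n)) * (\<integral>\<^sup>+x. ennreal \<bar>q (x + h) - q x\<bar> \<partial>lborel)"
        by (intro nn_integral_cmult) measurable
      also have "\<dots> \<le> (H (vol n 0 h) * ennreal (real n)) * ennreal (L * norm h powr s)"
        by (intro mult_left_mono L1) auto
      also have "\<dots> = H (vol n 0 h) * ennreal (real n * (L * norm h powr s))"
        using L by (subst ennreal_mult) (auto simp: mult.assoc)
      finally show "(\<integral>\<^sup>+x. ?A1 x (x + h) \<partial>lborel) \<le> H (vol n 0 h) * ennreal (real n * (L * norm h powr s))" .
    qed
    finally show "(\<integral>\<^sup>+x. \<integral>\<^sup>+y. ?A1 x y \<partial>lborel \<partial>lborel) \<le> ennreal (L * (real n * ?V) powr (- s / real DIM('a))) * wmoment \<phi> k (s / real DIM('a))"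
      unfolding R .
    have "(\<integral>\<^sup>+x. \<integral>\<^sup>+y. ?A3 x y \<partial>lborel \<partial>lborel) = (\<integral>\<^sup>+h. \<integral>\<^sup>+x. ?A3 x (x + h) \<partial>lborel \<partial>lborel)"
      by (rule nn_integral_shift_pair) measurable
    also have "\<dots> \<le> (\<integral>\<^sup>+h. H (vol n 0 h) * ennreal (real n * (L * norm (h::'a) powr s)) \<partial>lborel)"
    proof (intro nn_integral_mono)
      fix h :: 'a
      show "(\<integral>\<^sup>+x. ?A3 x (x + h) \<partial>lborel) \<le> H (vol n 0 h) * ennreal (real n * (L * norm h powr s))"
      proof (cases "h = 0")
        case True
        then show ?thesis by (simp add: vol_self H_def)
      next
        case False
        let ?b = "?V * norm h ^ DIM('a)"
        have b: "0 < ?b" using False by simp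
        have "(\<integral>\<^sup>+x. ?A3 x (x + h) \<partial>lborel) = (\<integral>\<^sup>+x. (H (vol n 0 h) * ennreal (real n)) * ennreal \<bar>mean_density x (norm h) - q x\<bar> \<partial>lborel)"
          by (intro nn_integral_cong) (simp add: vol_shift ennreal_mult mult.assoc dist_norm)
        also have "\<dots> = (H (vol n 0 h) * ennreal (real n)) * (\<integral>\<^sup>+x. ennreal \<bar>mean_density x (norm h) - q x\<bar> \<partial>lborel)"
          by (intro nn_integral_cmult) measurable
        also have "(\<integral>\<^sup>+x. ennreal \<bar>mean_density x (norm h) - q x\<bar> \<partial>lborel) = (\<integral>\<^sup>+x. ennreal (1 / ?b) * ennreal \<bar>ball_mass x (norm h) - ?b * q x\<bar> \<partial>lborel)"
        proof (intro nn_integral_cong)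
          fix x
          have "mean_density x (norm h) - q x = (1 / ?b) * (ball_mass x (norm h) - ?b * q x)"
          proof -
            have "m / \<beta> - c = 1 / \<beta> * (m - \<beta> * c)" if "0 < \<beta>" for m \<beta> c :: real
              using that by (simp add: field_simps)
            from this[OF b] show ?thesis unfolding mean_density_def .
          qed
          then have "\<bar>mean_density x (norm h) - q x\<bar> = (1 / ?b) * \<bar>ball_mass x (norm h) - ?b * q x\<bar>"
            by (simp only: abs_mult abs_of_pos[OF divide_pos_pos[OF zero_less_one b]])
          then show "ennreal \<bar>mean_density x (norm h) - q x\<bar> = ennreal (1 / ?b) * ennreal \<bar>ball_mass x (norm h) - ?b * q x\<bar>"
            by (simp only: ennreal_mult'[OF less_imp_le[OF divide_pos_pos[OF zero_less_one b]]])
        qed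
        also have "\<dots> = ennreal (1 / ?b) * (\<integral>\<^sup>+x. ennreal \<bar>ball_mass x (norm h) - ?b * q x\<bar> \<partial>lborel)"
        proof (intro nn_integral_cmult)
          have [measurable]: "(\<lambda>x. ball_mass x (norm h)) \<in> borel_measurable borel"
            using measurable_compose[OF _ ball_mass_meas, of "\<lambda>x. (x, x + h)" borel] by (simp add: dist_norm)
          show "(\<lambda>x. ennreal \<bar>ball_mass x (norm h) - ?b * q x\<bar>) \<in> borel_measurable lborel" by measurable
        qed
        also have "\<dots> \<le> ennreal (1 / ?b) * ennreal (L * norm h powr s * ?b)"
          by (intro mult_left_mono ball_mass_center) auto
        also have "\<dots> = ennreal (L * norm h powr s)"
        proof -
          have "ennreal (1 / \<beta>) * ennreal (w * \<beta>) = ennreal w" if "0 < \<beta>" "0 \<le> w" for \<beta> w :: real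
            using that by (simp add: ennreal_mult[symmetric])
          then show ?thesis using b L by simp
        qed
        finally have "(\<integral>\<^sup>+x. ?A3 x (x + h) \<partial>lborel) \<le> (H (vol n 0 h) * ennreal (real n)) * ennreal (L * norm h powr s)"
          by (simp add: mult_left_mono)
        also have "\<dots> = H (vol n 0 h) * ennreal (real n * (L * norm h powr s))"
          using L by (subst ennreal_mult) (auto simp: mult.assoc)
        finally show ?thesis .
      qed
    qed
    finally show "(\<integral>\<^sup>+x. \<integral>\<^sup>+y. ?A3 x y \<partial>lborel \<partial>lborel) \<le> ennreal (L * (real n * ?V) powr (- s / real DIM('a))) * wmoment \<phi> k (s / real DIM('a))"
      unfolding R .
    have "(\<integral>\<^sup>+x. \<integral>\<^sup>+y. ?A2 x y \<partial>lborel \<partial>lborel) = (\<integral>\<^sup>+x. indicator S x * (ennreal (1 / real n) * wmoment \<phi> k 0) \<partial>lborel)"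
    proof (rule nn_integral_cong)
      fix x :: 'a
      have "(\<integral>\<^sup>+y. H (vol n x y) \<partial>lborel) = ennreal (1 / real n) * (\<integral>\<^sup>+u. H u * indicator {0<..} u \<partial>lborel)"
        by (rule nn_integral_vol[OF n(2)]) measurable
      also have "(\<integral>\<^sup>+u. H u * indicator {0<..} u \<partial>lborel) = wmoment \<phi> k 0"
        unfolding wmoment_def H_def by (intro nn_integral_cong) (auto simp: indicator_def)
      finally have "(\<integral>\<^sup>+y. H (vol n x y) \<partial>lborel) = ennreal (1 / real n) * wmoment \<phi> k 0" .
      note H_int = this
      show "(\<integral>\<^sup>+y. ?A2 x y \<partial>lborel) = indicator S x * (ennreal (1 / real n) * wmoment \<phi> k 0)"
      proof -
        have "(\<integral>\<^sup>+y. ?A2 x y \<partial>lborel) = (\<integral>\<^sup>+y. H (vol n x y) \<partial>lborel) * indicator S x"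
          by (rule nn_integral_multc) measurable
        also have "(\<integral>\<^sup>+y. H (vol n x y) \<partial>lborel) = ennreal (1 / real n) * wmoment \<phi> k 0" by (rule H_int)
        finally show ?thesis by (simp only: mult.commute)
      qed
    qed
    also have "\<dots> = emeasure lborel S * (ennreal (1 / real n) * wmoment \<phi> k 0)"
      by (subst nn_integral_multc) auto
    finally show "(\<integral>\<^sup>+x. \<integral>\<^sup>+y. ?A2 x y \<partial>lborel \<partial>lborel) \<le> emeasure lborel S * ennreal (1 / real n) * wmoment \<phi> k 0"
      by (simp add: mult.assoc)
  qed simp
  also have "\<dots> = ennreal (bias_const k) *
       (ennreal (2 * L * (real n * ?V) powr (- s / real DIM('a))) * wmoment \<phi> k (s / real DIM('a))
        + emeasure lborel S * ennreal (1 / real n) * wmoment \<phi> k 0)"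
  proof -
    have two: "a + b + a = 2 * a + b" for a b :: ennreal
      by (simp add: mult_2 add_ac)
    have "ennreal (2 * L * (real n * ?V) powr (- s / real DIM('a))) = 2 * ennreal (L * (real n * ?V) powr (- s / real DIM('a)))"
      using L ennreal_mult[of 2 "L * (real n * ?V) powr (- s / real DIM('a))"] by (simp add: mult.assoc)
    then show ?thesis by (simp only: two mult.assoc)
  qed
  finally show ?thesis .
qed

text \<open>
The change of variables turns the integral into the Laplace transform at \<open>q x\<close> that
characterises the estimator function.
\<close>
lemma integral_poisson_density:
  assumes k: "1 \<le> k" "1 \<le> n" and \<phi> [measurable]: "\<phi> \<in> borel_measurable borel"
    and est: "is_estimator_function f k \<phi>"
  shows "(\<integral>y. poisson_density k n x y * \<phi> (vol n x y) \<partial>lborel) = f (q x) * q x"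
proof (cases "q x = 0")
  case True
  then show ?thesis by (simp add: poisson_density_def)
next
  case False
  then have qx: "0 < q x" using q0[of x] by simp
  have n: "0 < real n" using k by simp
  have "(\<integral>y. poisson_density k n x y * \<phi> (vol n x y) \<partial>lborel)
    = (LINT u:{0<..}|lborel. q x * q x * pois_weight k n (q x * u) * \<phi> u) / real n"
    unfolding poisson_density_def by (rule integral_vol[OF k(2)]) measurable
  also have "(LINT u:{0<..}|lborel. q x * q x * pois_weight k n (q x * u) * \<phi> u)
    = (LINT u:{0<..}|lborel. (real n * q x * q x * q x ^ (k - 1) / fact (k - 1)) * (u ^ (k - 1) * \<phi> u * exp (- q x * u)))"
    by (intro set_lebesgue_integral_cong) (auto simp: pois_weight_def power_mult_distrib)
  also have "\<dots> = (real n * q x * q x * q x ^ (k - 1) / fact (k - 1)) * (LINT u:{0<..}|lborel. u ^ (k - 1) * \<phi> u * exp (- q x * u))"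
    by (rule set_integral_mult_right)
  also have "(LINT u:{0<..}|lborel. u ^ (k - 1) * \<phi> u * exp (- q x * u)) = Gamma (real k) * f (q x) / q x ^ k"
    using est qx by (simp add: is_estimator_function_def)
  also have "Gamma (real k) = fact (k - 1)"
    using Gamma_fact[of "k - 1", where 'a = real] k by (simp add: of_nat_diff)
  also have "(real n * q x * q x * q x ^ (k - 1) / fact (k - 1)) * (fact (k - 1) * f (q x) / q x ^ k) / real n = f (q x) * q x"
  proof -
    have "q x ^ k = q x * q x ^ (k - 1)" using k by (simp add: power_eq_if)
    moreover have "q x ^ (k - 1) \<noteq> 0" using qx by simp
    ultimately show ?thesis using qx n by (simp add: field_simps)
  qed
  finally show ?thesis .
qed

lemma borel_measurable_knn_volume:
  assumes J: "finite J" "1 \<le> k" "k \<le> card J" and I: "insert i J \<subseteq> I"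
  shows "(\<lambda>z. real n * (unit_ball_vol (real DIM('a)) * kth_smallest k (\<lambda>j. dist (z i) (z j)) J ^ DIM('a)))
    \<in> borel_measurable (PiM I (\<lambda>_. \<mu>))"
proof -
  have c: "(\<lambda>z. z j) \<in> borel_measurable (PiM I (\<lambda>_. \<mu>))" if "j \<in> I" for j
  proof -
    have "(\<lambda>z. z j) \<in> measurable (PiM I (\<lambda>_. \<mu>)) \<mu>" using that by (rule measurable_component_singleton)
    then show ?thesis by (simp add: measurable_cong_sets[OF refl sets_mu])
  qed
  have "(\<lambda>z. kth_smallest k (\<lambda>j. dist (z i) (z j)) J) \<in> borel_measurable (PiM I (\<lambda>_. \<mu>))"
    using I by (intro borel_measurable_kth_smallest J borel_measurable_dist c) auto
  then show ?thesis by measurable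
qed

lemma wmoment_bounds_moment:
  "(\<integral>\<^sup>+u. ennreal (u ^ (k - 1) * exp (- (lo * u))) * ennreal \<bar>\<phi> u\<bar> * indicator {0<..} u \<partial>lborel) \<le> wmoment \<phi> k 0"
  unfolding wmoment_def
proof (intro nn_integral_mono)
  fix u :: real
  show "ennreal (u ^ (k - 1) * exp (- (lo * u))) * ennreal \<bar>\<phi> u\<bar> * indicator {0<..} u
    \<le> ennreal (\<bar>\<phi> u\<bar> * (u powr 0 * (u ^ (k - 1) * exp (- (lo / 2 * u))))) * indicator {0<..} u"
  proof (cases "0 < u")
    case True
    have "u ^ (k - 1) * exp (- (lo * u)) * \<bar>\<phi> u\<bar> \<le> \<bar>\<phi> u\<bar> * (u powr 0 * (u ^ (k - 1) * exp (- (lo / 2 * u))))"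
      using True lo by (simp add: mult.commute mult_left_mono)
    then show ?thesis using True by (simp add: ennreal_mult[symmetric] ennreal_leI)
  qed simp
qed

lemma knn_moment:
  assumes k: "1 \<le> k" and J: "finite J" "k \<le> card J" "i \<notin> J"
    and \<phi> [measurable]: "\<phi> \<in> borel_measurable borel"
  shows "(\<integral>\<^sup>+z. ennreal \<bar>\<phi> (real (card J) * (unit_ball_vol (real DIM('a)) * kth_smallest k (\<lambda>j. dist (z i) (z j)) J ^ DIM('a)))\<bar>
      \<partial>PiM (insert i J) (\<lambda>_. \<mu>)) \<le> ennreal (Mx * (exp (real k) * Mx ^ (k - 1))) * wmoment \<phi> k 0"
proof -
  have "(\<integral>\<^sup>+z. ennreal \<bar>\<phi> (real (card J) * (unit_ball_vol (real DIM('a)) * kth_smallest k (\<lambda>j. dist (z i) (z j)) J ^ DIM('a)))\<bar>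
      \<partial>PiM (insert i J) (\<lambda>_. \<mu>))
    = (\<integral>\<^sup>+x. \<integral>\<^sup>+y. ennreal (pair_density k (card J) x y) * ennreal \<bar>\<phi> (vol (card J) x y)\<bar> \<partial>lborel \<partial>lborel)"
    by (rule nn_integral_knn_volume[OF J(1) k J(2,3)]) measurable
  also have "\<dots> \<le> ennreal (Mx * (exp (real k) * Mx ^ (k - 1))) *
       (\<integral>\<^sup>+u. ennreal (u ^ (k - 1) * exp (- (lo * u))) * ennreal \<bar>\<phi> u\<bar> * indicator {0<..} u \<partial>lborel)"
    by (rule moment_bound[OF k J(2)]) measurable
  also have "\<dots> \<le> ennreal (Mx * (exp (real k) * Mx ^ (k - 1))) * wmoment \<phi> k 0"
    by (intro mult_left_mono wmoment_bounds_moment) auto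
  finally show ?thesis .
qed

text \<open>
The mean and \<open>density_functional f q\<close> are integrals of the same function of \<open>u\<close> against \<open>pair_density\<close> and
\<open>poisson_density\<close>. Integrability passes from the first to the second through the difference.
\<close>
lemma knn_bias:
  fixes f :: "real \<Rightarrow> real"
  assumes k: "1 \<le> k" and J: "finite J" "k \<le> card J" "i \<notin> J"
    and \<phi> [measurable]: "\<phi> \<in> borel_measurable borel"
    and est: "is_estimator_function f k \<phi>"
    and fin: "wmoment \<phi> k 0 < \<infinity>" "wmoment \<phi> k (s / real DIM('a)) < \<infinity>"
  defines "n \<equiv> card J"
  defines "Z \<equiv> \<lambda>z. \<phi> (real n * (unit_ball_vol (real DIM('a)) * kth_smallest k (\<lambda>j. dist (z i) (z j)) J ^ DIM('a)))"
  shows "integrable (PiM (insert i J) (\<lambda>_. \<mu>)) Z"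
    and "ennreal \<bar>(\<integral>z. Z z \<partial>PiM (insert i J) (\<lambda>_. \<mu>)) - density_functional f q\<bar>
      \<le> ennreal (bias_const k) *
       (ennreal (2 * L * (real n * unit_ball_vol (real DIM('a))) powr (- s / real DIM('a))) * wmoment \<phi> k (s / real DIM('a))
        + emeasure lborel S * ennreal (1 / real n) * wmoment \<phi> k 0)" (is "_ \<le> ?bound")
proof -
  have kn: "1 \<le> k" "k \<le> n" "1 \<le> n" using k J by (auto simp: n_def)
  let ?P = "PiM (insert i J) (\<lambda>_. \<mu>)"
  let ?P2 = "lborel \<Otimes>\<^sub>M lborel :: ('a \<times> 'a) measure"
  let ?F1 = "\<lambda>z::'a\<times>'a. pair_density k n (fst z) (snd z) * \<phi> (vol n (fst z) (snd z))"
  let ?F2 = "\<lambda>z::'a\<times>'a. poisson_density k n (fst z) (snd z) * \<phi> (vol n (fst z) (snd z))"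
  have m1 [measurable]: "?F1 \<in> borel_measurable ?P2" by measurable
  have m2 [measurable]: "?F2 \<in> borel_measurable ?P2" by measurable
  have mZ: "Z \<in> borel_measurable ?P"
    unfolding Z_def using J k
    by (intro measurable_compose[OF borel_measurable_knn_volume \<phi>]) auto
  have pair: "(\<integral>\<^sup>+z. g z \<partial>?P2) = (\<integral>\<^sup>+x. \<integral>\<^sup>+y. g (x, y) \<partial>lborel \<partial>lborel)" if "g \<in> borel_measurable ?P2" for g :: "'a \<times> 'a \<Rightarrow> ennreal"
    using lborel.nn_integral_fst[OF that] by simp
  have "(\<integral>\<^sup>+z. ennreal (norm (?F1 z)) \<partial>?P2)
     = (\<integral>\<^sup>+x. \<integral>\<^sup>+y. ennreal (pair_density k n x y) * ennreal \<bar>\<phi> (vol n x y)\<bar> \<partial>lborel \<partial>lborel)"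
    by (subst pair) (auto simp: abs_mult pair_density_nonneg ennreal_mult)
  also have "\<dots> \<le> ennreal (Mx * (exp (real k) * Mx ^ (k - 1))) *
       (\<integral>\<^sup>+u. ennreal (u ^ (k - 1) * exp (- (lo * u))) * ennreal \<bar>\<phi> u\<bar> * indicator {0<..} u \<partial>lborel)"
    by (rule moment_bound[OF kn(1,2)]) measurable
  also have "\<dots> \<le> ennreal (Mx * (exp (real k) * Mx ^ (k - 1))) * wmoment \<phi> k 0"
    by (intro mult_left_mono wmoment_bounds_moment) auto
  also have "\<dots> < \<infinity>" using fin(1) by (simp add: ennreal_mult_less_top)
  finally have i1: "integrable ?P2 ?F1" by (intro integrableI_bounded m1)
  have D: "(\<integral>\<^sup>+z. ennreal (norm (?F1 z - ?F2 z)) \<partial>?P2) \<le> ?bound"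
    using bias_integral_bound[OF kn(1,2) \<phi>] by (subst pair) auto
  also have "?bound < \<infinity>" using fin Sfin
    by (simp add: ennreal_mult_less_top ennreal_add_less_top)
  finally have i12: "integrable ?P2 (\<lambda>z. ?F1 z - ?F2 z)" by (intro integrableI_bounded) auto
  have i2: "integrable ?P2 ?F2"
    using Bochner_Integration.integrable_diff[OF i1 i12] by simp
  \<comment> \<open>Applied to \<open>\<phi>\<close> and \<open>- \<phi>\<close>, this transfers the signed integral without a statement about
      image measures.\<close>
  have eqs: "(\<integral>\<^sup>+z. ennreal (\<psi> (real n * (unit_ball_vol (real DIM('a)) * kth_smallest k (\<lambda>j. dist (z i) (z j)) J ^ DIM('a)))) \<partial>?P)
     = (\<integral>\<^sup>+z. ennreal (pair_density k n (fst z) (snd z) * \<psi> (vol n (fst z) (snd z))) \<partial>?P2)"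
    if [measurable]: "\<psi> \<in> borel_measurable borel" for \<psi> :: "real \<Rightarrow> real"
  proof -
    have "(\<integral>\<^sup>+z. ennreal (\<psi> (real n * (unit_ball_vol (real DIM('a)) * kth_smallest k (\<lambda>j. dist (z i) (z j)) J ^ DIM('a)))) \<partial>?P)
      = (\<integral>\<^sup>+x. \<integral>\<^sup>+y. ennreal (pair_density k n x y) * ennreal (\<psi> (vol n x y)) \<partial>lborel \<partial>lborel)"
      unfolding n_def by (rule nn_integral_knn_volume[OF J(1) k J(2,3)]) measurable
    also have "\<dots> = (\<integral>\<^sup>+z. ennreal (pair_density k n (fst z) (snd z) * \<psi> (vol n (fst z) (snd z))) \<partial>?P2)"
      by (subst pair) (auto simp: pair_density_nonneg ennreal_mult')
    finally show ?thesis .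
  qed
  have e1: "(\<integral>\<^sup>+z. ennreal (Z z) \<partial>?P) = (\<integral>\<^sup>+z. ennreal (?F1 z) \<partial>?P2)"
    unfolding Z_def by (rule eqs) measurable
  have e2: "(\<integral>\<^sup>+z. ennreal (- Z z) \<partial>?P) = (\<integral>\<^sup>+z. ennreal (- ?F1 z) \<partial>?P2)"
    using eqs[of "\<lambda>u. - \<phi> u"] unfolding Z_def by simp
  note Z = integral_eq_via_nn[OF mZ i1 e1 e2]
  show "integrable ?P Z" by (rule Z(1))
  have "(\<integral>z. ?F2 z \<partial>?P2) = (\<integral>x. \<integral>y. poisson_density k n x y * \<phi> (vol n x y) \<partial>lborel \<partial>lborel)"
    using lborel_pair.integral_fst'[OF i2] by simp
  also have "\<dots> = density_functional f q"
    unfolding density_functional_def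
    by (intro Bochner_Integration.integral_cong refl integral_poisson_density kn \<phi> est)
  finally have T: "density_functional f q = (\<integral>z. ?F2 z \<partial>?P2)" ..
  have "(\<integral>z. Z z \<partial>?P) - density_functional f q = (\<integral>z. ?F1 z - ?F2 z \<partial>?P2)"
    unfolding Z(2) T by (rule Bochner_Integration.integral_diff[OF i1 i2, symmetric])
  then have "ennreal \<bar>(\<integral>z. Z z \<partial>?P) - density_functional f q\<bar> \<le> (\<integral>\<^sup>+z. ennreal (norm (?F1 z - ?F2 z)) \<partial>?P2)"
    using integral_norm_bound_ennreal[OF i12] unfolding real_norm_def by metis
  then show "ennreal \<bar>(\<integral>z. Z z \<partial>?P) - density_functional f q\<bar> \<le> ?bound"
    using D by (rule order_trans)
qed

end

section \<open>An Efron-Stein inequality\<close>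

lemma integrable_mult_L2:
  fixes u v :: "'x \<Rightarrow> real"
  assumes [measurable]: "u \<in> borel_measurable M" "v \<in> borel_measurable M"
    and "integrable M (\<lambda>x. (u x)\<^sup>2)" "integrable M (\<lambda>x. (v x)\<^sup>2)"
  shows "integrable M (\<lambda>x. u x * v x)"
proof (rule Bochner_Integration.integrable_bound)
  show "integrable M (\<lambda>x. (u x)\<^sup>2 + (v x)\<^sup>2)" using assms by simp
  have "\<bar>a * b\<bar> \<le> a\<^sup>2 + b\<^sup>2" for a b :: real
  proof -
    have "0 \<le> (\<bar>a\<bar> - \<bar>b\<bar>)\<^sup>2" "0 \<le> \<bar>a\<bar> * \<bar>b\<bar>" by auto
    then show ?thesis unfolding power2_diff abs_mult power2_abs mult.assoc by linarith
  qed
  then show "AE x in M. norm (u x * v x) \<le> norm ((u x)\<^sup>2 + (v x)\<^sup>2)" by simp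
qed simp

lemma integrable_diff_L2:
  fixes u v :: "'x \<Rightarrow> real"
  assumes [measurable]: "u \<in> borel_measurable M" "v \<in> borel_measurable M"
    and "integrable M (\<lambda>x. (u x)\<^sup>2)" "integrable M (\<lambda>x. (v x)\<^sup>2)"
  shows "integrable M (\<lambda>x. (u x - v x)\<^sup>2)"
proof -
  have "(\<lambda>x. (u x - v x)\<^sup>2) = (\<lambda>x. (u x)\<^sup>2 + (v x)\<^sup>2 - 2 * (u x * v x))"
    by (simp add: power2_diff mult.assoc)
  then show ?thesis using assms integrable_mult_L2[of u M v] by simp
qed

text \<open>
The constant \<open>2\<close> is not optimal, but this form has a short proof. Replace the coordinates of an independent
copy one after the other, as in \<open>Var f = E (f X * (f X - f X'))\<close>. Each increment is antisymmetric
under the exchange of the two versions of the replaced coordinate, so \<open>f X\<close> in front of it may be replaced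
by half of the difference of \<open>f\<close> at two points that differ in this coordinate only. The functions \<open>g i\<close>
cancel in these differences.
\<close>
lemma efron_stein:
  fixes \<mu> :: "'a measure" and f :: "('i \<Rightarrow> 'a) \<Rightarrow> real"
  assumes \<mu>: "prob_space \<mu>" and I: "finite I"
    and f [measurable]: "f \<in> borel_measurable (PiM I (\<lambda>_. \<mu>))" and f2: "integrable (PiM I (\<lambda>_. \<mu>)) (\<lambda>x. (f x)\<^sup>2)"
    and g [measurable]: "\<And>i. i \<in> I \<Longrightarrow> g i \<in> borel_measurable (PiM I (\<lambda>_. \<mu>))"
    and fg2: "\<And>i. i \<in> I \<Longrightarrow> integrable (PiM I (\<lambda>_. \<mu>)) (\<lambda>x. (f x - g i x)\<^sup>2)"
    and loc: "\<And>i x y. i \<in> I \<Longrightarrow> (\<And>j. j \<in> I - {i} \<Longrightarrow> x j = y j) \<Longrightarrow> g i x = g i y"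
  shows "(\<integral>x. (f x)\<^sup>2 \<partial>PiM I (\<lambda>_. \<mu>)) - (\<integral>x. f x \<partial>PiM I (\<lambda>_. \<mu>))\<^sup>2
    \<le> 2 * (\<Sum>i\<in>I. \<integral>x. (f x - g i x)\<^sup>2 \<partial>PiM I (\<lambda>_. \<mu>))"
proof -
  interpret \<mu>: prob_space \<mu> by fact
  interpret product_sigma_finite "\<lambda>_. \<mu>" by unfold_locales
  let ?P = "PiM I (\<lambda>_. \<mu>)"
  interpret P: prob_space ?P by (intro prob_space_PiM \<mu>)
  let ?K = "Inl ` I \<union> Inr ` I :: ('i + 'i) set"
  let ?PK = "PiM ?K (\<lambda>_. \<mu>)"
  define \<sigma> where "\<sigma> = (\<lambda>A i. if i \<in> A then Inr i else Inl i :: 'i + 'i)"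
  \<comment> \<open>The second component holds the independent copy; in \<open>X A\<close> the coordinates in \<open>A\<close> are replaced.\<close>
  define X where "X = (\<lambda>A (\<omega> :: 'i + 'i \<Rightarrow> 'a). \<lambda>i\<in>I. \<omega> (\<sigma> A i))"
  have X_law: "distr ?PK ?P (X A) = ?P" for A
    unfolding X_def
    by (rule distr_PiM_reindex) (auto simp: \<sigma>_def inj_on_def \<mu> split: if_splits)
  have X_meas [measurable]: "X A \<in> measurable ?PK ?P" for A
    unfolding X_def by (intro measurable_restrict measurable_component_singleton) (auto simp: \<sigma>_def)
  have int_X: "(\<integral>\<omega>. H (X A \<omega>) \<partial>?PK) = (\<integral>x. H x \<partial>?P)" if "H \<in> borel_measurable ?P" for H :: "_ \<Rightarrow> real" and A
    using integral_distr[OF X_meas that, of A] X_law by simp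
  have itg_X: "integrable ?PK (\<lambda>\<omega>. H (X A \<omega>))" if "integrable ?P H" for H :: "_ \<Rightarrow> real" and A
    using integrable_distr_eq[OF X_meas, of H A] that X_law by (simp add: borel_measurable_integrable)
  let ?e = "\<lambda>i. \<integral>x. (f x - g i x)\<^sup>2 \<partial>?P"
  have f1: "integrable ?P f" by (rule P.square_integrable_imp_integrable[OF f f2])
  have fX2: "integrable ?PK (\<lambda>\<omega>. (f (X A \<omega>))\<^sup>2)" for A using itg_X[OF f2] .
  have prod_int: "integrable ?PK (\<lambda>\<omega>. f (X A \<omega>) * f (X B \<omega>))" for A B
    by (intro integrable_mult_L2 fX2) measurable
  have step: "(\<integral>\<omega>. f (X {} \<omega>) * (f (X A \<omega>) - f (X (insert i A) \<omega>)) \<partial>?PK) \<le> 2 * ?e i"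
    if A: "A \<subseteq> I" and i: "i \<in> I" "i \<notin> A" for A i
  proof -
    let ?\<pi> = "\<lambda>n :: 'i + 'i. if n = Inl i then Inr i else if n = Inr i then Inl i else n"
    let ?s = "\<lambda>\<omega> :: 'i + 'i \<Rightarrow> 'a. \<lambda>n\<in>?K. \<omega> (?\<pi> n)"
    have s_law: "distr ?PK ?PK ?s = ?PK"
      using i by (intro distr_PiM_reindex) (auto simp: inj_on_def \<mu> split: if_splits)
    have s_meas: "?s \<in> measurable ?PK ?PK"
      using i by (intro measurable_restrict measurable_component_singleton) auto
    have Xs: "X B (?s \<omega>) = X (if i \<in> B then B - {i} else insert i B) \<omega>" for B \<omega>
      using i unfolding X_def \<sigma>_def by (auto simp: fun_eq_iff)
    \<comment> \<open>Exchanging the two versions of coordinate \<open>i\<close> preserves the measure.\<close>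
    have swap: "(\<integral>\<omega>. f (X {} \<omega>) * (f (X A \<omega>) - f (X (insert i A) \<omega>)) \<partial>?PK)
       = (\<integral>\<omega>. f (X {i} \<omega>) * (f (X (insert i A) \<omega>) - f (X A \<omega>)) \<partial>?PK)"
    proof -
      have "(\<integral>\<omega>. f (X {} \<omega>) * (f (X A \<omega>) - f (X (insert i A) \<omega>)) \<partial>distr ?PK ?PK ?s)
        = (\<integral>\<omega>. f (X {} (?s \<omega>)) * (f (X A (?s \<omega>)) - f (X (insert i A) (?s \<omega>))) \<partial>?PK)"
        by (rule integral_distr[OF s_meas]) measurable
      then show ?thesis using i by (simp only: s_law Xs) simp
    qed
    have D: "integrable ?PK (\<lambda>\<omega>. (f (X B \<omega>) - f (X (insert i B) \<omega>))\<^sup>2)"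
      "(\<integral>\<omega>. (f (X B \<omega>) - f (X (insert i B) \<omega>))\<^sup>2 \<partial>?PK) \<le> 4 * ?e i" if "i \<notin> B" for B
    proof -
      show int: "integrable ?PK (\<lambda>\<omega>. (f (X B \<omega>) - f (X (insert i B) \<omega>))\<^sup>2)"
        by (intro integrable_diff_L2 fX2) measurable
      have gX: "g i (X B \<omega>) = g i (X (insert i B) \<omega>)" for \<omega>
        by (rule loc[OF i(1)]) (auto simp: X_def \<sigma>_def)
      have "(\<integral>\<omega>. (f (X B \<omega>) - f (X (insert i B) \<omega>))\<^sup>2 \<partial>?PK)
        \<le> (\<integral>\<omega>. 2 * (f (X B \<omega>) - g i (X B \<omega>))\<^sup>2 + 2 * (f (X (insert i B) \<omega>) - g i (X (insert i B) \<omega>))\<^sup>2 \<partial>?PK)"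
      proof (rule integral_mono[OF int])
        show "integrable ?PK (\<lambda>\<omega>. 2 * (f (X B \<omega>) - g i (X B \<omega>))\<^sup>2 + 2 * (f (X (insert i B) \<omega>) - g i (X (insert i B) \<omega>))\<^sup>2)"
          using itg_X[OF fg2[OF i(1)]] by (intro Bochner_Integration.integrable_add integrable_mult_right) auto
        fix \<omega>
        have "(a - b)\<^sup>2 \<le> 2 * a\<^sup>2 + 2 * b\<^sup>2" for a b :: real
        proof -
          have "0 \<le> (a + b)\<^sup>2" by simp
          then show ?thesis by (simp add: power2_diff power2_sum)
        qed
        from this[of "f (X B \<omega>) - g i (X B \<omega>)" "f (X (insert i B) \<omega>) - g i (X (insert i B) \<omega>)"]
        show "(f (X B \<omega>) - f (X (insert i B) \<omega>))\<^sup>2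
          \<le> 2 * (f (X B \<omega>) - g i (X B \<omega>))\<^sup>2 + 2 * (f (X (insert i B) \<omega>) - g i (X (insert i B) \<omega>))\<^sup>2"
          using gX[of \<omega>] by simp
      qed
      also have "\<dots> = 2 * (\<integral>\<omega>. (f (X B \<omega>) - g i (X B \<omega>))\<^sup>2 \<partial>?PK) + 2 * (\<integral>\<omega>. (f (X (insert i B) \<omega>) - g i (X (insert i B) \<omega>))\<^sup>2 \<partial>?PK)"
        using itg_X[OF fg2[OF i(1)]] by (subst Bochner_Integration.integral_add) auto
      also have "\<dots> = 4 * ?e i"
        using int_X[of "\<lambda>x. (f x - g i x)\<^sup>2"] i(1) by simp
      finally show "(\<integral>\<omega>. (f (X B \<omega>) - f (X (insert i B) \<omega>))\<^sup>2 \<partial>?PK) \<le> 4 * ?e i" .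
    qed
    let ?u = "\<lambda>\<omega>. f (X {} \<omega>) - f (X {i} \<omega>)" and ?v = "\<lambda>\<omega>. f (X A \<omega>) - f (X (insert i A) \<omega>)"
    let ?T = "\<integral>\<omega>. f (X {} \<omega>) * ?v \<omega> \<partial>?PK"
    have i1: "integrable ?PK (\<lambda>\<omega>. f (X B \<omega>) * (f (X C \<omega>) - f (X E \<omega>)))" for B C E
      using prod_int by (simp add: right_diff_distrib)
    have "2 * ?T = ?T + (\<integral>\<omega>. f (X {i} \<omega>) * (f (X (insert i A) \<omega>) - f (X A \<omega>)) \<partial>?PK)"
      using swap by simp
    also have "\<dots> = (\<integral>\<omega>. f (X {} \<omega>) * ?v \<omega> + f (X {i} \<omega>) * (f (X (insert i A) \<omega>) - f (X A \<omega>)) \<partial>?PK)"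
      by (rule Bochner_Integration.integral_add[symmetric]) (rule i1)+
    also have "\<dots> = (\<integral>\<omega>. ?u \<omega> * ?v \<omega> \<partial>?PK)"
      by (intro Bochner_Integration.integral_cong) (auto simp: algebra_simps)
    also have "\<dots> \<le> (\<integral>\<omega>. ((?u \<omega>)\<^sup>2 + (?v \<omega>)\<^sup>2) / 2 \<partial>?PK)"
    proof (rule integral_mono)
      show "integrable ?PK (\<lambda>\<omega>. ?u \<omega> * ?v \<omega>)"
        using D(1)[of "{}"] D(1)[OF i(2)] by (intro integrable_mult_L2) auto
      show "integrable ?PK (\<lambda>\<omega>. ((?u \<omega>)\<^sup>2 + (?v \<omega>)\<^sup>2) / 2)"
        using D(1)[of "{}"] D(1)[OF i(2)] by simp
      fix \<omega>
      have "a * b \<le> (a\<^sup>2 + b\<^sup>2) / 2" for a b :: real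
      proof -
        have "0 \<le> (a - b)\<^sup>2" by simp
        then show ?thesis unfolding power2_diff by simp
      qed
      then show "?u \<omega> * ?v \<omega> \<le> ((?u \<omega>)\<^sup>2 + (?v \<omega>)\<^sup>2) / 2" .
    qed
    also have "\<dots> = ((\<integral>\<omega>. (?u \<omega>)\<^sup>2 \<partial>?PK) + (\<integral>\<omega>. (?v \<omega>)\<^sup>2 \<partial>?PK)) / 2"
      using D(1)[of "{}"] D(1)[OF i(2)] by simp
    also have "\<dots> \<le> (4 * ?e i + 4 * ?e i) / 2"
      using D(2)[of "{}"] D(2)[OF i(2)] by (intro divide_right_mono add_mono) auto
    finally show ?thesis by simp
  qed
  have tele: "(\<integral>\<omega>. f (X {} \<omega>) * (f (X {} \<omega>) - f (X A \<omega>)) \<partial>?PK) \<le> 2 * (\<Sum>i\<in>A. ?e i)" if "A \<subseteq> I" for A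
    using finite_subset[OF that I] that
  proof (induction A rule: finite_induct)
    case (insert i A)
    have i1: "integrable ?PK (\<lambda>\<omega>. f (X B \<omega>) * (f (X C \<omega>) - f (X E \<omega>)))" for B C E
      using prod_int by (simp add: right_diff_distrib)
    have "(\<integral>\<omega>. f (X {} \<omega>) * (f (X {} \<omega>) - f (X (insert i A) \<omega>)) \<partial>?PK)
      = (\<integral>\<omega>. f (X {} \<omega>) * (f (X {} \<omega>) - f (X A \<omega>)) + f (X {} \<omega>) * (f (X A \<omega>) - f (X (insert i A) \<omega>)) \<partial>?PK)"
      by (intro Bochner_Integration.integral_cong) (auto simp: algebra_simps)
    also have "\<dots> = (\<integral>\<omega>. f (X {} \<omega>) * (f (X {} \<omega>) - f (X A \<omega>)) \<partial>?PK) + (\<integral>\<omega>. f (X {} \<omega>) * (f (X A \<omega>) - f (X (insert i A) \<omega>)) \<partial>?PK)"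
      by (rule Bochner_Integration.integral_add) (rule i1)+
    also have "\<dots> \<le> 2 * (\<Sum>i\<in>A. ?e i) + 2 * ?e i"
      using insert by (intro add_mono step) auto
    finally show ?case using insert by simp
  qed simp
  have indep: "(\<integral>\<omega>. f (X {} \<omega>) * f (X I \<omega>) \<partial>?PK) = (\<integral>x. f x \<partial>?P)\<^sup>2"
  proof -
    let ?PL = "PiM (Inl ` I) (\<lambda>_. \<mu>) :: ('i + 'i \<Rightarrow> 'a) measure" and ?PR = "PiM (Inr ` I) (\<lambda>_. \<mu>) :: ('i + 'i \<Rightarrow> 'a) measure"
    let ?L = "\<lambda>\<omega> :: 'i + 'i \<Rightarrow> 'a. \<lambda>i\<in>I. \<omega> (Inl i)" and ?R = "\<lambda>\<omega> :: 'i + 'i \<Rightarrow> 'a. \<lambda>i\<in>I. \<omega> (Inr i)"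
    have LX: "X {} \<omega> = ?L \<omega>" "X I \<omega> = ?R \<omega>" for \<omega> by (auto simp: X_def \<sigma>_def fun_eq_iff)
    have Ll: "distr ?PL ?P ?L = ?P" "?L \<in> measurable ?PL ?P"
      subgoal by (rule distr_PiM_reindex) (auto simp: \<mu>)
      subgoal by (intro measurable_restrict measurable_component_singleton) auto
      done
    have Rl: "distr ?PR ?P ?R = ?P" "?R \<in> measurable ?PR ?P"
      subgoal by (rule distr_PiM_reindex) (auto simp: \<mu>)
      subgoal by (intro measurable_restrict measurable_component_singleton) auto
      done
    have mer: "?L (merge (Inl ` I) (Inr ` I) (x, y)) = ?L x" "?R (merge (Inl ` I) (Inr ` I) (x, y)) = ?R y" for x y :: "'i + 'i \<Rightarrow> 'a"
      by (auto simp: merge_def fun_eq_iff)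
    have "(\<integral>\<omega>. f (X {} \<omega>) * f (X I \<omega>) \<partial>?PK)
      = (\<integral>x. (\<integral>y. f (?L (merge (Inl ` I) (Inr ` I) (x, y))) * f (?R (merge (Inl ` I) (Inr ` I) (x, y))) \<partial>?PR) \<partial>?PL)"
      using product_integral_fold[of "Inl ` I" "Inr ` I" "\<lambda>\<omega>. f (X {} \<omega>) * f (X I \<omega>)"] I prod_int[of "{}" I]
      by (auto simp: LX)
    also have "\<dots> = (\<integral>x. f (?L x) * (\<integral>y. f (?R y) \<partial>?PR) \<partial>?PL)" by (simp add: mer)
    also have "\<dots> = (\<integral>x. f (?L x) \<partial>?PL) * (\<integral>y. f (?R y) \<partial>?PR)" by simp
    also have "(\<integral>x. f (?L x) \<partial>?PL) = (\<integral>x. f x \<partial>?P)"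
      using integral_distr[OF Ll(2) f] Ll(1) by simp
    also have "(\<integral>y. f (?R y) \<partial>?PR) = (\<integral>x. f x \<partial>?P)"
      using integral_distr[OF Rl(2) f] Rl(1) by simp
    finally show ?thesis by (simp add: power2_eq_square)
  qed
  have "(\<integral>x. (f x)\<^sup>2 \<partial>?P) - (\<integral>x. f x \<partial>?P)\<^sup>2
    = (\<integral>\<omega>. (f (X {} \<omega>))\<^sup>2 \<partial>?PK) - (\<integral>\<omega>. f (X {} \<omega>) * f (X I \<omega>) \<partial>?PK)"
    using int_X[of "\<lambda>x. (f x)\<^sup>2" "{}"] by (simp add: indep)
  also have "\<dots> = (\<integral>\<omega>. (f (X {} \<omega>))\<^sup>2 - f (X {} \<omega>) * f (X I \<omega>) \<partial>?PK)"
    by (rule Bochner_Integration.integral_diff[symmetric]) (rule fX2, rule prod_int)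
  also have "\<dots> = (\<integral>\<omega>. f (X {} \<omega>) * (f (X {} \<omega>) - f (X I \<omega>)) \<partial>?PK)"
    by (intro Bochner_Integration.integral_cong) (auto simp: algebra_simps power2_eq_square)
  also have "\<dots> \<le> 2 * (\<Sum>i\<in>I. ?e i)" by (rule tele) simp
  finally show ?thesis .
qed

section \<open>Stability under removal of a sample point\<close>

text \<open>
Vectors within an angle of 60 degrees: the difference is not longer than the longer one. With
\<open>sgn 0 = 0\<close> the claim includes zero vectors, so that the cone argument covers coinciding sample points.
\<close>
lemma norm_diff_le_of_sgn_close:
  fixes y z :: "'a::euclidean_space"
  assumes sg: "norm (sgn y - sgn z) < 1" and yz: "norm z \<le> norm y"
  shows "norm (y - z) \<le> norm y"
proof (cases "y = 0 \<or> z = 0")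
  case True
  then show ?thesis using yz by auto
next
  have id: "(norm (u - v))\<^sup>2 = (norm u)\<^sup>2 + (norm v)\<^sup>2 - 2 * (u \<bullet> v)" for u v :: 'a
    by (simp add: power2_norm_eq_inner inner_diff inner_commute)
  case False
  then have n: "norm (sgn y) = 1" "norm (sgn z) = 1" by (auto simp: norm_sgn)
  have "(norm (sgn y - sgn z))\<^sup>2 < 1" using sg by (simp add: power_less_one_iff)
  then have "1 / 2 \<le> sgn y \<bullet> sgn z"
    unfolding id using n by simp
  moreover have "y \<bullet> z = norm y * norm z * (sgn y \<bullet> sgn z)"
  proof -
    have "norm u *\<^sub>R sgn u = u" for u :: 'a by (cases "u = 0") (auto simp: sgn_div_norm)
    then show ?thesis by (metis inner_scaleR_left inner_scaleR_right mult.assoc)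
  qed
  ultimately have in2: "norm y * norm z * (1 / 2) \<le> y \<bullet> z"
    using mult_left_mono[of "1 / 2" "sgn y \<bullet> sgn z" "norm y * norm z"] by simp
  have "norm z * norm z \<le> norm y * norm z" using yz by (intro mult_right_mono) auto
  moreover note id[of y z]
  ultimately have "(norm (y - z))\<^sup>2 \<le> (norm y)\<^sup>2"
    using in2 by (simp add: power2_eq_square)
  then show ?thesis by simp
qed

text \<open>
Cover the unit ball by finitely many balls of radius \<open>1 / 2\<close>. Among the points \<open>j\<close> whose direction from \<open>i\<close>
lies in one of them, the farthest one has all the others at most as far away as \<open>i\<close>, so there are at
most \<open>k\<close> of them. The constant depends on the dimension only.
\<close>
lemma card_reverse_neighbours:
  "\<exists>K0::nat. \<forall>(I :: 'i set) (x :: 'i \<Rightarrow> 'a::euclidean_space) i k. finite I \<longrightarrow> i \<in> I \<longrightarrow>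
     card {j\<in>I - {i}. card {l\<in>I - {j} - {i}. dist (x j) (x l) \<le> dist (x j) (x i)} < k} \<le> K0 * k"
proof -
  have sub: "cball (0::'a) 1 \<subseteq> (\<Union>c\<in>cball 0 1. ball c (1 / 2))" by auto
  obtain T :: "'a set" where T: "finite T" "cball 0 1 \<subseteq> (\<Union>c\<in>T. ball c (1 / 2))"
    by (rule compactE_image[OF compact_cball _ sub]) auto
  have "card {j\<in>I - {i}. card {l\<in>I - {j} - {i}. dist (x j) (x l) \<le> dist (x j) (x i)} < k} \<le> card T * k"
    if I: "finite I" and i: "i \<in> I" for I :: "'i set" and x :: "'i \<Rightarrow> 'a" and i k
  proof -
    let ?N = "{j\<in>I - {i}. card {l\<in>I - {j} - {i}. dist (x j) (x l) \<le> dist (x j) (x i)} < k}"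
    let ?Nc = "\<lambda>c. {j\<in>?N. sgn (x j - x i) \<in> ball c (1 / 2)}"
    have c: "card (?Nc c) \<le> k" for c
    proof (cases "?Nc c = {}")
      case True
      show ?thesis unfolding True by simp
    next
      case False
      have fin: "finite (?Nc c)" using I by simp
      obtain j where j: "j \<in> ?Nc c" "\<And>l. l \<in> ?Nc c \<Longrightarrow> norm (x l - x i) \<le> norm (x j - x i)"
        using obtains_MAX[OF fin False, of "\<lambda>l. norm (x l - x i)"]
          Max_ge[OF finite_imageI[OF fin, of "\<lambda>l. norm (x l - x i)"]] by (metis (no_types, lifting) imageI)
      have "?Nc c - {j} \<subseteq> {l\<in>I - {j} - {i}. dist (x j) (x l) \<le> dist (x j) (x i)}"
      proof
        fix l assume l: "l \<in> ?Nc c - {j}"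
        have "dist c (sgn (x j - x i)) < 1 / 2" "dist c (sgn (x l - x i)) < 1 / 2" using l j(1) by auto
        then have "dist (sgn (x j - x i)) (sgn (x l - x i)) < 1"
          using dist_triangle3[of "sgn (x j - x i)" "sgn (x l - x i)" c] by linarith
        then have "norm ((x j - x i) - (x l - x i)) \<le> norm (x j - x i)"
          using j(2)[of l] l by (intro norm_diff_le_of_sgn_close) (auto simp: dist_norm)
        then show "l \<in> {l\<in>I - {j} - {i}. dist (x j) (x l) \<le> dist (x j) (x i)}"
          using l by (simp add: dist_norm)
      qed
      then have "card (?Nc c - {j}) \<le> card {l\<in>I - {j} - {i}. dist (x j) (x l) \<le> dist (x j) (x i)}"
        using I by (intro card_mono) auto
      also have "\<dots> < k" using j(1) by simp
      finally have "card (?Nc c - {j}) < k" .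
      moreover have "card (?Nc c) = Suc (card (?Nc c - {j}))" by (rule card.remove[OF fin j(1)])
      ultimately show ?thesis by linarith
    qed
    have "?N \<subseteq> (\<Union>c\<in>T. ?Nc c)"
    proof
      fix j assume "j \<in> ?N"
      moreover have "sgn (x j - x i) \<in> cball 0 1" by (simp add: norm_sgn)
      ultimately show "j \<in> (\<Union>c\<in>T. ?Nc c)" using T(2) by blast
    qed
    then have "card ?N \<le> card (\<Union>c\<in>T. ?Nc c)" using I T(1) by (intro card_mono) auto
    also have "\<dots> \<le> (\<Sum>c\<in>T. card (?Nc c))" by (rule card_UN_le[OF T(1)])
    also have "\<dots> \<le> (\<Sum>c\<in>T. k)" by (intro sum_mono c)
    finally show ?thesis by simp
  qed
  then show ?thesis by blast
qed

text \<open>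
A deterministic inequality. For each \<open>i\<close> the number of changed summands is bounded by the cone argument, so
that the square of their sum is comparable with the sum of their squares; for each \<open>j\<close> at most \<open>k\<close> removals
change the summand \<open>j\<close>.
\<close>
lemma sum_remove_one_squared:
  assumes k: "1 \<le> k"
  shows "\<exists>K. \<forall>(I :: 'i set) (x :: 'i \<Rightarrow> 'a::euclidean_space) (h :: real \<Rightarrow> real). finite I \<longrightarrow> k + 2 \<le> card I \<longrightarrow>
    (\<Sum>i\<in>I. ((\<Sum>j\<in>I. h (kth_smallest k (\<lambda>l. dist (x j) (x l)) (I - {j})))
      - (\<Sum>j\<in>I - {i}. h (kth_smallest k (\<lambda>l. dist (x j) (x l)) (I - {j} - {i}))))\<^sup>2)
    \<le> K * (\<Sum>j\<in>I. (h (kth_smallest k (\<lambda>l. dist (x j) (x l)) (I - {j})))\<^sup>2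
        + (h (kth_smallest (k + 1) (\<lambda>l. dist (x j) (x l)) (I - {j})))\<^sup>2)"
proof -
  obtain K0 :: nat where K0: "\<And>(I :: 'i set) (x :: 'i \<Rightarrow> 'a) i k. finite I \<Longrightarrow> i \<in> I \<Longrightarrow>
     card {j\<in>I - {i}. card {l\<in>I - {j} - {i}. dist (x j) (x l) \<le> dist (x j) (x i)} < k} \<le> K0 * k"
    using card_reverse_neighbours[where 'i = 'i and 'a = 'a] by blast
  have "(\<Sum>i\<in>I. ((\<Sum>j\<in>I. h (kth_smallest k (\<lambda>l. dist (x j) (x l)) (I - {j})))
      - (\<Sum>j\<in>I - {i}. h (kth_smallest k (\<lambda>l. dist (x j) (x l)) (I - {j} - {i}))))\<^sup>2)
    \<le> (3 * (1 + real (K0 * k)) * (1 + real k)) * (\<Sum>j\<in>I. (h (kth_smallest k (\<lambda>l. dist (x j) (x l)) (I - {j})))\<^sup>2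
        + (h (kth_smallest (k + 1) (\<lambda>l. dist (x j) (x l)) (I - {j})))\<^sup>2)"
    if I: "finite I" "k + 2 \<le> card I" for I :: "'i set" and x :: "'i \<Rightarrow> 'a" and h :: "real \<Rightarrow> real"
  proof -
    let ?R = "\<lambda>j. kth_smallest k (\<lambda>l. dist (x j) (x l)) (I - {j})"
    let ?R' = "\<lambda>i j. kth_smallest k (\<lambda>l. dist (x j) (x l)) (I - {j} - {i})"
    define \<xi> where "\<xi> = (\<lambda>j. h (?R j))"
    define \<xi>' where "\<xi>' = (\<lambda>i j. h (?R' i j))"
    define \<eta> where "\<eta> = (\<lambda>j. h (kth_smallest (k + 1) (\<lambda>l. dist (x j) (x l)) (I - {j})))"
    define N where "N = (\<lambda>i. {j\<in>I - {i}. ?R' i j \<noteq> ?R j})"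
    have cI: "k + 1 \<le> card (I - {j})" if "j \<in> I" for j using that I by simp
    have rem: "?R' i j = kth_smallest (k + 1) (\<lambda>l. dist (x j) (x l)) (I - {j})"
      "dist (x j) (x i) \<le> ?R j"
      "card {l\<in>I - {j}. dist (x j) (x l) \<le> ?R j} \<le> k"
      "card {l\<in>I - {j} - {i}. dist (x j) (x l) \<le> dist (x j) (x i)} < k"
      if "i \<in> I" "j \<in> N i" for i j
      using kth_smallest_remove[of "I - {j}" k i "\<lambda>l. dist (x j) (x l)"] that I k cI[of j]
      by (auto simp: N_def)
    have finN: "finite (N i)" for i using I by (simp add: N_def)
    have cN: "card (N i) \<le> K0 * k" if "i \<in> I" for i
    proof -
      have "N i \<subseteq> {j\<in>I - {i}. card {l\<in>I - {j} - {i}. dist (x j) (x l) \<le> dist (x j) (x i)} < k}"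
        using rem(4)[OF that] by (auto simp: N_def)
      then have "card (N i) \<le> card {j\<in>I - {i}. card {l\<in>I - {j} - {i}. dist (x j) (x l) \<le> dist (x j) (x i)} < k}"
        using I by (intro card_mono) auto
      also have "\<dots> \<le> K0 * k" using K0[OF I(1) that] .
      finally show ?thesis .
    qed
    have one: "((\<Sum>j\<in>I. \<xi> j) - (\<Sum>j\<in>I - {i}. \<xi>' i j))\<^sup>2
      \<le> 3 * (1 + real (K0 * k)) * ((\<xi> i)\<^sup>2 + (\<Sum>j\<in>N i. (\<xi> j)\<^sup>2 + (\<eta> j)\<^sup>2))" if i: "i \<in> I" for i
    proof -
      let ?c = "real (K0 * k)"
      have "(\<Sum>j\<in>I. \<xi> j) = \<xi> i + (\<Sum>j\<in>I - {i}. \<xi> j)" using I i by (simp add: sum.remove)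
      then have "(\<Sum>j\<in>I. \<xi> j) - (\<Sum>j\<in>I - {i}. \<xi>' i j) = \<xi> i + (\<Sum>j\<in>I - {i}. \<xi> j - \<xi>' i j)"
        by (simp add: sum_subtractf)
      also have "(\<Sum>j\<in>I - {i}. \<xi> j - \<xi>' i j) = (\<Sum>j\<in>N i. \<xi> j - \<xi>' i j)"
        using I by (intro sum.mono_neutral_right) (auto simp: N_def \<xi>_def \<xi>'_def)
      also have "(\<Sum>j\<in>N i. \<xi> j - \<xi>' i j) = (\<Sum>j\<in>N i. \<xi> j) - (\<Sum>j\<in>N i. \<eta> j)"
        using rem(1)[OF i] by (simp add: sum_subtractf \<xi>'_def \<eta>_def)
      finally have e: "(\<Sum>j\<in>I. \<xi> j) - (\<Sum>j\<in>I - {i}. \<xi>' i j) = \<xi> i + ((\<Sum>j\<in>N i. \<xi> j) - (\<Sum>j\<in>N i. \<eta> j))" .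
      have cs: "(\<Sum>j\<in>N i. w j)\<^sup>2 \<le> ?c * (\<Sum>j\<in>N i. (w j)\<^sup>2)" for w :: "'i \<Rightarrow> real"
      proof -
        have "(\<Sum>j\<in>N i. w j)\<^sup>2 \<le> real (card (N i)) * (\<Sum>j\<in>N i. (w j)\<^sup>2)"
          using Cauchy_Schwarz_ineq_sum[of "\<lambda>_. 1" w "N i"] by simp
        also have "\<dots> \<le> ?c * (\<Sum>j\<in>N i. (w j)\<^sup>2)"
          using cN[OF i] by (intro mult_right_mono sum_nonneg) (auto simp del: of_nat_mult)
        finally show ?thesis .
      qed
      have tri: "(a + (b - c))\<^sup>2 \<le> 3 * a\<^sup>2 + 3 * b\<^sup>2 + 3 * c\<^sup>2" for a b c :: real
      proof -
        have "0 \<le> (a - b)\<^sup>2 + (a + c)\<^sup>2 + (b + c)\<^sup>2" by simp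
        then show ?thesis by (simp add: power2_eq_square algebra_simps)
      qed
      have "((\<Sum>j\<in>I. \<xi> j) - (\<Sum>j\<in>I - {i}. \<xi>' i j))\<^sup>2
        \<le> 3 * (\<xi> i)\<^sup>2 + 3 * (\<Sum>j\<in>N i. \<xi> j)\<^sup>2 + 3 * (\<Sum>j\<in>N i. \<eta> j)\<^sup>2"
        unfolding e by (rule tri)
      also have "\<dots> \<le> 3 * (\<xi> i)\<^sup>2 + 3 * (?c * (\<Sum>j\<in>N i. (\<xi> j)\<^sup>2)) + 3 * (?c * (\<Sum>j\<in>N i. (\<eta> j)\<^sup>2))"
        using cs by (intro add_mono mult_left_mono) auto
      also have "\<dots> = 3 * (\<xi> i)\<^sup>2 + 3 * ?c * (\<Sum>j\<in>N i. (\<xi> j)\<^sup>2 + (\<eta> j)\<^sup>2)"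
        by (simp add: sum.distrib algebra_simps)
      also have "\<dots> \<le> 3 * (1 + ?c) * (\<xi> i)\<^sup>2 + 3 * (1 + ?c) * (\<Sum>j\<in>N i. (\<xi> j)\<^sup>2 + (\<eta> j)\<^sup>2)"
        by (intro add_mono mult_right_mono sum_nonneg) auto
      finally show ?thesis by (simp add: algebra_simps)
    qed
    have cnt: "card {i\<in>I. j \<in> N i} \<le> k" if j: "j \<in> I" for j
    proof (cases "{i\<in>I. j \<in> N i} = {}")
      case True
      show ?thesis unfolding True by simp
    next
      case False
      then obtain i0 where i0: "i0 \<in> I" "j \<in> N i0" by auto
      have "{i\<in>I. j \<in> N i} \<subseteq> {l\<in>I - {j}. dist (x j) (x l) \<le> ?R j}"
        using rem(2) by (auto simp: N_def)
      then have "card {i\<in>I. j \<in> N i} \<le> card {l\<in>I - {j}. dist (x j) (x l) \<le> ?R j}"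
        using I by (intro card_mono) auto
      also have "\<dots> \<le> k" by (rule rem(3)[OF i0])
      finally show ?thesis .
    qed
    have dbl: "(\<Sum>i\<in>I. \<Sum>j\<in>N i. w j) \<le> real k * (\<Sum>j\<in>I. w j)" if w: "\<And>j. 0 \<le> w j" for w :: "'i \<Rightarrow> real"
    proof -
      have "(\<Sum>i\<in>I. \<Sum>j\<in>N i. w j) = (\<Sum>i\<in>I. \<Sum>j\<in>I. if j \<in> N i then w j else 0)"
      proof (rule sum.cong[OF refl])
        fix i assume "i \<in> I"
        have "N i \<subseteq> I" by (auto simp: N_def)
        then show "(\<Sum>j\<in>N i. w j) = (\<Sum>j\<in>I. if j \<in> N i then w j else 0)"
          using I by (intro sum.mono_neutral_cong_left) auto
      qed
      also have "\<dots> = (\<Sum>j\<in>I. \<Sum>i\<in>I. if j \<in> N i then w j else 0)" by (rule sum.swap)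
      also have "\<dots> = (\<Sum>j\<in>I. real (card {i\<in>I. j \<in> N i}) * w j)"
        using I by (intro sum.cong refl) (simp add: sum.If_cases Int_def)
      also have "\<dots> \<le> (\<Sum>j\<in>I. real k * w j)"
        using cnt w by (intro sum_mono mult_right_mono) auto
      finally show ?thesis by (simp add: sum_distrib_left)
    qed
    have "(\<Sum>i\<in>I. ((\<Sum>j\<in>I. \<xi> j) - (\<Sum>j\<in>I - {i}. \<xi>' i j))\<^sup>2)
      \<le> (\<Sum>i\<in>I. 3 * (1 + real (K0 * k)) * ((\<xi> i)\<^sup>2 + (\<Sum>j\<in>N i. (\<xi> j)\<^sup>2 + (\<eta> j)\<^sup>2)))"
      by (intro sum_mono one)
    also have "\<dots> = 3 * (1 + real (K0 * k)) * ((\<Sum>i\<in>I. (\<xi> i)\<^sup>2) + (\<Sum>i\<in>I. \<Sum>j\<in>N i. (\<xi> j)\<^sup>2 + (\<eta> j)\<^sup>2))"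
      by (simp add: sum_distrib_left[symmetric] sum.distrib)
    also have "\<dots> \<le> 3 * (1 + real (K0 * k)) * ((\<Sum>j\<in>I. (\<xi> j)\<^sup>2 + (\<eta> j)\<^sup>2) + real k * (\<Sum>j\<in>I. (\<xi> j)\<^sup>2 + (\<eta> j)\<^sup>2))"
      by (intro mult_left_mono add_mono sum_mono dbl) auto
    also have "\<dots> = (3 * (1 + real (K0 * k)) * (1 + real k)) * (\<Sum>j\<in>I. (\<xi> j)\<^sup>2 + (\<eta> j)\<^sup>2)"
      by (simp add: algebra_simps)
    finally show ?thesis unfolding \<xi>_def \<xi>'_def \<eta>_def .
  qed
  then show ?thesis by blast
qed

section \<open>Mean squared error under a bounded regular density\<close>

context knn_model begin

definition knn_term :: "(real \<Rightarrow> real) \<Rightarrow> nat \<Rightarrow> nat \<Rightarrow> nat set \<Rightarrow> nat \<Rightarrow> (nat \<Rightarrow> 'a) \<Rightarrow> real" where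
  "knn_term \<phi> k n J j z =
     \<phi> (real n * (unit_ball_vol (real DIM('a)) * kth_smallest k (\<lambda>l. dist (z j) (z l)) J ^ DIM('a)))"

lemma knn_term_measurable:
  assumes "\<phi> \<in> borel_measurable borel" "finite J" "1 \<le> k" "k \<le> card J" "insert j J \<subseteq> I"
  shows "knn_term \<phi> k n J j \<in> borel_measurable (PiM I (\<lambda>_. \<mu>))"
  unfolding knn_term_def[abs_def]
  using assms by (intro measurable_compose[OF borel_measurable_knn_volume assms(1)])

lemma knn_second_moment:
  assumes k: "1 \<le> k" "k + 1 \<le> m" and j: "j \<in> {1..m}" and \<phi> [measurable]: "\<phi> \<in> borel_measurable borel"
    and fin: "wmoment (\<lambda>u. (\<phi> u)\<^sup>2) k 0 < \<infinity>"
  shows "integrable (PiM {1..m} (\<lambda>_. \<mu>)) (\<lambda>z. (knn_term \<phi> k (m - 1) ({1..m} - {j}) j z)\<^sup>2)"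
    and "(\<integral>z. (knn_term \<phi> k (m - 1) ({1..m} - {j}) j z)\<^sup>2 \<partial>PiM {1..m} (\<lambda>_. \<mu>))
      \<le> Mx * (exp (real k) * Mx ^ (k - 1)) * enn2real (wmoment (\<lambda>u. (\<phi> u)\<^sup>2) k 0)"
proof -
  let ?J = "{1..m} - {j}" and ?P = "PiM {1..m} (\<lambda>_. \<mu>)"
  let ?Z = "\<lambda>z. (knn_term \<phi> k (m - 1) ?J j z)\<^sup>2"
  let ?K = "Mx * (exp (real k) * Mx ^ (k - 1))"
  have cJ: "card ?J = m - 1" "insert j ?J = {1..m}" using j by auto
  have "knn_term \<phi> k (m - 1) ?J j \<in> borel_measurable ?P"
    using k j cJ by (intro knn_term_measurable \<phi>) auto
  then have mZ: "?Z \<in> borel_measurable ?P" by measurable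
  have "(\<integral>\<^sup>+z. ennreal \<bar>(\<phi> (real (card ?J) * (unit_ball_vol (real DIM('a)) * kth_smallest k (\<lambda>l. dist (z j) (z l)) ?J ^ DIM('a))))\<^sup>2\<bar>
      \<partial>PiM (insert j ?J) (\<lambda>_. \<mu>)) \<le> ennreal ?K * wmoment (\<lambda>u. (\<phi> u)\<^sup>2) k 0"
    using k cJ(1) by (intro knn_moment[where \<phi> = "\<lambda>u. (\<phi> u)\<^sup>2"]) auto
  then have b: "(\<integral>\<^sup>+z. ennreal (?Z z) \<partial>?P) \<le> ennreal ?K * wmoment (\<lambda>u. (\<phi> u)\<^sup>2) k 0"
    unfolding cJ knn_term_def by simp
  also have e: "ennreal ?K * wmoment (\<lambda>u. (\<phi> u)\<^sup>2) k 0 = ennreal (?K * enn2real (wmoment (\<lambda>u. (\<phi> u)\<^sup>2) k 0))"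
    using fin Mx by (subst ennreal_mult) (auto simp: ennreal_enn2real)
  finally have b2: "(\<integral>\<^sup>+z. ennreal (?Z z) \<partial>?P) \<le> ennreal (?K * enn2real (wmoment (\<lambda>u. (\<phi> u)\<^sup>2) k 0))" .
  show int: "integrable ?P ?Z"
    using b2 by (intro integrableI_bounded mZ) (auto simp: le_less_trans)
  have "ennreal (\<integral>z. ?Z z \<partial>?P) = (\<integral>\<^sup>+z. ennreal (?Z z) \<partial>?P)"
    by (rule nn_integral_eq_integral[OF int, symmetric]) simp
  then have "ennreal (\<integral>z. ?Z z \<partial>?P) \<le> ennreal (?K * enn2real (wmoment (\<lambda>u. (\<phi> u)\<^sup>2) k 0))" using b2 by simp
  then show "(\<integral>z. ?Z z \<partial>?P) \<le> ?K * enn2real (wmoment (\<lambda>u. (\<phi> u)\<^sup>2) k 0)"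
    using Mx by (subst (asm) ennreal_le_iff) auto
qed

lemma knn_variance:
  assumes k: "1 \<le> k" and \<phi> [measurable]: "\<phi> \<in> borel_measurable borel"
    and fin: "wmoment (\<lambda>u. (\<phi> u)\<^sup>2) k 0 < \<infinity>" "wmoment (\<lambda>u. (\<phi> u)\<^sup>2) (k + 1) 0 < \<infinity>"
  shows "\<exists>K\<ge>0. \<forall>m\<ge>k+2.
     integrable (PiM {1..m} (\<lambda>_. \<mu>)) (\<lambda>z. (\<Sum>j\<in>{1..m}. knn_term \<phi> k (m - 1) ({1..m} - {j}) j z)\<^sup>2) \<and>
     (\<integral>z. (\<Sum>j\<in>{1..m}. knn_term \<phi> k (m - 1) ({1..m} - {j}) j z)\<^sup>2 \<partial>PiM {1..m} (\<lambda>_. \<mu>))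
      - (\<integral>z. (\<Sum>j\<in>{1..m}. knn_term \<phi> k (m - 1) ({1..m} - {j}) j z) \<partial>PiM {1..m} (\<lambda>_. \<mu>))\<^sup>2 \<le> K * real m"
proof -
  obtain K :: real where K: "\<And>(I :: nat set) (x :: nat \<Rightarrow> 'a) (h :: real \<Rightarrow> real). finite I \<Longrightarrow> k + 2 \<le> card I \<Longrightarrow>
    (\<Sum>i\<in>I. ((\<Sum>j\<in>I. h (kth_smallest k (\<lambda>l. dist (x j) (x l)) (I - {j})))
      - (\<Sum>j\<in>I - {i}. h (kth_smallest k (\<lambda>l. dist (x j) (x l)) (I - {j} - {i}))))\<^sup>2)
    \<le> K * (\<Sum>j\<in>I. (h (kth_smallest k (\<lambda>l. dist (x j) (x l)) (I - {j})))\<^sup>2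
        + (h (kth_smallest (k + 1) (\<lambda>l. dist (x j) (x l)) (I - {j})))\<^sup>2)"
    using sum_remove_one_squared[OF k, where 'i = nat and 'a = 'a] by blast
  define c1 where "c1 = Mx * (exp (real k) * Mx ^ (k - 1)) * enn2real (wmoment (\<lambda>u. (\<phi> u)\<^sup>2) k 0)"
  define c2 where "c2 = Mx * (exp (real (k + 1)) * Mx ^ (k + 1 - 1)) * enn2real (wmoment (\<lambda>u. (\<phi> u)\<^sup>2) (k + 1) 0)"
  have c0: "0 \<le> c1" "0 \<le> c2" using Mx by (auto simp: c1_def c2_def)
  let ?C = "2 * (\<bar>K\<bar> * (c1 + c2))"
  have "integrable (PiM {1..m} (\<lambda>_. \<mu>)) (\<lambda>z. (\<Sum>j\<in>{1..m}. knn_term \<phi> k (m - 1) ({1..m} - {j}) j z)\<^sup>2) \<and>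
     (\<integral>z. (\<Sum>j\<in>{1..m}. knn_term \<phi> k (m - 1) ({1..m} - {j}) j z)\<^sup>2 \<partial>PiM {1..m} (\<lambda>_. \<mu>))
      - (\<integral>z. (\<Sum>j\<in>{1..m}. knn_term \<phi> k (m - 1) ({1..m} - {j}) j z) \<partial>PiM {1..m} (\<lambda>_. \<mu>))\<^sup>2 \<le> ?C * real m"
    if m: "k + 2 \<le> m" for m
  proof -
    let ?I = "{1..m}" and ?P = "PiM {1..m} (\<lambda>_. \<mu>)"
    let ?X = "\<lambda>j. knn_term \<phi> k (m - 1) (?I - {j}) j"
    let ?E = "\<lambda>j. knn_term \<phi> (k + 1) (m - 1) (?I - {j}) j"
    define f where "f = (\<lambda>z. \<Sum>j\<in>?I. ?X j z)"
    define g where "g = (\<lambda>i z. \<Sum>j\<in>?I - {i}. knn_term \<phi> k (m - 1) (?I - {j} - {i}) j z)"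
    have mX: "?X j \<in> borel_measurable ?P" if "j \<in> ?I" for j
      using that k m by (intro knn_term_measurable \<phi>) auto
    have mf: "f \<in> borel_measurable ?P" unfolding f_def by (intro borel_measurable_sum mX)
    have mg: "g i \<in> borel_measurable ?P" if "i \<in> ?I" for i
      unfolding g_def using that k m
      by (intro borel_measurable_sum knn_term_measurable \<phi>) auto
    have iX: "integrable ?P (\<lambda>z. (?X j z)\<^sup>2)" "(\<integral>z. (?X j z)\<^sup>2 \<partial>?P) \<le> c1" if "j \<in> ?I" for j
      unfolding c1_def using knn_second_moment[of k m j \<phi>] that k m fin by auto
    have iE: "integrable ?P (\<lambda>z. (?E j z)\<^sup>2)" "(\<integral>z. (?E j z)\<^sup>2 \<partial>?P) \<le> c2" if "j \<in> ?I" for j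
      unfolding c2_def using knn_second_moment[of "k + 1" m j \<phi>] that k m fin by auto
    have if2: "integrable ?P (\<lambda>z. (f z)\<^sup>2)"
    proof (rule Bochner_Integration.integrable_bound)
      show "integrable ?P (\<lambda>z. (\<Sum>j\<in>?I. (?X j z)\<^sup>2) * real (card ?I))"
        by (intro Bochner_Integration.integrable_mult_left Bochner_Integration.integrable_sum iX)
      show "(\<lambda>z. (f z)\<^sup>2) \<in> borel_measurable ?P" using mf by measurable
      show "AE z in ?P. norm ((f z)\<^sup>2) \<le> norm ((\<Sum>j\<in>?I. (?X j z)\<^sup>2) * real (card ?I))"
      proof (intro AE_I2)
        fix z
        have "(f z)\<^sup>2 \<le> (\<Sum>j\<in>?I. (?X j z)\<^sup>2) * real (card ?I)"
          unfolding f_def by (rule sum_squared_le_sum_of_squares)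
        then show "norm ((f z)\<^sup>2) \<le> norm ((\<Sum>j\<in>?I. (?X j z)\<^sup>2) * real (card ?I))" by simp
      qed
    qed
    let ?S = "\<lambda>z. \<bar>K\<bar> * (\<Sum>j\<in>?I. (?X j z)\<^sup>2 + (?E j z)\<^sup>2)"
    have iS: "integrable ?P ?S"
      by (intro integrable_mult_right Bochner_Integration.integrable_sum Bochner_Integration.integrable_add iX iE)
    have det: "(\<Sum>i\<in>?I. (f z - g i z)\<^sup>2) \<le> ?S z" for z
    proof -
      let ?h = "\<lambda>r. \<phi> (real (m - 1) * (unit_ball_vol (real DIM('a)) * r ^ DIM('a)))"
      have "(\<Sum>i\<in>?I. (f z - g i z)\<^sup>2) \<le> K * (\<Sum>j\<in>?I. (?X j z)\<^sup>2 + (?E j z)\<^sup>2)"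
        unfolding f_def g_def knn_term_def using m by (intro K[of "{1..m}" ?h z]) auto
      also have "\<dots> \<le> ?S z" by (intro mult_right_mono sum_nonneg) auto
      finally show ?thesis .
    qed
    have ifg: "integrable ?P (\<lambda>z. (f z - g i z)\<^sup>2)" if i: "i \<in> ?I" for i
    proof (rule Bochner_Integration.integrable_bound[OF iS])
      show "(\<lambda>z. (f z - g i z)\<^sup>2) \<in> borel_measurable ?P" using mf mg[OF i] by measurable
      show "AE z in ?P. norm ((f z - g i z)\<^sup>2) \<le> norm (?S z)"
      proof (intro AE_I2)
        fix z
        have "(f z - g i z)\<^sup>2 \<le> (\<Sum>i\<in>?I. (f z - g i z)\<^sup>2)"
          by (rule member_le_sum[OF i]) auto
        also note det[of z]
        finally show "norm ((f z - g i z)\<^sup>2) \<le> norm (?S z)" by simp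
      qed
    qed
    have loc: "g i x = g i y" if i: "i \<in> ?I" and xy: "\<And>j. j \<in> ?I - {i} \<Longrightarrow> x j = y j" for i x y
      unfolding g_def knn_term_def
    proof (rule sum.cong[OF refl])
      fix j assume j: "j \<in> ?I - {i}"
      have "kth_smallest k (\<lambda>l. dist (x j) (x l)) (?I - {j} - {i}) = kth_smallest k (\<lambda>l. dist (y j) (y l)) (?I - {j} - {i})"
        using xy[OF j] xy by (intro kth_smallest_cong) auto
      then show "\<phi> (real (m - 1) * (unit_ball_vol (real DIM('a)) * kth_smallest k (\<lambda>l. dist (x j) (x l)) (?I - {j} - {i}) ^ DIM('a)))
        = \<phi> (real (m - 1) * (unit_ball_vol (real DIM('a)) * kth_smallest k (\<lambda>l. dist (y j) (y l)) (?I - {j} - {i}) ^ DIM('a)))"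
        by simp
    qed
    have "(\<integral>z. (f z)\<^sup>2 \<partial>?P) - (\<integral>z. f z \<partial>?P)\<^sup>2 \<le> 2 * (\<Sum>i\<in>?I. \<integral>z. (f z - g i z)\<^sup>2 \<partial>?P)"
      by (rule efron_stein[OF prob_mu _ mf if2 mg ifg loc]) auto
    also have "(\<Sum>i\<in>?I. \<integral>z. (f z - g i z)\<^sup>2 \<partial>?P) = (\<integral>z. (\<Sum>i\<in>?I. (f z - g i z)\<^sup>2) \<partial>?P)"
      by (rule Bochner_Integration.integral_sum[symmetric]) (rule ifg)
    also have "\<dots> \<le> (\<integral>z. ?S z \<partial>?P)"
      by (rule integral_mono[OF Bochner_Integration.integrable_sum[OF ifg] iS det])
    also have "(\<integral>z. ?S z \<partial>?P) = \<bar>K\<bar> * (\<Sum>j\<in>?I. (\<integral>z. (?X j z)\<^sup>2 \<partial>?P) + (\<integral>z. (?E j z)\<^sup>2 \<partial>?P))"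
    proof -
      have "(\<integral>z. (\<Sum>j\<in>?I. (?X j z)\<^sup>2 + (?E j z)\<^sup>2) \<partial>?P) = (\<Sum>j\<in>?I. \<integral>z. (?X j z)\<^sup>2 + (?E j z)\<^sup>2 \<partial>?P)"
        by (rule Bochner_Integration.integral_sum) (intro Bochner_Integration.integrable_add iX iE)
      also have "\<dots> = (\<Sum>j\<in>?I. (\<integral>z. (?X j z)\<^sup>2 \<partial>?P) + (\<integral>z. (?E j z)\<^sup>2 \<partial>?P))"
        by (intro sum.cong refl Bochner_Integration.integral_add iX iE)
      finally show ?thesis by simp
    qed
    also have "\<dots> \<le> \<bar>K\<bar> * (\<Sum>j\<in>?I. c1 + c2)"
      by (intro mult_left_mono sum_mono add_mono iX iE) auto
    finally have "(\<integral>z. (f z)\<^sup>2 \<partial>?P) - (\<integral>z. f z \<partial>?P)\<^sup>2 \<le> ?C * real m"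
      by (simp add: algebra_simps)
    then show ?thesis using if2 unfolding f_def by blast
  qed
  then show ?thesis using c0 by (intro exI[of _ ?C]) auto
qed

text \<open>
The summands are kept separate, one for each centre \<open>j\<close>, since the law of each follows from \<open>knn_bias\<close> with
its own index set.
\<close>
lemma knn_mean:
  assumes k: "1 \<le> k" and \<phi> [measurable]: "\<phi> \<in> borel_measurable borel"
    and est: "is_estimator_function f k \<phi>"
    and fin: "wmoment \<phi> k 0 < \<infinity>" "wmoment \<phi> k (s / real DIM('a)) < \<infinity>"
  shows "\<exists>A\<ge>0. \<forall>m\<ge>k+1. \<forall>j\<in>{1..m}.
     integrable (PiM {1..m} (\<lambda>_. \<mu>)) (knn_term \<phi> k (m - 1) ({1..m} - {j}) j) \<and>
     \<bar>(\<integral>z. knn_term \<phi> k (m - 1) ({1..m} - {j}) j z \<partial>PiM {1..m} (\<lambda>_. \<mu>)) - density_functional f q\<bar>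
       \<le> A * (real (m - 1) powr (- s / real DIM('a)) + 1 / real (m - 1))"
proof -
  let ?d = "real DIM('a)" and ?V = "unit_ball_vol (real DIM('a))"
  define w0 where "w0 = enn2real (wmoment \<phi> k 0)"
  define w1 where "w1 = enn2real (wmoment \<phi> k (s / ?d))"
  define vS where "vS = measure lborel S"
  have w: "wmoment \<phi> k 0 = ennreal w0" "wmoment \<phi> k (s / ?d) = ennreal w1" "emeasure lborel S = ennreal vS"
    using fin Sfin by (auto simp: w0_def w1_def vS_def emeasure_eq_ennreal_measure ennreal_enn2real)
  have nn: "0 \<le> w0" "0 \<le> w1" "0 \<le> vS" by (auto simp: w0_def w1_def vS_def)
  define a1 where "a1 = bias_const k * (2 * L * ?V powr (- s / ?d) * w1)"
  define a2 where "a2 = bias_const k * (vS * w0)"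
  have a: "0 \<le> a1" "0 \<le> a2" using nn L bias_const_nonneg by (auto simp: a1_def a2_def)
  have "integrable (PiM {1..m} (\<lambda>_. \<mu>)) (knn_term \<phi> k (m - 1) ({1..m} - {j}) j) \<and>
     \<bar>(\<integral>z. knn_term \<phi> k (m - 1) ({1..m} - {j}) j z \<partial>PiM {1..m} (\<lambda>_. \<mu>)) - density_functional f q\<bar>
       \<le> (a1 + a2) * (real (m - 1) powr (- s / ?d) + 1 / real (m - 1))"
    if m: "k + 1 \<le> m" and j: "j \<in> {1..m}" for m j
  proof -
    let ?J = "{1..m} - {j}" and ?P = "PiM {1..m} (\<lambda>_. \<mu>)"
    have cJ: "card ?J = m - 1" "insert j ?J = {1..m}" using j by auto
    have J: "finite ?J" "k \<le> card ?J" "j \<notin> ?J" using m cJ by auto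
    note B = knn_bias[OF k J \<phi> est fin, unfolded cJ, folded knn_term_def]
    have n: "0 < real (m - 1)" using m k by simp
    have "ennreal (bias_const k) *
       (ennreal (2 * L * (real (m - 1) * ?V) powr (- s / ?d)) * ennreal w1
        + ennreal vS * ennreal (1 / real (m - 1)) * ennreal w0)
      = ennreal (bias_const k * (2 * L * (real (m - 1) * ?V) powr (- s / ?d) * w1 + vS * (1 / real (m - 1)) * w0))"
    proof -
      have "ennreal b * (ennreal x * ennreal w1 + ennreal vS * ennreal y * ennreal w0) = ennreal (b * (x * w1 + vS * y * w0))"
        if "0 \<le> b" "0 \<le> x" "0 \<le> y" for b x y :: real
        using nn that by (simp add: ennreal_mult ennreal_plus)
      then show ?thesis using L bias_const_nonneg by simp
    qed
    then have "ennreal \<bar>(\<integral>z. knn_term \<phi> k (m - 1) ?J j z \<partial>?P) - density_functional f q\<bar>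
      \<le> ennreal (bias_const k * (2 * L * (real (m - 1) * ?V) powr (- s / ?d) * w1 + vS * (1 / real (m - 1)) * w0))"
      using B(2) unfolding w by simp
    then have "\<bar>(\<integral>z. knn_term \<phi> k (m - 1) ?J j z \<partial>?P) - density_functional f q\<bar>
      \<le> bias_const k * (2 * L * (real (m - 1) * ?V) powr (- s / ?d) * w1 + vS * (1 / real (m - 1)) * w0)"
      using nn L bias_const_nonneg by (subst (asm) ennreal_le_iff) auto
    also have "\<dots> = a1 * real (m - 1) powr (- s / ?d) + a2 * (1 / real (m - 1))"
      by (simp add: a1_def a2_def powr_mult algebra_simps)
    also have "\<dots> \<le> (a1 + a2) * real (m - 1) powr (- s / ?d) + (a1 + a2) * (1 / real (m - 1))"
      using a by (intro add_mono mult_right_mono) auto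
    finally show ?thesis using B(1) by (simp add: distrib_left knn_term_def[abs_def])
  qed
  then show ?thesis using a by (intro exI[of _ "a1 + a2"]) auto
qed

text \<open>
Combination of \<open>knn_variance\<close> and \<open>knn_mean\<close>; passing from \<open>m - 1\<close> to \<open>m\<close> costs a constant factor.
\<close>
lemma knn_mse:
  assumes k: "1 \<le> k" and \<phi> [measurable]: "\<phi> \<in> borel_measurable borel"
    and est: "is_estimator_function f k \<phi>"
    and fin: "wmoment \<phi> k 0 < \<infinity>" "wmoment \<phi> k (s / real DIM('a)) < \<infinity>"
      "wmoment (\<lambda>u. (\<phi> u)\<^sup>2) k 0 < \<infinity>" "wmoment (\<lambda>u. (\<phi> u)\<^sup>2) (k + 1) 0 < \<infinity>"
  shows "\<exists>K\<ge>0. \<forall>m\<ge>k+2.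
     integrable (PiM {1..m} (\<lambda>_. \<mu>)) (\<lambda>z. ((\<Sum>j\<in>{1..m}. knn_term \<phi> k (m - 1) ({1..m} - {j}) j z) / real m - density_functional f q)\<^sup>2) \<and>
     (\<integral>z. ((\<Sum>j\<in>{1..m}. knn_term \<phi> k (m - 1) ({1..m} - {j}) j z) / real m - density_functional f q)\<^sup>2 \<partial>PiM {1..m} (\<lambda>_. \<mu>))
      \<le> K * (real m powr (- 2 * (s / real DIM('a))) + 1 / real m)"
proof -
  let ?d = "real DIM('a)"
  let ?T = "density_functional f q"
  obtain K where K: "0 \<le> K" "\<And>m. k + 2 \<le> m \<Longrightarrow>
     integrable (PiM {1..m} (\<lambda>_. \<mu>)) (\<lambda>z. (\<Sum>j\<in>{1..m}. knn_term \<phi> k (m - 1) ({1..m} - {j}) j z)\<^sup>2)"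
    "\<And>m. k + 2 \<le> m \<Longrightarrow> (\<integral>z. (\<Sum>j\<in>{1..m}. knn_term \<phi> k (m - 1) ({1..m} - {j}) j z)\<^sup>2 \<partial>PiM {1..m} (\<lambda>_. \<mu>))
      - (\<integral>z. (\<Sum>j\<in>{1..m}. knn_term \<phi> k (m - 1) ({1..m} - {j}) j z) \<partial>PiM {1..m} (\<lambda>_. \<mu>))\<^sup>2 \<le> K * real m"
    using knn_variance[OF k \<phi> fin(3,4)] by blast
  obtain A where A: "0 \<le> A" "\<And>m j. k + 1 \<le> m \<Longrightarrow> j \<in> {1..m} \<Longrightarrow>
      integrable (PiM {1..m} (\<lambda>_. \<mu>)) (knn_term \<phi> k (m - 1) ({1..m} - {j}) j)"
    "\<And>m j. k + 1 \<le> m \<Longrightarrow> j \<in> {1..m} \<Longrightarrow>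
      \<bar>(\<integral>z. knn_term \<phi> k (m - 1) ({1..m} - {j}) j z \<partial>PiM {1..m} (\<lambda>_. \<mu>)) - ?T\<bar>
       \<le> A * (real (m - 1) powr (- s / ?d) + 1 / real (m - 1))"
    using knn_mean[OF k \<phi> est fin(1,2)] by blast
  let ?C = "K + 2 * A\<^sup>2 * (2 powr (2 * (s / ?d)) + 2)"
  have "integrable (PiM {1..m} (\<lambda>_. \<mu>)) (\<lambda>z. ((\<Sum>j\<in>{1..m}. knn_term \<phi> k (m - 1) ({1..m} - {j}) j z) / real m - ?T)\<^sup>2) \<and>
     (\<integral>z. ((\<Sum>j\<in>{1..m}. knn_term \<phi> k (m - 1) ({1..m} - {j}) j z) / real m - ?T)\<^sup>2 \<partial>PiM {1..m} (\<lambda>_. \<mu>))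
      \<le> ?C * (real m powr (- 2 * (s / ?d)) + 1 / real m)"
    if m: "k + 2 \<le> m" for m
  proof -
    let ?P = "PiM {1..m} (\<lambda>_. \<mu>)"
    interpret P: prob_space ?P by (intro prob_space_PiM prob_mu)
    define F where "F = (\<lambda>z. \<Sum>j\<in>{1..m}. knn_term \<phi> k (m - 1) ({1..m} - {j}) j z)"
    have m0: "0 < real m" "0 < real (m - 1)" using m by auto
    have iF2: "integrable ?P (\<lambda>z. (F z)\<^sup>2)" using K(2)[OF m] by (simp add: F_def)
    have iF: "integrable ?P F"
      unfolding F_def using A(2)[of m] m by (intro Bochner_Integration.integrable_sum) auto
    have var: "(\<integral>z. (F z)\<^sup>2 \<partial>?P) - (\<integral>z. F z \<partial>?P)\<^sup>2 \<le> K * real m" using K(3)[OF m] by (simp add: F_def)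
    have sq: "(F z / real m - ?T)\<^sup>2 = (1 / (real m)\<^sup>2) * (F z)\<^sup>2 - (2 * ?T / real m) * F z + ?T\<^sup>2" for z
      by (simp add: power2_diff power_divide algebra_simps)
    have i1: "integrable ?P (\<lambda>z. (1 / (real m)\<^sup>2) * (F z)\<^sup>2)"
      by (intro integrable_mult_right iF2)
    have i2: "integrable ?P (\<lambda>z. (2 * ?T / real m) * F z)"
      by (intro integrable_mult_right iF)
    have int: "integrable ?P (\<lambda>z. (F z / real m - ?T)\<^sup>2)"
      unfolding sq by (intro Bochner_Integration.integrable_add Bochner_Integration.integrable_diff i1 i2 P.integrable_const)
    have "(\<integral>z. (F z / real m - ?T)\<^sup>2 \<partial>?P) = (1 / (real m)\<^sup>2) * (\<integral>z. (F z)\<^sup>2 \<partial>?P) - (2 * ?T / real m) * (\<integral>z. F z \<partial>?P) + ?T\<^sup>2"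
    proof -
      have "(\<integral>z. (F z / real m - ?T)\<^sup>2 \<partial>?P)
        = (\<integral>z. (1 / (real m)\<^sup>2) * (F z)\<^sup>2 - (2 * ?T / real m) * F z \<partial>?P) + (\<integral>z. ?T\<^sup>2 \<partial>?P)"
        unfolding sq by (rule Bochner_Integration.integral_add[OF Bochner_Integration.integrable_diff[OF i1 i2] P.integrable_const])
      also have "(\<integral>z. (1 / (real m)\<^sup>2) * (F z)\<^sup>2 - (2 * ?T / real m) * F z \<partial>?P)
        = (\<integral>z. (1 / (real m)\<^sup>2) * (F z)\<^sup>2 \<partial>?P) - (\<integral>z. (2 * ?T / real m) * F z \<partial>?P)"
        by (rule Bochner_Integration.integral_diff[OF i1 i2])
      finally show ?thesis using P.prob_space by simp
    qed
    also have "\<dots> = (1 / (real m)\<^sup>2) * ((\<integral>z. (F z)\<^sup>2 \<partial>?P) - (\<integral>z. F z \<partial>?P)\<^sup>2) + ((\<integral>z. F z \<partial>?P) / real m - ?T)\<^sup>2"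
      by (simp add: power2_diff power_divide algebra_simps)
    finally have split: "(\<integral>z. (F z / real m - ?T)\<^sup>2 \<partial>?P)
      = (1 / (real m)\<^sup>2) * ((\<integral>z. (F z)\<^sup>2 \<partial>?P) - (\<integral>z. F z \<partial>?P)\<^sup>2) + ((\<integral>z. F z \<partial>?P) / real m - ?T)\<^sup>2" .
    have t1: "(1 / (real m)\<^sup>2) * ((\<integral>z. (F z)\<^sup>2 \<partial>?P) - (\<integral>z. F z \<partial>?P)\<^sup>2) \<le> K * (1 / real m)"
    proof -
      have "(1 / (real m)\<^sup>2) * ((\<integral>z. (F z)\<^sup>2 \<partial>?P) - (\<integral>z. F z \<partial>?P)\<^sup>2) \<le> (1 / (real m)\<^sup>2) * (K * real m)"
        using var by (intro mult_left_mono) auto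
      also have "\<dots> = K * (1 / real m)" using m0 by (simp add: power2_eq_square)
      finally show ?thesis .
    qed
    let ?b = "real (m - 1) powr (- s / ?d) + 1 / real (m - 1)"
    have mean: "\<bar>(\<integral>z. F z \<partial>?P) / real m - ?T\<bar> \<le> A * ?b"
    proof -
      have "(\<integral>z. F z \<partial>?P) = (\<Sum>j\<in>{1..m}. \<integral>z. knn_term \<phi> k (m - 1) ({1..m} - {j}) j z \<partial>?P)"
        unfolding F_def using A(2)[of m] m by (intro Bochner_Integration.integral_sum) auto
      then have "(\<integral>z. F z \<partial>?P) / real m - ?T = (\<Sum>j\<in>{1..m}. (\<integral>z. knn_term \<phi> k (m - 1) ({1..m} - {j}) j z \<partial>?P) - ?T) / real m"
        using m0 by (simp add: sum_subtractf diff_divide_distrib)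
      then have "\<bar>(\<integral>z. F z \<partial>?P) / real m - ?T\<bar> = \<bar>\<Sum>j\<in>{1..m}. (\<integral>z. knn_term \<phi> k (m - 1) ({1..m} - {j}) j z \<partial>?P) - ?T\<bar> / real m"
        by simp
      also have "\<dots> \<le> (\<Sum>j\<in>{1..m}. A * ?b) / real m"
        using A(3)[of m] m by (intro divide_right_mono order_trans[OF sum_abs] sum_mono) auto
      also have "\<dots> = A * ?b" using m0 by simp
      finally show ?thesis .
    qed
    have "((\<integral>z. F z \<partial>?P) / real m - ?T)\<^sup>2 \<le> (A * ?b)\<^sup>2"
      using power_mono[OF mean abs_ge_zero, of 2] by simp
    also have "\<dots> = A\<^sup>2 * ?b\<^sup>2" by (rule power_mult_distrib)
    also have "\<dots> \<le> A\<^sup>2 * (2 * (2 powr (2 * (s / ?d)) + 2) * (real m powr (- 2 * (s / ?d)) + 1 / real m))"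
    proof (rule mult_left_mono)
      have half: "real m / 2 \<le> real (m - 1)" using m by simp
      have "?b\<^sup>2 \<le> 2 * (real (m - 1) powr (- s / ?d))\<^sup>2 + 2 * (1 / real (m - 1))\<^sup>2"
      proof -
        have "(a + b)\<^sup>2 \<le> 2 * a\<^sup>2 + 2 * b\<^sup>2" for a b :: real
        proof -
          have "0 \<le> (a - b)\<^sup>2" by simp
          then show ?thesis unfolding power2_diff power2_sum by simp
        qed
        then show ?thesis .
      qed
      also have "(real (m - 1) powr (- s / ?d))\<^sup>2 = real (m - 1) powr (- 2 * (s / ?d))"
        using m0 by (simp add: powr_power)
      also have "\<dots> \<le> (real m / 2) powr (- 2 * (s / ?d))"
        using half m0 s by (intro powr_mono2') auto
      also have "\<dots> = 2 powr (2 * (s / ?d)) * real m powr (- 2 * (s / ?d))"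
        using m0 by (simp add: powr_divide powr_minus field_simps)
      also have "(1 / real (m - 1))\<^sup>2 \<le> 2 / real m"
      proof -
        have "(1 / real (m - 1))\<^sup>2 \<le> 1 / real (m - 1)"
        proof -
          have "1 / real (m - 1) \<le> 1" using m by simp
          then have "1 / real (m - 1) * (1 / real (m - 1)) \<le> 1 * (1 / real (m - 1))"
            by (intro mult_right_mono) auto
          then show ?thesis by (simp add: power2_eq_square)
        qed
        also have "\<dots> \<le> 1 / (real m / 2)" using half m0 by (intro divide_left_mono) auto
        finally show ?thesis by simp
      qed
      finally have "?b\<^sup>2 \<le> 2 * (2 powr (2 * (s / ?d)) * real m powr (- 2 * (s / ?d))) + 2 * (2 / real m)"
        by simp
      also have "\<dots> \<le> 2 * ((2 powr (2 * (s / ?d)) + 2) * real m powr (- 2 * (s / ?d))) + 2 * ((2 powr (2 * (s / ?d)) + 2) * (1 / real m))"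
        using m0 by (intro add_mono mult_left_mono mult_right_mono) (auto simp: field_simps)
      finally show "?b\<^sup>2 \<le> 2 * (2 powr (2 * (s / ?d)) + 2) * (real m powr (- 2 * (s / ?d)) + 1 / real m)"
        by (simp add: algebra_simps)
    qed simp
    finally have t2: "((\<integral>z. F z \<partial>?P) / real m - ?T)\<^sup>2
      \<le> A\<^sup>2 * (2 * (2 powr (2 * (s / ?d)) + 2) * (real m powr (- 2 * (s / ?d)) + 1 / real m))" .
    have "(\<integral>z. (F z / real m - ?T)\<^sup>2 \<partial>?P) \<le> K * (1 / real m) +
       A\<^sup>2 * (2 * (2 powr (2 * (s / ?d)) + 2) * (real m powr (- 2 * (s / ?d)) + 1 / real m))"
      unfolding split by (rule add_mono[OF t1 t2])
    also have "\<dots> \<le> K * (real m powr (- 2 * (s / ?d)) + 1 / real m) +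
       A\<^sup>2 * (2 * (2 powr (2 * (s / ?d)) + 2) * (real m powr (- 2 * (s / ?d)) + 1 / real m))"
      using K(1) by (intro add_mono mult_left_mono) auto
    also have "\<dots> = ?C * (real m powr (- 2 * (s / ?d)) + 1 / real m)" by (simp add: algebra_simps)
    finally show ?thesis using int unfolding F_def by blast
  qed
  moreover have "0 \<le> ?C" using K(1) by simp
  ultimately show ?thesis by blast
qed

end

section \<open>Measurability of the estimator\<close>

text \<open>
Coinciding sample points can leave fewer than \<open>k\<close> distinct neighbours, and \<open>knn_dist\<close> is then a list entry
beyond the end of the list. This entry depends only on the length of the list, which suffices for
measurability.
\<close>
lemma nth_beyond_length: "length xs \<le> n \<Longrightarrow> xs ! n = [] ! (n - length xs)"
  by (induction xs arbitrary: n) (auto simp: nth_Cons split: nat.splits)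

definition first_occurrences :: "(nat \<Rightarrow> 'b) \<Rightarrow> nat set \<Rightarrow> nat set" where
  "first_occurrences x J = {j\<in>J. \<forall>l\<in>J. l < j \<longrightarrow> x l \<noteq> x j}"

lemma first_occurrences:
  "inj_on x (first_occurrences x J)" "x ` first_occurrences x J = x ` J"
proof -
  show "inj_on x (first_occurrences x J)"
  proof (rule inj_onI)
    fix a b assume "a \<in> first_occurrences x J" "b \<in> first_occurrences x J" "x a = x b"
    then show "a = b" by (cases a b rule: linorder_cases) (auto simp: first_occurrences_def)
  qed
  have "\<exists>l\<in>first_occurrences x J. x j = x l" if "j \<in> J" for j
  proof -
    define l where "l = (LEAST l. l \<in> J \<and> x l = x j)"
    have l: "l \<in> J \<and> x l = x j" unfolding l_def by (rule LeastI[of _ j]) (use that in simp)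
    have "x l' \<noteq> x l" if "l' \<in> J" "l' < l" for l'
      using not_less_Least[of l' "\<lambda>l. l \<in> J \<and> x l = x j"] that l unfolding l_def[symmetric] by auto
    then show ?thesis using l by (auto simp: first_occurrences_def)
  qed
  then show "x ` first_occurrences x J = x ` J"
    by (auto simp: image_iff first_occurrences_def) 
qed

text \<open>
Since \<open>knn_dist\<close> sees the set of sample points, repetitions are first removed by keeping the smallest index
of each point.
\<close>
lemma knn_dist_le_iff:
  fixes x :: "nat \<Rightarrow> 'a::metric_space"
  assumes J: "finite J" and k: "1 \<le> k"
  shows "knn_dist k y (x ` J) \<le> t \<longleftrightarrow>
    (if k \<le> card (first_occurrences x J) then k \<le> card {j \<in> first_occurrences x J. dist y (x j) \<le> t}
     else ([] ! (k - 1 - card (first_occurrences x J)) :: real) \<le> t)"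
proof -
  let ?F = "first_occurrences x J"
  have F: "finite ?F" using J by (simp add: first_occurrences_def)
  have "knn_dist k y (x ` J) = kth_smallest k (dist y) (x ` ?F)"
    by (simp add: knn_dist_def kth_smallest_def first_occurrences(2))
  also have "\<dots> = kth_smallest k (\<lambda>j. dist y (x j)) ?F"
    by (rule kth_smallest_image[OF first_occurrences(1)])
  finally have e: "knn_dist k y (x ` J) = kth_smallest k (\<lambda>j. dist y (x j)) ?F" .
  show ?thesis
  proof (cases "k \<le> card ?F")
    case True
    then show ?thesis using kth_smallest_iff(1)[OF F k True] by (simp add: e)
  next
    case False
    let ?L = "sorted_list_of_multiset (image_mset (\<lambda>j. dist y (x j)) (mset_set ?F))"
    have "length ?L = card ?F"
      using length_filter_sorted_image[OF F, of "\<lambda>_. True" "\<lambda>j. dist y (x j)"] by simp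
    then have "?L ! (k - 1) = [] ! (k - 1 - card ?F)" using False nth_beyond_length[of ?L "k - 1"] by simp
    then show ?thesis using False by (simp add: e kth_smallest_def)
  qed
qed

text \<open>
Measurability has to hold on the whole space, including the null event of ties, because the underlying
probability space need not be complete.
\<close>
lemma borel_measurable_knn_dist:
  fixes X :: "nat \<Rightarrow> 'w \<Rightarrow> 'a::euclidean_space"
  assumes J: "finite J" and k: "1 \<le> k" and X: "\<And>j. j \<in> insert i J \<Longrightarrow> X j \<in> borel_measurable M"
  shows "(\<lambda>\<omega>. knn_dist k (X i \<omega>) ((\<lambda>j. X j \<omega>) ` J)) \<in> borel_measurable M"
proof (subst borel_measurable_iff_le, intro allI)
  fix t :: real
  let ?F = "\<lambda>\<omega>. first_occurrences (\<lambda>j. X j \<omega>) J"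
  have d: "(\<lambda>\<omega>. dist (X l \<omega>) (X j \<omega>)) \<in> borel_measurable M" if "l \<in> insert i J" "j \<in> insert i J" for l j
    using that by (intro borel_measurable_dist X)
  have ne: "Measurable.pred M (\<lambda>\<omega>. X l \<omega> \<noteq> X j \<omega>)" if "l \<in> J" "j \<in> J" for l j
  proof -
    have [measurable]: "(\<lambda>\<omega>. dist (X l \<omega>) (X j \<omega>)) \<in> borel_measurable M" using that by (intro d) auto
    have "Measurable.pred M (\<lambda>\<omega>. 0 < dist (X l \<omega>) (X j \<omega>))" by measurable
    then show ?thesis by simp
  qed
  have occ: "Measurable.pred M (\<lambda>\<omega>. \<forall>l\<in>J. l < j \<longrightarrow> X l \<omega> \<noteq> X j \<omega>)" if "j \<in> J" for j
  proof -
    have "{\<omega>\<in>space M. \<forall>l\<in>{l\<in>J. l < j}. X l \<omega> \<noteq> X j \<omega>} \<in> sets M"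
    proof (rule sets.sets_Collect_finite_All)
      show "finite {l\<in>J. l < j}" using J by simp
      show "{\<omega>\<in>space M. X l \<omega> \<noteq> X j \<omega>} \<in> sets M" if "l \<in> {l\<in>J. l < j}" for l
        using ne[of l j] that \<open>j \<in> J\<close> unfolding pred_def by blast
    qed
    moreover have "{\<omega>\<in>space M. \<forall>l\<in>{l\<in>J. l < j}. X l \<omega> \<noteq> X j \<omega>} = {\<omega>\<in>space M. \<forall>l\<in>J. l < j \<longrightarrow> X l \<omega> \<noteq> X j \<omega>}"
      by auto
    ultimately show ?thesis by (simp only: pred_def)
  qed
  have le: "Measurable.pred M (\<lambda>\<omega>. dist (X i \<omega>) (X j \<omega>) \<le> t)" if "j \<in> J" for j
  proof -
    have [measurable]: "(\<lambda>\<omega>. dist (X i \<omega>) (X j \<omega>)) \<in> borel_measurable M" using that by (intro d) auto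
    show ?thesis by measurable
  qed
  have m1: "Measurable.pred M (\<lambda>\<omega>. Q (?F \<omega>))" for Q
    unfolding first_occurrences_def by (rule pred_filter_set[OF J occ])
  have "Measurable.pred M (\<lambda>\<omega>. k \<le> card {j\<in>J. (\<forall>l\<in>J. l < j \<longrightarrow> X l \<omega> \<noteq> X j \<omega>) \<and> dist (X i \<omega>) (X j \<omega>) \<le> t})"
    by (rule pred_filter_set[OF J, where Q = "\<lambda>A. k \<le> card A"], rule pred_intros_logic(3)[OF occ le])
  moreover have "{j\<in>J. (\<forall>l\<in>J. l < j \<longrightarrow> X l \<omega> \<noteq> X j \<omega>) \<and> dist (X i \<omega>) (X j \<omega>) \<le> t}
    = {j \<in> ?F \<omega>. dist (X i \<omega>) (X j \<omega>) \<le> t}" for \<omega>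
    by (auto simp: first_occurrences_def)
  ultimately have m2: "Measurable.pred M (\<lambda>\<omega>. k \<le> card {j \<in> ?F \<omega>. dist (X i \<omega>) (X j \<omega>) \<le> t})"
    by (simp only:)
  have "Measurable.pred M (\<lambda>\<omega>. (k \<le> card (?F \<omega>) \<and> k \<le> card {j \<in> ?F \<omega>. dist (X i \<omega>) (X j \<omega>) \<le> t}) \<or>
     (\<not> k \<le> card (?F \<omega>) \<and> ([] ! (k - 1 - card (?F \<omega>)) :: real) \<le> t))"
    by (intro pred_intros_logic m1[of "\<lambda>A. k \<le> card A"] m2 m1[of "\<lambda>A. ([] ! (k - 1 - card A) :: real) \<le> t"])
  moreover have "((k \<le> card (?F \<omega>) \<and> k \<le> card {j \<in> ?F \<omega>. dist (X i \<omega>) (X j \<omega>) \<le> t}) \<or>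
     (\<not> k \<le> card (?F \<omega>) \<and> ([] ! (k - 1 - card (?F \<omega>)) :: real) \<le> t))
     \<longleftrightarrow> knn_dist k (X i \<omega>) ((\<lambda>j. X j \<omega>) ` J) \<le> t" for \<omega>
    unfolding knn_dist_le_iff[OF J k] by auto
  ultimately show "{\<omega> \<in> space M. knn_dist k (X i \<omega>) ((\<lambda>j. X j \<omega>) ` J) \<le> t} \<in> sets M"
    by (simp only: pred_def)
qed

lemma measure_lborel_ball:
  "measure lborel (ball (c :: 'a::euclidean_space) r) = unit_ball_vol (real DIM('a)) * max 0 r ^ DIM('a)"
proof (cases "0 \<le> r")
  case True
  then show ?thesis using content_ball[of r c] by (simp add: max_def)
next
  case False
  then have "ball c r = {}" "max 0 r = 0" by auto
  then show ?thesis by (simp add: zero_power)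
qed

lemma knn_volume_eq:
  fixes x :: "nat \<Rightarrow> 'a::euclidean_space"
  assumes inj: "inj_on x {1..m}" and k: "1 \<le> k" "k + 1 \<le> m" and i: "i \<in> {1..m}"
  shows "knn_volume k m x i = real (m - 1) *
     (unit_ball_vol (real DIM('a)) * kth_smallest k (\<lambda>l. dist (x i) (x l)) ({1..m} - {i}) ^ DIM('a))"
proof -
  let ?J = "{1..m} - {i}"
  have "inj_on x ?J" using inj by (rule inj_on_subset) auto
  then have "knn_dist k (x i) (x ` ?J) = kth_smallest k (\<lambda>l. dist (x i) (x l)) ?J"
    using kth_smallest_image[of x ?J k "dist (x i)"] by (simp add: knn_dist_def kth_smallest_def)
  moreover have "kth_smallest k (\<lambda>l. dist (x i) (x l)) ?J \<in> (\<lambda>l. dist (x i) (x l)) ` ?J"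
    using k i by (intro kth_smallest_mem) auto
  then have "0 \<le> kth_smallest k (\<lambda>l. dist (x i) (x l)) ?J" by auto
  ultimately show ?thesis
    using k by (simp add: knn_volume_def measure_lborel_ball of_nat_diff)
qed

lemma borel_measurable_knn_estimator:
  fixes X :: "nat \<Rightarrow> 'w \<Rightarrow> 'a::euclidean_space"
  assumes k: "1 \<le> k" "1 \<le> m" and X: "\<And>j. j \<in> {1..m} \<Longrightarrow> X j \<in> borel_measurable M"
    and \<phi>: "\<psi> \<in> borel_measurable borel" "\<And>u. 0 \<le> u \<Longrightarrow> \<psi> u = \<phi> u"
  shows "(\<lambda>\<omega>. knn_estimator \<phi> k m (\<lambda>i. X i \<omega>)) \<in> borel_measurable M"
proof -
  have v: "(\<lambda>\<omega>. knn_volume k m (\<lambda>i. X i \<omega>) i) \<in> borel_measurable M" if i: "i \<in> {1..m}" for i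
  proof -
    have [measurable]: "(\<lambda>\<omega>. knn_dist k (X i \<omega>) ((\<lambda>j. X j \<omega>) ` ({1..m} - {i}))) \<in> borel_measurable M"
      using i by (intro borel_measurable_knn_dist k X) auto
    show ?thesis unfolding knn_volume_def measure_lborel_ball by measurable
  qed
  have "0 \<le> knn_volume k m x i" for x :: "nat \<Rightarrow> 'a" and i
    using k by (simp add: knn_volume_def)
  then have "(\<lambda>\<omega>. knn_estimator \<phi> k m (\<lambda>i. X i \<omega>)) = (\<lambda>\<omega>. (\<Sum>i=1..m. \<psi> (knn_volume k m (\<lambda>i. X i \<omega>) i)) / real m)"
    by (simp add: knn_estimator_def \<phi>(2))
  moreover have "\<dots> \<in> borel_measurable M"
    by (intro borel_measurable_divide borel_measurable_sum measurable_compose[OF v \<phi>(1)] borel_measurable_const)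
  ultimately show ?thesis by simp
qed

text \<open>
Integrability against one exponential already contains measurability on the positive half-line.
\<close>
lemma estimator_function_measurable:
  assumes "is_estimator_function f k \<phi>"
  shows "(\<lambda>u. indicator {0<..} u * \<phi> u) \<in> borel_measurable borel"
proof -
  have "set_integrable lborel {0<..} (\<lambda>u. u ^ (k - 1) * \<phi> u * exp (- 1 * u))"
    using assms unfolding is_estimator_function_def by (metis zero_less_one)
  then have m: "(\<lambda>u. indicator {0<..} u *\<^sub>R (u ^ (k - 1) * \<phi> u * exp (- 1 * u))) \<in> borel_measurable borel"
    unfolding set_integrable_def by (auto dest: borel_measurable_integrable)
  have e: "(\<lambda>u::real. exp u / u ^ (k - 1)) \<in> borel_measurable borel" by measurable
  have "indicator {0<..} u * \<phi> u =
     (indicator {0<..} u *\<^sub>R (u ^ (k - 1) * \<phi> u * exp (- 1 * u))) * (exp u / u ^ (k - 1))" for u :: real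
  proof (cases "0 < u")
    case True
    have "exp (- 1 * u) * exp u = 1" by (simp add: exp_minus)
    moreover have "u ^ (k - 1) * (1 / u ^ (k - 1)) = 1" using True by simp
    ultimately have "u ^ (k - 1) * \<phi> u * exp (- 1 * u) * (exp u / u ^ (k - 1)) = \<phi> u"
      using True by simp
    then show ?thesis using True by simp
  qed simp
  then show ?thesis using borel_measurable_times[OF m e] by simp
qed

section \<open>The support of a density and the rate exponent\<close>

lemma prob_space_density_measure:
  assumes "prob_density p"
  shows "prob_space (density_measure p)"
proof
  show "emeasure (density_measure p) (space (density_measure p)) = 1"
    using assms unfolding density_measure_def prob_density_def
    by (subst emeasure_density) auto
qed

lemma dsupp_complement:
  assumes p: "prob_density p"
  shows "- dsupp p = \<Union>{B. \<exists>x r. 0 < r \<and> B = ball x r \<and> emeasure (density_measure p) (ball x r) = 0}" (is "_ = \<Union>?F")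
proof (intro equalityI subsetI)
  interpret P: prob_space "density_measure p" by (rule prob_space_density_measure[OF p])
  fix x
  { assume "x \<in> - dsupp p"
    then obtain r where r: "0 < r" "\<not> 0 < measure (density_measure p) (ball x r)"
      by (auto simp: dsupp_def)
    then have "measure (density_measure p) (ball x r) = 0"
      by (metis measure_nonneg order_le_less)
    then have e: "emeasure (density_measure p) (ball x r) = 0"
      by (simp only: P.emeasure_eq_measure ennreal_0)
    have "ball x r \<in> ?F" using r(1) e by blast
    moreover have "x \<in> ball x r" using r(1) by simp
    ultimately show "x \<in> \<Union>?F" by (rule UnionI) }
  { assume "x \<in> \<Union>?F"
    then obtain B where "B \<in> ?F" "x \<in> B" by (rule UnionE)
    then obtain y r where yr: "0 < r" "x \<in> ball y r" "emeasure (density_measure p) (ball y r) = 0" by blast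
    let ?e = "r - dist y x"
    have e: "0 < ?e" using yr by simp
    have "ball x ?e \<subseteq> ball y r"
    proof
      fix z assume "z \<in> ball x ?e"
      then show "z \<in> ball y r" using dist_triangle[of y z x] by simp
    qed
    then have "emeasure (density_measure p) (ball x ?e) \<le> emeasure (density_measure p) (ball y r)"
      by (intro emeasure_mono) (auto simp: density_measure_def)
    then have "measure (density_measure p) (ball x ?e) = 0" using yr(3) by (simp add: measure_def)
    then have "\<not> 0 < measure (density_measure p) (ball x ?e)" by (simp only: less_irrefl not_False_eq_True)
    then have "\<not> (\<forall>r>0. 0 < measure (density_measure p) (ball x r))" using e by blast
    then show "x \<in> - dsupp p" unfolding dsupp_def by (simp only: Compl_iff mem_Collect_eq not_False_eq_True) }
qed

lemma closed_dsupp: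
  assumes p: "prob_density p"
  shows "closed (dsupp p)"
  unfolding closed_def dsupp_complement[OF p] by (intro open_Union) auto

text \<open>
By the Lindelof property, countably many null balls cover the complement of the support.
\<close>
lemma AE_dsupp:
  fixes p :: "'a::euclidean_space \<Rightarrow> real"
  assumes p: "prob_density p"
  shows "AE x in lborel. x \<notin> dsupp p \<longrightarrow> p x = 0"
proof -
  let ?F = "{B. \<exists>x r. 0 < r \<and> B = ball x r \<and> emeasure (density_measure p) (ball x r) = 0}"
  have [measurable]: "p \<in> borel_measurable borel" and p0: "\<And>x. 0 \<le> p x"
    using p by (auto simp: prob_density_def)
  have "\<And>B. B \<in> ?F \<Longrightarrow> open B" by auto
  from Lindelof[OF this] obtain F' where F': "F' \<subseteq> ?F" "countable F'" "\<Union>F' = \<Union>?F" by blast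
  have "\<Union>F' \<in> null_sets (density_measure p)"
  proof -
    have "(\<Union>B\<in>F'. B) \<in> null_sets (density_measure p)"
      by (rule null_sets_UN'[OF F'(2)]) (use F'(1) in \<open>auto simp: null_sets_def density_measure_def\<close>)
    then show ?thesis by simp
  qed
  then have "- dsupp p \<in> null_sets (density_measure p)"
    unfolding F'(3) dsupp_complement[OF p, symmetric] .
  then have "AE x in lborel. x \<in> - dsupp p \<longrightarrow> ennreal (p x) = 0"
    unfolding density_measure_def by (subst (asm) null_sets_density_iff) auto
  then show ?thesis
  proof eventually_elim
    case (elim x)
    show ?case
    proof
      assume "x \<notin> dsupp p"
      then have "p x \<le> 0" using elim by (simp add: ennreal_eq_0_iff)
      then show "p x = 0" using p0[of x] by simp
    qed
  qed
qed

text \<open>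
The function \<open>f\<close> is measurable on the positive half-line because it is, up to explicit factors, a Laplace
transform. The product with \<open>t\<close> does not see the value of \<open>f\<close> at \<open>0\<close>.
\<close>
lemma functional_integrand_measurable:
  fixes f \<phi> :: "real \<Rightarrow> real"
  assumes est: "is_estimator_function f k \<phi>" and k: "1 \<le> k"
  shows "(\<lambda>t. if 0 < t then f t * t else 0) \<in> borel_measurable borel"
proof -
  define \<phi>1 where "\<phi>1 = (\<lambda>u. indicator {0<..} u * \<phi> u)"
  have [measurable]: "\<phi>1 \<in> borel_measurable borel"
    unfolding \<phi>1_def by (rule estimator_function_measurable[OF est])
  have "(\<lambda>t::real. \<integral>u. u ^ (k - 1) * \<phi>1 u * exp (- t * u) \<partial>lborel) \<in> borel_measurable borel"
    by (intro lborel.borel_measurable_lebesgue_integral) measurable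
  then have m: "(\<lambda>t::real. if 0 < t then (\<integral>u. u ^ (k - 1) * \<phi>1 u * exp (- t * u) \<partial>lborel) * t ^ k / Gamma (real k) * t else 0) \<in> borel_measurable borel"
    by measurable
  have "(\<integral>u. u ^ (k - 1) * \<phi>1 u * exp (- t * u) \<partial>lborel) * t ^ k / Gamma (real k) = f t" if t: "0 < t" for t
  proof -
    have "(\<integral>u. u ^ (k - 1) * \<phi>1 u * exp (- t * u) \<partial>lborel) = (LINT u:{0<..}|lborel. u ^ (k - 1) * \<phi> u * exp (- t * u))"
      unfolding set_lebesgue_integral_def \<phi>1_def by (intro Bochner_Integration.integral_cong) auto
    also have "\<dots> = Gamma (real k) * f t / t ^ k"
      using est t by (simp add: is_estimator_function_def)
    finally have "(\<integral>u. u ^ (k - 1) * \<phi>1 u * exp (- t * u) \<partial>lborel) = Gamma (real k) * f t / t ^ k" .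
    moreover have "Gamma (real k) \<noteq> 0"
      using Gamma_real_pos[of "real k"] k less_imp_neq[of 0 "Gamma (real k)"] by force
    ultimately show ?thesis using t by simp
  qed
  then have "(\<lambda>t. if 0 < t then f t * t else 0) = (\<lambda>t::real. if 0 < t then (\<integral>u. u ^ (k - 1) * \<phi>1 u * exp (- t * u) \<partial>lborel) * t ^ k / Gamma (real k) * t else 0)"
    by (auto simp: fun_eq_iff)
  then show ?thesis using m by simp
qed

lemma density_functional_cong_AE:
  assumes est: "is_estimator_function f k \<phi>" and k: "1 \<le> k"
    and [measurable]: "p \<in> borel_measurable borel" "q \<in> borel_measurable borel"
    and nn: "\<And>x. 0 \<le> p x" "\<And>x. 0 \<le> q x" and eq: "AE x in lborel. p x = q x"
  shows "density_functional f p = density_functional f q"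
proof -
  have pw: "f (g x) * g x = (\<lambda>t. if 0 < t then f t * t else 0) (g x)" if "\<And>x. 0 \<le> g x" for g :: "'a \<Rightarrow> real" and x
    using that[of x] by auto
  have e: "density_functional f g = (\<integral>x. (\<lambda>t. if 0 < t then f t * t else 0) (g x) \<partial>lborel)"
    if "\<And>x. 0 \<le> g x" for g :: "'a \<Rightarrow> real"
    unfolding density_functional_def by (intro Bochner_Integration.integral_cong refl pw that)
  show ?thesis unfolding e[OF nn(1)] e[OF nn(2)]
  proof (rule integral_cong_AE)
    show "AE x in lborel. (\<lambda>t. if 0 < t then f t * t else 0) (p x) = (\<lambda>t. if 0 < t then f t * t else 0) (q x)"
      using eq by eventually_elim simp
    show "(\<lambda>x. (\<lambda>t. if 0 < t then f t * t else 0) (p x)) \<in> borel_measurable lborel"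
      by (rule measurable_compose[OF _ functional_integrand_measurable[OF est k]]) simp
    show "(\<lambda>x. (\<lambda>t. if 0 < t then f t * t else 0) (q x)) \<in> borel_measurable lborel"
      by (rule measurable_compose[OF _ functional_integrand_measurable[OF est k]]) simp
  qed
qed

context knn_model begin

text \<open>
Comparison with two Gamma integrals; the exponents \<open>\<alpha>\<close> and \<open>\<beta>\<close> bound the growth of \<open>\<psi>\<close> at zero and
at infinity.
\<close>
lemma wmoment_finite:
  assumes bound: "\<And>u. 0 < u \<Longrightarrow> \<bar>\<psi> u\<bar> \<le> K * (u powr \<alpha> + u powr \<beta>)" and K: "0 \<le> K"
    and \<alpha>: "0 < \<alpha> + \<theta> + real k" and \<beta>: "0 < \<beta> + \<theta> + real k" and k: "1 \<le> k"
  shows "wmoment \<psi> k \<theta> < \<infinity>"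
proof -
  let ?g = "\<lambda>\<gamma> u. ennreal (u powr (\<gamma> + \<theta> + real (k - 1)) * exp (- (lo / 2) * u)) * indicator {0<..} u"
  have "wmoment \<psi> k \<theta> \<le> (\<integral>\<^sup>+u. ennreal K * (?g \<alpha> u + ?g \<beta> u) \<partial>lborel)"
    unfolding wmoment_def
  proof (rule nn_integral_mono)
    fix u :: real
    show "ennreal (\<bar>\<psi> u\<bar> * (u powr \<theta> * (u ^ (k - 1) * exp (- (lo / 2 * u))))) * indicator {0<..} u
      \<le> ennreal K * (?g \<alpha> u + ?g \<beta> u)"
    proof (cases "0 < u")
      case True
      have "\<bar>\<psi> u\<bar> * (u powr \<theta> * (u ^ (k - 1) * exp (- (lo / 2 * u))))
        \<le> (K * (u powr \<alpha> + u powr \<beta>)) * (u powr \<theta> * (u ^ (k - 1) * exp (- (lo / 2 * u))))"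
        using bound[OF True] True by (intro mult_right_mono) auto
      also have "\<dots> = K * (u powr (\<alpha> + \<theta> + real (k - 1)) * exp (- (lo / 2) * u) + u powr (\<beta> + \<theta> + real (k - 1)) * exp (- (lo / 2) * u))"
      proof -
        have "u powr (\<gamma> + \<theta> + real (k - 1)) = u powr \<gamma> * u powr \<theta> * u ^ (k - 1)" for \<gamma>
          using True by (simp add: powr_add powr_realpow)
        then show ?thesis by (simp add: algebra_simps)
      qed
      finally show ?thesis using True K
        by (simp add: ennreal_mult[symmetric] ennreal_plus[symmetric] ennreal_leI del: ennreal_plus)
    qed simp
  qed
  also have "\<dots> = ennreal K * ((\<integral>\<^sup>+u. ?g \<alpha> u \<partial>lborel) + (\<integral>\<^sup>+u. ?g \<beta> u \<partial>lborel))"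
    by (subst nn_integral_cmult) (auto simp: nn_integral_add)
  also have "\<dots> < \<infinity>"
    using nn_integral_powr_exp_finite[of "\<alpha> + \<theta> + real (k - 1)" "lo / 2"]
      nn_integral_powr_exp_finite[of "\<beta> + \<theta> + real (k - 1)" "lo / 2"] \<alpha> \<beta> k lo
    by (simp add: ennreal_mult_less_top of_nat_diff)
  finally show ?thesis .
qed

end

lemma rate_exponent_bounds:
  assumes \<sigma>: "0 < \<sigma>" and k: "1 \<le> k" "real k > - 2 * a" and d: "0 < d"
  shows "0 < rate_exponent d \<sigma> a k" and "rate_exponent d \<sigma> a k \<le> min \<sigma> 1 / real d"
proof -
  let ?t = "(real k + a) / (real k - 1)"
  have t: "0 < ?t" "?t \<le> 1" if "a \<le> -1"
  proof -
    have "0 < real k - 1" "0 < real k + a" using k that by auto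
    then show "0 < ?t" "?t \<le> 1" using that by (auto simp: field_simps)
  qed
  have c1: "a \<le> -1" if "a \<le> - \<sigma> / real d - 1"
  proof -
    have "0 < \<sigma> / real d" using \<sigma> d by simp
    then show ?thesis using that by simp
  qed
  define r where "r = (if a \<le> - \<sigma> / real d - 1 then min \<sigma> 1 * ?t else if a \<le> -1 then min \<sigma> ?t else min \<sigma> 1)"
  have r: "rate_exponent d \<sigma> a k = r / real d"
    by (simp add: rate_exponent_def r_def)
  have "0 < min \<sigma> 1 * ?t" if "a \<le> -1"
    using t[OF that] \<sigma> by (intro mult_pos_pos) auto
  then have "0 < r" using c1 t(1) \<sigma> unfolding r_def by auto
  then show "0 < rate_exponent d \<sigma> a k" unfolding r using d by simp
  have "r \<le> min \<sigma> 1"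
  proof -
    have "min \<sigma> 1 * ?t \<le> min \<sigma> 1 * 1" if "a \<le> -1"
      using t[OF that] \<sigma> by (intro mult_left_mono) auto
    then show ?thesis using c1 t(2) unfolding r_def by auto
  qed
  then show "rate_exponent d \<sigma> a k \<le> min \<sigma> 1 / real d"
    unfolding r by (rule divide_right_mono) simp
qed

text \<open>
The exponent \<open>0\<close> of the logarithm is admissible because \<open>ln (G m) \<noteq> 0\<close> eventually; the convention
\<open>0 powr 0 = 0\<close> would otherwise spoil the bound.
\<close>
lemma soft_O_I:
  fixes F G :: "nat \<Rightarrow> real"
  assumes G: "G \<longlonglongrightarrow> 0" "\<And>m. m \<ge> N \<Longrightarrow> 0 < G m" and FG: "\<And>m. m \<ge> N \<Longrightarrow> \<bar>F m\<bar> \<le> K * G m"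
  shows "F \<in> soft_O G"
proof -
  have "eventually (\<lambda>m. G m < 1) sequentially" using G(1) by (rule order_tendstoD) simp
  moreover have "eventually (\<lambda>m. N \<le> m) sequentially" by (rule eventually_ge_at_top)
  ultimately have "eventually (\<lambda>m. norm (F m) \<le> K * norm (G m * \<bar>ln (G m)\<bar> powr 0)) sequentially"
  proof eventually_elim
    case (elim m)
    have "ln (G m) < 0" using elim G(2) by simp
    then have "\<bar>ln (G m)\<bar> powr 0 = 1" by simp
    then show ?case using FG[of m] G(2)[of m] elim by simp
  qed
  then have "F \<in> O(\<lambda>m. G m * \<bar>ln (G m)\<bar> powr 0)" by (rule bigoI)
  then show ?thesis unfolding soft_O_def by blast
qed

lemma regular_lower_bound:
  fixes S :: "'a::euclidean_space set"
  assumes reg: "r > 0" "(INF x\<in>S. INF r'\<in>{0<..r}. measure lborel (ball x r' \<inter> S) / measure lborel (ball x r')) > 0"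
  shows "\<exists>c>0. \<forall>x\<in>S. \<forall>r'. 0 < r' \<and> r' \<le> r \<longrightarrow>
     c * (unit_ball_vol (real DIM('a)) * r' ^ DIM('a)) \<le> measure lborel (ball x r' \<inter> S)"
proof -
  let ?R = "\<lambda>x r'. measure lborel (ball x r' \<inter> S) / measure lborel (ball x r')"
  define c where "c = (INF x\<in>S. INF r'\<in>{0<..r}. ?R x r')"
  have c: "0 < c" using reg(2) by (simp add: c_def)
  have b1: "bdd_below (?R x ` {0<..r})" for x by (rule bdd_belowI[of _ 0]) auto
  have ge0: "0 \<le> (INF r'\<in>{0<..r}. ?R x r')" for x
    using reg(1) by (intro cINF_greatest) auto
  have b2: "bdd_below ((\<lambda>x. INF r'\<in>{0<..r}. ?R x r') ` S)" using ge0 by (intro bdd_belowI[of _ 0]) auto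
  have "c * (unit_ball_vol (real DIM('a)) * r' ^ DIM('a)) \<le> measure lborel (ball x r' \<inter> S)"
    if x: "x \<in> S" and r': "0 < r'" "r' \<le> r" for x r'
  proof -
    have "c \<le> (INF r'\<in>{0<..r}. ?R x r')" unfolding c_def by (rule cINF_lower[OF b2 x])
    also have "\<dots> \<le> ?R x r'" using r' by (intro cINF_lower[OF b1]) auto
    finally have "c \<le> ?R x r'" .
    moreover have "measure lborel (ball x r') = unit_ball_vol (real DIM('a)) * r' ^ DIM('a)"
      using r' by (intro content_ball) simp
    moreover have "0 < unit_ball_vol (real DIM('a)) * r' ^ DIM('a)" using r' by simp
    ultimately show ?thesis by (simp only: pos_le_divide_eq)
  qed
  then show ?thesis using c by blast
qed

text \<open>
The density is set to zero outside its support and cut off at its essential bound, both on null sets. The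
thickness of the support is given up to a radius \<open>r\<close>; comparing a larger ball with the ball of
radius \<open>r\<close> extends it, with a smaller constant, up to the radius \<open>D\<close>.
\<close>
lemma knn_model_exists:
  fixes p :: "'a::euclidean_space \<Rightarrow> real"
  assumes dens: "prob_density p"
    and upper: "\<exists>Cp>0. AE x in lborel. p x \<le> Cp"
    and lower: "\<exists>cp>0. \<forall>x\<in>dsupp p. p x \<ge> cp"
    and bdd: "bounded (dsupp p)"
    and regular: "\<exists>r>0. (INF x\<in>dsupp p. INF r'\<in>{0<..r}.
                    measure lborel (ball x r' \<inter> dsupp p) / measure lborel (ball x r')) > 0"
    and sigma: "0 < \<sigma>" "\<sigma> \<le> 2"
    and hoelder: "hoelder_on \<sigma> p (interior (dsupp p))"
    and bdry: "hausdorff_measure (DIM('a) - 1) (frontier (dsupp p)) < \<infinity>"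
  shows "\<exists>q lo Mx D L. knn_model q (dsupp p) lo Mx D L (min \<sigma> 1) \<and> (AE x in lborel. p x = q x)"
proof -
  let ?S = "dsupp p"
  let ?V = "unit_ball_vol (real DIM('a))"
  have pm [measurable]: "p \<in> borel_measurable borel" and p0: "\<And>x. 0 \<le> p x" and p1: "(\<integral>\<^sup>+x. ennreal (p x) \<partial>lborel) = 1"
    using dens by (auto simp: prob_density_def)
  obtain Cp where Cp: "0 < Cp" "AE x in lborel. p x \<le> Cp" using upper by blast
  obtain cp where cp: "0 < cp" "\<And>x. x \<in> ?S \<Longrightarrow> cp \<le> p x" using lower by blast
  have closed: "closed ?S" by (rule closed_dsupp[OF dens])
  have compact: "compact ?S" using closed bdd by (simp add: compact_eq_bounded_closed)
  have Sm [measurable]: "?S \<in> sets borel" using closed by (rule borel_closed)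
  define q where "q = (\<lambda>x. if x \<in> ?S then min (p x) Cp else 0)"
  have qm [measurable]: "q \<in> borel_measurable borel" unfolding q_def by measurable
  have pq: "AE x in lborel. p x = q x"
    using AE_dsupp[OF dens] Cp(2) by eventually_elim (auto simp: q_def)
  have q1: "(\<integral>\<^sup>+x. ennreal (q x) \<partial>lborel) = 1"
    unfolding p1[symmetric] by (rule nn_integral_cong_AE) (use pq in eventually_elim, simp)
  obtain r where r: "0 < r" "(INF x\<in>?S. INF r'\<in>{0<..r}.
                    measure lborel (ball x r' \<inter> ?S) / measure lborel (ball x r')) > 0"
    using regular by blast
  obtain c where c: "0 < c" "\<And>x r'. x \<in> ?S \<Longrightarrow> 0 < r' \<Longrightarrow> r' \<le> r \<Longrightarrow>
     c * (?V * r' ^ DIM('a)) \<le> measure lborel (ball x r' \<inter> ?S)"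
    using regular_lower_bound[OF r] by blast
  define D where "D = max (diameter ?S) r"
  define m0 where "m0 = min cp Cp"
  \<comment> \<open>The second term is the mass bound for radii up to \<open>D\<close>, the first the bound on the density.\<close>
  define lo where "lo = min m0 (m0 * (c * (r / D) ^ DIM('a)))"
  have D: "0 < D" "r \<le> D" using r by (auto simp: D_def)
  have m0: "0 < m0" using cp Cp by (simp add: m0_def)
  have lo: "0 < lo" using m0 c r D by (simp add: lo_def)
  have qlo: "m0 \<le> q x" if "x \<in> ?S" for x
    using cp(2)[OF that] that by (auto simp: q_def m0_def)
  have mass_leb: "c * (r / D) ^ DIM('a) * (?V * r' ^ DIM('a)) \<le> measure lborel (ball x r' \<inter> ?S)"
    if x: "x \<in> ?S" and r': "0 < r'" "r' \<le> D" for x r'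
  proof (cases "r' \<le> r")
    case True
    have "(r / D) ^ DIM('a) \<le> 1" using r D by (intro power_le_one) auto
    then have "c * (r / D) ^ DIM('a) \<le> c * 1" using c by (intro mult_left_mono) auto
    then have "c * (r / D) ^ DIM('a) * (?V * r' ^ DIM('a)) \<le> c * 1 * (?V * r' ^ DIM('a))"
      using r' by (intro mult_right_mono) auto
    also have "\<dots> \<le> measure lborel (ball x r' \<inter> ?S)" using c(2)[OF x r'(1) True] by simp
    finally show ?thesis .
  next
    case False
    have "(r / D * r') ^ DIM('a) \<le> r ^ DIM('a)"
    proof (rule power_mono)
      have "r / D * r' \<le> r / D * D" using r r' D by (intro mult_left_mono) auto
      then show "r / D * r' \<le> r" using D by simp
    qed (use r r' D in auto)
    then have "c * (?V * (r / D * r') ^ DIM('a)) \<le> c * (?V * r ^ DIM('a))"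
      using c by (intro mult_left_mono) auto
    also have "\<dots> \<le> measure lborel (ball x r \<inter> ?S)" using c(2)[OF x r(1)] by simp
    also have "\<dots> \<le> measure lborel (ball x r' \<inter> ?S)"
    proof (rule measure_mono_fmeasurable)
      show "ball x r \<inter> ?S \<subseteq> ball x r' \<inter> ?S" using False by auto
      show "ball x r \<inter> ?S \<in> sets lborel" by simp
      have "emeasure lborel (ball x r' \<inter> ?S) \<le> emeasure lborel (ball x r')" by (intro emeasure_mono) auto
      also have "\<dots> < \<infinity>" using r' by (simp add: emeasure_ball)
      finally show "ball x r' \<inter> ?S \<in> fmeasurable lborel" by (intro fmeasurableI) auto
    qed
    finally show ?thesis by (simp only: power_mult_distrib mult_ac)
  qed
  have qC: "q x \<le> Cp" for x using Cp by (simp add: q_def)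
  have q0: "0 \<le> q x" for x using p0 Cp by (simp add: q_def)
  obtain L1 where L1: "0 \<le> L1" "\<And>b t x. b \<in> Basis \<Longrightarrow> closed_segment x (x + t *\<^sub>R b) \<subseteq> interior ?S \<Longrightarrow>
     \<bar>p (x + t *\<^sub>R b) - p x\<bar> \<le> L1 * \<bar>t\<bar> powr (min \<sigma> 1)"
    using hoelder_on_directional[OF hoelder sigma bounded_interior[OF bdd]] by blast
  have "\<exists>C\<ge>0. \<forall>h. (\<integral>\<^sup>+x. ennreal \<bar>q (x + h) - q x\<bar> \<partial>lborel) \<le> ennreal (C * norm h powr (min \<sigma> 1))"
  proof (rule L1_modulus[OF qm q0 qC _ q1 compact bdry])
    show "x \<notin> ?S \<Longrightarrow> q x = 0" for x by (simp add: q_def)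
    show "0 < min \<sigma> 1" "min \<sigma> 1 \<le> 1" "0 \<le> L1" using sigma L1 by auto
    fix b :: 'a and t x assume b: "b \<in> Basis" and seg: "closed_segment x (x + t *\<^sub>R b) \<subseteq> interior ?S"
    have "x \<in> interior ?S" "x + t *\<^sub>R b \<in> interior ?S" using seg by (auto simp: subset_eq)
    then have "x \<in> ?S" "x + t *\<^sub>R b \<in> ?S" using interior_subset[of ?S] by auto
    then have "\<bar>q (x + t *\<^sub>R b) - q x\<bar> \<le> \<bar>p (x + t *\<^sub>R b) - p x\<bar>" by (simp add: q_def min_def)
    then show "\<bar>q (x + t *\<^sub>R b) - q x\<bar> \<le> L1 * \<bar>t\<bar> powr (min \<sigma> 1)" using L1(2)[OF b seg] by linarith
  qed
  then obtain L where L: "0 \<le> L" "\<And>h. (\<integral>\<^sup>+x. ennreal \<bar>q (x + h) - q x\<bar> \<partial>lborel) \<le> ennreal (L * norm h powr (min \<sigma> 1))"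
    by blast
  have "knn_model q ?S lo (max 1 Cp) D L (min \<sigma> 1)"
  proof
    show "q \<in> borel_measurable borel" by (rule qm)
    show "0 \<le> q x" for x by (rule q0)
    show "q x \<le> max 1 Cp" for x using qC[of x] by simp
    show "x \<notin> ?S \<Longrightarrow> q x = 0" for x by (simp add: q_def)
    show "lo \<le> q x" if "x \<in> ?S" for x using qlo[OF that] by (simp add: lo_def min_le_iff_disj)
    show "0 < lo" "1 \<le> max 1 Cp" "?S \<in> sets borel" using lo Sm by auto
    show "emeasure lborel ?S < \<infinity>" by (rule emeasure_compact_finite[OF compact])
    show "(\<integral>\<^sup>+x. ennreal (q x) \<partial>lborel) = 1" by (rule q1)
    show "dist x y \<le> D" if "x \<in> ?S" "y \<in> ?S" for x y
      using diameter_bounded_bound[OF bdd that] by (simp add: D_def)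
    show "(\<integral>\<^sup>+x. ennreal \<bar>q (x + h) - q x\<bar> \<partial>lborel) \<le> ennreal (L * norm h powr (min \<sigma> 1))" for h by (rule L(2))
    show "0 \<le> L" "0 < min \<sigma> 1" using L sigma by auto
    show "lo * (?V * r' ^ DIM('a)) \<le> measure (density lborel (\<lambda>x. ennreal (q x))) (ball x r')"
      if x: "x \<in> ?S" and r': "0 \<le> r'" "r' \<le> D" for x r'
    proof (cases "r' = 0")
      case True
      then show ?thesis by (simp add: zero_power)
    next
      case False
      let ?Q = "density lborel (\<lambda>x. ennreal (q x))"
      interpret Q: prob_space ?Q
        by standard (subst emeasure_density, auto simp: q1)
      have fin: "emeasure lborel (ball x r' \<inter> ?S) \<noteq> \<infinity>"
      proof -
        have "emeasure lborel (ball x r' \<inter> ?S) \<le> emeasure lborel (ball x r')" by (intro emeasure_mono) auto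
        also have "\<dots> < \<infinity>" using r' by (simp add: emeasure_ball)
        finally show ?thesis by simp
      qed
      have "lo * (?V * r' ^ DIM('a)) \<le> m0 * (c * (r / D) ^ DIM('a)) * (?V * r' ^ DIM('a))"
        using r' by (intro mult_right_mono) (auto simp: lo_def)
      also have "\<dots> \<le> m0 * measure lborel (ball x r' \<inter> ?S)"
        using mass_leb[OF x _ r'(2)] False r' m0 by (simp add: mult.assoc mult_left_mono)
      finally have "ennreal (lo * (?V * r' ^ DIM('a))) \<le> ennreal (m0 * measure lborel (ball x r' \<inter> ?S))"
        by (rule ennreal_leI)
      also have "\<dots> = ennreal m0 * emeasure lborel (ball x r' \<inter> ?S)"
        using m0 fin by (simp add: ennreal_mult emeasure_eq_ennreal_measure)
      also have "\<dots> = (\<integral>\<^sup>+z. ennreal m0 * indicator (ball x r' \<inter> ?S) z \<partial>lborel)"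
        by (rule nn_integral_cmult_indicator[symmetric]) simp
      also have "\<dots> \<le> (\<integral>\<^sup>+z. ennreal (q z) * indicator (ball x r') z \<partial>lborel)"
        by (intro nn_integral_mono) (auto simp: indicator_def intro!: ennreal_leI qlo)
      also have "\<dots> = emeasure ?Q (ball x r')" by (subst emeasure_density) auto
      also have "\<dots> = ennreal (measure ?Q (ball x r'))" by (rule Q.emeasure_eq_measure)
      finally show ?thesis by (subst (asm) ennreal_le_iff) auto
    qed
  qed
  then show ?thesis using pq by blast
qed

lemma (in prob_space) distr_iid_vector:
  fixes X :: "nat \<Rightarrow> 'a \<Rightarrow> 'b::euclidean_space"
  assumes indep: "indep_vars (\<lambda>_. borel) X {1..}"
    and law: "\<And>i. 1 \<le> i \<Longrightarrow> distr M borel (X i) = \<nu>" and m: "1 \<le> m"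
  shows "distr M (PiM {1..m} (\<lambda>_. borel)) (\<lambda>\<omega>. \<lambda>i\<in>{1..m}. X i \<omega>) = PiM {1..m} (\<lambda>_. \<nu>)"
proof -
  have "indep_vars (\<lambda>_. borel) X {1..m}" by (rule indep_vars_subset[OF indep]) auto
  moreover have "random_variable borel (X i)" if "i \<in> {1..m}" for i
    using indep that by (auto simp: indep_vars_def)
  ultimately have "distr M (PiM {1..m} (\<lambda>_. borel)) (\<lambda>\<omega>. \<lambda>i\<in>{1..m}. X i \<omega>) = PiM {1..m} (\<lambda>i. distr M borel (X i))"
    using m by (subst (asm) indep_vars_iff_distr_eq_PiM') auto
  also have "\<dots> = PiM {1..m} (\<lambda>_. \<nu>)" by (rule PiM_cong) (auto simp: law)
  finally show ?thesis .
qed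

section \<open>The convergence rate\<close>

theorem mainTheorem6:
  fixes p :: "'a::euclidean_space \<Rightarrow> real"
    and f \<phi> :: "real \<Rightarrow> real"
    and a b C \<sigma> :: real
    and k :: nat
    and M :: "'w measure"
    and X :: "nat \<Rightarrow> 'w \<Rightarrow> 'a"
  assumes dens: "prob_density p"
    and M: "prob_space M"
    and indep: "prob_space.indep_vars M (\<lambda>_. borel) X {1..}"
    and distr: "\<And>i. i \<ge> 1 \<Longrightarrow> distributed M lborel (X i) (\<lambda>x. ennreal (p x))"
    and k: "k \<ge> 1" "real k > - 2 * a"
    and phi: "is_estimator_function f k \<phi>"
    and envelope: "\<And>u. u > 0 \<Longrightarrow> \<bar>\<phi> u\<bar> \<le> C * poly_envelope a b u"
    and upper: "\<exists>Cp>0. AE x in lborel. p x \<le> Cp"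
    and lower: "\<exists>cp>0. \<forall>x\<in>dsupp p. p x \<ge> cp"
    and bdd: "bounded (dsupp p)"
    and regular: "\<exists>r>0. (INF x\<in>dsupp p. INF r'\<in>{0<..r}.
                    measure lborel (ball x r' \<inter> dsupp p) / measure lborel (ball x r')) > 0"
    and sigma: "0 < \<sigma>" "\<sigma> \<le> 2"
    and hoelder: "hoelder_on \<sigma> p (interior (dsupp p))"
    and bdry: "hausdorff_measure (DIM('a) - 1) (frontier (dsupp p)) < \<infinity>"
  shows "(\<forall>\<^sub>F m in sequentially.
            integrable M (\<lambda>\<omega>. (knn_estimator \<phi> k m (\<lambda>i. X i \<omega>) - density_functional f p)\<^sup>2)) \<and>
         (\<lambda>m. \<integral>\<omega>. (knn_estimator \<phi> k m (\<lambda>i. X i \<omega>) - density_functional f p)\<^sup>2 \<partial>M)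
           \<in> soft_O (\<lambda>m. real m powr (- 2 * rate_exponent (DIM('a)) \<sigma> a k) + real m powr (- 1))"
proof -
  interpret M: prob_space M by fact
  let ?d = "real DIM('a)"
  let ?s = "min \<sigma> 1"
  let ?T = "density_functional f p"
  have pm [measurable]: "p \<in> borel_measurable borel" and p0: "\<And>x. 0 \<le> p x"
    using dens by (auto simp: prob_density_def)
  obtain q lo Mx D L where model: "knn_model q (dsupp p) lo Mx D L ?s" and pq: "AE x in lborel. p x = q x"
    using knn_model_exists[OF dens upper lower bdd regular sigma hoelder bdry] by blast
  interpret knn_model q "dsupp p" lo Mx D L ?s by (rule model)
  \<comment> \<open>Borel on the whole line and equal to \<open>\<phi>\<close> at all attainable volumes, among them \<open>0\<close>\<close>
  define \<psi> where "\<psi> = (\<lambda>u::real. if 0 < u then \<phi> u else if u = 0 then \<phi> 0 else 0)"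
  have \<psi>: "\<psi> \<in> borel_measurable borel"
  proof -
    have "\<psi> = (\<lambda>u. indicator {0<..} u * \<phi> u + indicator {0} u * \<phi> 0)"
      by (auto simp: \<psi>_def fun_eq_iff indicator_def)
    moreover have "(\<lambda>u::real. indicator {0} u * \<phi> 0) \<in> borel_measurable borel"
      by (intro borel_measurable_times borel_measurable_indicator borel_measurable_const) auto
    ultimately show ?thesis using borel_measurable_add[OF estimator_function_measurable[OF phi]] by simp
  qed
  have \<psi>\<phi>: "\<psi> u = \<phi> u" if "0 \<le> u" for u using that by (auto simp: \<psi>_def)
  have est: "is_estimator_function f k \<psi>"
  proof -
    have "set_integrable lborel {0<..} (\<lambda>u. u ^ (k - 1) * \<psi> u * exp (- s * u))
      = set_integrable lborel {0<..} (\<lambda>u. u ^ (k - 1) * \<phi> u * exp (- s * u))" for s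
      by (rule set_integrable_cong) (auto simp: \<psi>_def)
    moreover have "(LINT u:{0<..}|lborel. u ^ (k - 1) * \<psi> u * exp (- s * u))
      = (LINT u:{0<..}|lborel. u ^ (k - 1) * \<phi> u * exp (- s * u))" for s
      by (rule set_lebesgue_integral_cong) (auto simp: \<psi>_def)
    ultimately show ?thesis using phi unfolding is_estimator_function_def by simp
  qed
  have C0: "0 \<le> C" using envelope[of 1] by (simp add: poly_envelope_def)
  \<comment> \<open>Raising \<open>b\<close> to \<open>max b 0\<close> keeps both powers of the envelope integrable near zero.\<close>
  let ?b = "max b 0"
  have env: "\<bar>\<psi> u\<bar> \<le> C * (u powr a + u powr ?b)" if u: "0 < u" for u
  proof -
    have "poly_envelope a b u \<le> u powr a + u powr ?b"
    proof (cases "u \<le> 1")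
      case False
      then have "u powr b \<le> u powr ?b" by (intro powr_mono) auto
      then show ?thesis using False by (simp add: poly_envelope_def add_increasing)
    qed (simp add: poly_envelope_def)
    then have "C * poly_envelope a b u \<le> C * (u powr a + u powr ?b)" using C0 by (rule mult_left_mono)
    then show ?thesis using envelope[OF u] \<psi>\<phi>[of u] u by simp
  qed
  have env2: "\<bar>(\<psi> u)\<^sup>2\<bar> \<le> 2 * C\<^sup>2 * (u powr (2 * a) + u powr (2 * ?b))" if u: "0 < u" for u
  proof -
    have sq: "(x + y)\<^sup>2 \<le> 2 * x\<^sup>2 + 2 * y\<^sup>2" for x y :: real
    proof -
      have "0 \<le> (x - y)\<^sup>2" by simp
      then show ?thesis unfolding power2_diff power2_sum by simp
    qed
    have "\<bar>(\<psi> u)\<^sup>2\<bar> \<le> (C * (u powr a + u powr ?b))\<^sup>2"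
      using power_mono[OF env[OF u] abs_ge_zero, of 2] by simp
    also have "\<dots> = C\<^sup>2 * (u powr a + u powr ?b)\<^sup>2" by (rule power_mult_distrib)
    also have "\<dots> \<le> C\<^sup>2 * (2 * (u powr a)\<^sup>2 + 2 * (u powr ?b)\<^sup>2)" by (intro mult_left_mono sq) simp
    also have "(u powr a)\<^sup>2 = u powr (2 * a)" using u by (simp add: powr_power mult.commute)
    also have "(u powr ?b)\<^sup>2 = u powr (2 * ?b)" using u by (simp add: powr_power mult.commute)
    finally show ?thesis by (simp add: algebra_simps)
  qed
  have a_pos: "0 < a + real k" using k by (cases "0 \<le> a") auto
  have s_pos: "0 < ?s / ?d" using sigma by simp
  have fin: "wmoment \<psi> k 0 < \<infinity>" "wmoment \<psi> k (?s / ?d) < \<infinity>"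
    "wmoment (\<lambda>u. (\<psi> u)\<^sup>2) k 0 < \<infinity>" "wmoment (\<lambda>u. (\<psi> u)\<^sup>2) (k + 1) 0 < \<infinity>"
  proof -
    show "wmoment \<psi> k 0 < \<infinity>"
      by (rule wmoment_finite[OF env C0]) (use a_pos k in auto)
    show "wmoment \<psi> k (?s / ?d) < \<infinity>"
      by (rule wmoment_finite[OF env C0]) (use a_pos s_pos k in \<open>linarith | simp\<close>)+
    show "wmoment (\<lambda>u. (\<psi> u)\<^sup>2) k 0 < \<infinity>"
      by (rule wmoment_finite[OF env2]) (use k in auto)
    show "wmoment (\<lambda>u. (\<psi> u)\<^sup>2) (k + 1) 0 < \<infinity>"
      by (rule wmoment_finite[OF env2]) (use k in auto)
  qed
  have Teq: "density_functional f q = ?T"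
    by (rule density_functional_cong_AE[OF phi k(1) pm q_meas p0 q0 pq, symmetric])
  obtain K where K: "0 \<le> K" "\<And>m. k + 2 \<le> m \<Longrightarrow>
     integrable (PiM {1..m} (\<lambda>_. \<mu>)) (\<lambda>z. ((\<Sum>j\<in>{1..m}. knn_term \<psi> k (m - 1) ({1..m} - {j}) j z) / real m - ?T)\<^sup>2)"
    "\<And>m. k + 2 \<le> m \<Longrightarrow> (\<integral>z. ((\<Sum>j\<in>{1..m}. knn_term \<psi> k (m - 1) ({1..m} - {j}) j z) / real m - ?T)\<^sup>2 \<partial>PiM {1..m} (\<lambda>_. \<mu>))
      \<le> K * (real m powr (- 2 * (?s / ?d)) + 1 / real m)"
    using knn_mse[OF k(1) \<psi> est fin] unfolding Teq by blast
  have law: "distr M borel (X i) = \<mu>" if "1 \<le> i" for i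
  proof -
    have "distr M borel (X i) = distr M lborel (X i)" by (rule distr_cong) auto
    also have "\<dots> = density lborel (\<lambda>x. ennreal (p x))" using distr[OF that] by (simp add: distributed_def)
    also have "\<dots> = \<mu>" unfolding \<mu>_def by (rule density_cong) (use pq in auto)
    finally show ?thesis .
  qed
  have X: "X i \<in> borel_measurable M" if "1 \<le> i" for i
    using indep that by (auto simp: M.indep_vars_def)
  have mse: "integrable M (\<lambda>\<omega>. (knn_estimator \<phi> k m (\<lambda>i. X i \<omega>) - ?T)\<^sup>2)"
    "(\<integral>\<omega>. (knn_estimator \<phi> k m (\<lambda>i. X i \<omega>) - ?T)\<^sup>2 \<partial>M) \<le> K * (real m powr (- 2 * (?s / ?d)) + 1 / real m)"
    if m: "k + 2 \<le> m" for m
  proof -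
    let ?Y = "\<lambda>\<omega>. \<lambda>i\<in>{1..m}. X i \<omega>"
    let ?P = "PiM {1..m} (\<lambda>_. \<mu>)"
    let ?H = "\<lambda>z. ((\<Sum>j\<in>{1..m}. knn_term \<psi> k (m - 1) ({1..m} - {j}) j z) / real m - ?T)\<^sup>2"
    let ?e = "\<lambda>\<omega>. (knn_estimator \<phi> k m (\<lambda>i. X i \<omega>) - ?T)\<^sup>2"
    have m1: "1 \<le> m" using m by simp
    have Y: "?Y \<in> measurable M (PiM {1..m} (\<lambda>_. borel))"
      by (intro measurable_restrict X) auto
    have Ylaw: "distr M (PiM {1..m} (\<lambda>_. borel)) ?Y = ?P"
      by (rule M.distr_iid_vector[OF indep law m1])
    have "AE z in ?P. inj_on z {1..m}"
      using AE_PiM_dist_inj[OF prob_mu sets_mu mu_sphere, of "{1..m}" 0]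
    proof (rule AE_mp)
      show "finite {1..m}" by simp
      show "AE z in ?P. inj_on (\<lambda>j. dist 0 (z j)) {1..m} \<longrightarrow> inj_on z {1..m}"
        by (intro AE_I2 impI, rule inj_on_imageI2[of "dist 0"]) (simp only: comp_def)
    qed
    then have "AE z in distr M (PiM {1..m} (\<lambda>_. borel)) ?Y. inj_on z {1..m}"
      by (simp only: Ylaw)
    from AE_distrD[OF Y this] have inj: "AE \<omega> in M. inj_on (?Y \<omega>) {1..m}" .
    have eq: "AE \<omega> in M. ?e \<omega> = ?H (?Y \<omega>)"
      using inj
    proof eventually_elim
      case (elim \<omega>)
      have "inj_on (?Y \<omega>) {1..m} \<longleftrightarrow> inj_on (\<lambda>i. X i \<omega>) {1..m}"
        by (rule inj_on_cong) simp
      then have inj': "inj_on (\<lambda>i. X i \<omega>) {1..m}" using elim by (rule iffD1)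
      have "knn_estimator \<phi> k m (\<lambda>i. X i \<omega>) = (\<Sum>j\<in>{1..m}. knn_term \<psi> k (m - 1) ({1..m} - {j}) j (?Y \<omega>)) / real m"
        unfolding knn_estimator_def
      proof (intro arg_cong[where f = "\<lambda>x. x / real m"] sum.cong refl)
        fix j assume j: "j \<in> {1..m}"
        have "kth_smallest k (\<lambda>l. dist (X j \<omega>) (X l \<omega>)) ({1..m} - {j})
          = kth_smallest k (\<lambda>l. dist (?Y \<omega> j) (?Y \<omega> l)) ({1..m} - {j})"
          using j by (intro kth_smallest_cong) auto
        then have v: "knn_volume k m (\<lambda>i. X i \<omega>) j = real (m - 1) *
          (unit_ball_vol ?d * kth_smallest k (\<lambda>l. dist (?Y \<omega> j) (?Y \<omega> l)) ({1..m} - {j}) ^ DIM('a))"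
          using knn_volume_eq[OF inj' k(1) _ j] m by simp
        have "0 \<le> knn_volume k m (\<lambda>i. X i \<omega>) j" using m1 by (simp add: knn_volume_def)
        then have "\<phi> (knn_volume k m (\<lambda>i. X i \<omega>) j) = \<psi> (knn_volume k m (\<lambda>i. X i \<omega>) j)" by (simp add: \<psi>\<phi>)
        then show "\<phi> (knn_volume k m (\<lambda>i. X i \<omega>) j) = knn_term \<psi> k (m - 1) ({1..m} - {j}) j (?Y \<omega>)"
          unfolding v knn_term_def .
      qed
      then show ?case by (simp only:)
    qed
    have em: "?e \<in> borel_measurable M"
      by (intro borel_measurable_power borel_measurable_diff borel_measurable_const
          borel_measurable_knn_estimator[OF k(1) m1 X \<psi> \<psi>\<phi>]) auto
    have Hm: "?H \<in> borel_measurable (PiM {1..m} (\<lambda>_. borel))"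
    proof -
      have "(borel_measurable ?P :: ((nat \<Rightarrow> 'a) \<Rightarrow> real) set) = borel_measurable (PiM {1..m} (\<lambda>_. borel))"
        by (intro measurable_cong_sets sets_PiM_cong) auto
      then show ?thesis using borel_measurable_integrable[OF K(2)[OF m]] by (simp only:)
    qed
    have HY: "(\<lambda>\<omega>. ?H (?Y \<omega>)) \<in> borel_measurable M" by (rule measurable_compose[OF Y Hm])
    have "integrable M (\<lambda>\<omega>. ?H (?Y \<omega>))"
      using K(2)[OF m] integrable_distr_eq[OF Y Hm] unfolding Ylaw by blast
    then show "integrable M ?e" using integrable_cong_AE[OF em HY eq] by blast
    have "(\<integral>\<omega>. ?e \<omega> \<partial>M) = (\<integral>\<omega>. ?H (?Y \<omega>) \<partial>M)" by (rule integral_cong_AE[OF em HY eq])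
    also have "\<dots> = (\<integral>z. ?H z \<partial>?P)" unfolding Ylaw[symmetric] by (rule integral_distr[OF Y Hm, symmetric])
    also have "\<dots> \<le> K * (real m powr (- 2 * (?s / ?d)) + 1 / real m)" by (rule K(3)[OF m])
    finally show "(\<integral>\<omega>. ?e \<omega> \<partial>M) \<le> K * (real m powr (- 2 * (?s / ?d)) + 1 / real m)" .
  qed
  let ?l = "rate_exponent DIM('a) \<sigma> a k"
  note rate = rate_exponent_bounds[OF sigma(1) k DIM_positive[where 'a = 'a]]
  show ?thesis
  proof
    show "\<forall>\<^sub>F m in sequentially. integrable M (\<lambda>\<omega>. (knn_estimator \<phi> k m (\<lambda>i. X i \<omega>) - ?T)\<^sup>2)"
      using eventually_ge_at_top[of "k + 2"] by eventually_elim (rule mse(1))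
    show "(\<lambda>m. \<integral>\<omega>. (knn_estimator \<phi> k m (\<lambda>i. X i \<omega>) - ?T)\<^sup>2 \<partial>M)
           \<in> soft_O (\<lambda>m. real m powr (- 2 * ?l) + real m powr (- 1))"
    proof (rule soft_O_I[where N = "k + 2" and K = K])
      have "(\<lambda>m. real m powr (- 2 * ?l) + real m powr (- 1)) \<longlonglongrightarrow> 0 + 0"
        using rate(1) by (intro tendsto_add tendsto_neg_powr filterlim_real_sequentially) auto
      then show "(\<lambda>m. real m powr (- 2 * ?l) + real m powr (- 1)) \<longlonglongrightarrow> 0" by simp
      fix m assume m: "k + 2 \<le> m"
      then have m1: "1 \<le> real m" by simp
      show "0 < real m powr (- 2 * ?l) + real m powr (- 1)" using m by (intro add_pos_pos) auto
      have "real m powr (- 2 * (?s / ?d)) \<le> real m powr (- 2 * ?l)"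
        using rate(2) m1 by (intro powr_mono) auto
      moreover have "1 / real m = real m powr (- 1)" using m1 by (simp add: powr_minus_divide)
      ultimately have "K * (real m powr (- 2 * (?s / ?d)) + 1 / real m) \<le> K * (real m powr (- 2 * ?l) + real m powr (- 1))"
        using K(1) by (intro mult_left_mono) auto
      moreover have "0 \<le> (\<integral>\<omega>. (knn_estimator \<phi> k m (\<lambda>i. X i \<omega>) - ?T)\<^sup>2 \<partial>M)" by simp
      ultimately show "\<bar>\<integral>\<omega>. (knn_estimator \<phi> k m (\<lambda>i. X i \<omega>) - ?T)\<^sup>2 \<partial>M\<bar> \<le> K * (real m powr (- 2 * ?l) + real m powr (- 1))"
        using mse(2)[OF m] by linarith
    qed
  qed
qed

end
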